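(* Assume $\Sigma_1\Sigma_2+\Sigma_1\Sigma_3+\Sigma_2\Sigma_3>0$ and $\Sigma_i+\Sigma_j>0$ for all $i\neq j$. Let $(c_1,c_2,c_3,U)^n$ and $(c_1,c_2,c_3,U)^{n-1}$ be given with $c_1^k+c_2^k+c_3^k=1$ for $k=n-1,n$, and let $(c_1,c_2,c_3,\mu_1,\mu_2,\mu_3,U)^{n+1}$ solve the second order scheme $$\frac{3c_i^{n+1}-4c_i^n+c_i^{n-1}}{2\delta t}=\frac{M_0}{\Sigma_i}\Delta\mu_i^{n+1},\quad i=1,2,3,$$ $$\mu_i^{n+1}=-\frac34\epsilon\Sigma_i\Delta c_i^{n+1}+\frac{24}{\epsilon}H_i^\dagger U^{n+1}+\beta^{n+1},\quad i=1,2,3,$$ $$3U^{n+1}-4U^n+U^{n-1}=\sum_{i=1}^3H_i^\dagger\big(3c_i^{n+1}-4c_i^n+c_i^{n-1}\big).$$ Then the scheme is unconditionally energy stable: for every $\delta t>0$, $$\frac1{\delta t}\big(E_{bdf}^{n+1}-E_{bdf}^n\big)\le-M_0\Big(\frac{1}{\Sigma_1}\|\nabla\mu_1^{n+1}\|^2+\frac{1}{\Sigma_2}\|\nabla\mu_2^{n+1}\|^2+\frac{1}{\Sigma_3}\|\nabla\mu_3^{n+1}\|^2\Big)$$ $$\le-M_0\underline{\Sigma}\Big(\frac{\|\nabla\mu_1^{n+1}\|^2}{\Sigma_1^2}+\frac{\|\nabla\mu_2^{n+1}\|^2}{\Sigma_2^2}+\frac{\|\nabla\mu_3^{n+1}\|^2}{\Sigma_3^2}\Big),$$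 where $$E_{bdf}^n=\sum_{i=1}^3\frac38\Sigma_i\epsilon\Big(\frac{\|\nabla c_i^n\|^2}{2}+\frac{\|2\nabla c_i^n-\nabla c_i^{n-1}\|^2}{2}\Big)+\frac{12}{\epsilon}\Big(\frac{\|U^n\|^2}{2}+\frac{\|2U^n-U^{n-1}\|^2}{2}\Big)-\frac{12}{\epsilon}B|\Omega|.$$
   Context: Let $d\in\{2,3\}$ and let $\Omega\subset\mathbb{R}^d$ be a smooth, open, bounded, connected domain (a rectangular box when periodic boundary conditions are used). $(f,g)=\int_\Omega fg\,dx$, $\|f\|=\sqrt{(f,f)}$. Parameters: $\epsilon>0$, $M_0>0$, $\Lambda\ge0$, time step $\delta t>0$; surface tensions $\sigma_{12},\sigma_{13},\sigma_{23}>0$ (with $\sigma_{ij}=\sigma_{ji}$); $\Sigma_i=\sigma_{ij}+\sigma_{ik}-\sigma_{jk}$ for $\{i,j,k\}=\{1,2,3\}$, which may be negative but are assumed nonzero with $\frac1{\Sigma_1}+\frac1{\Sigma_2}+\frac1{\Sigma_3}\ne0$; $\Sigma_T$ is defined by $\frac{3}{\Sigma_T}=\frac1{\Sigma_1}+\frac1{\Sigma_2}+\frac1{\Sigma_3}$. Under the assumed conditions on the $\Sigma_i$, there exists a constant $\underline\Sigma>0$ such that $\Sigma_1|\xi_1|^2+\Sigma_2|\xi_2|^2+\Sigma_3|\xi_3|^2\ge\underline\Sigma(|\xi_1|^2+|\xi_2|^2+|\xi_3|^2)$ whenever $\xi_1+\xi_2+\xi_3=0$; $\underline\Sigma$ denotes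 such a constant. $F(c_1,c_2,c_3)=\sum_{i=1}^3\frac{\Sigma_i}{2}c_i^2(1-c_i)^2+3\Lambda c_1^2c_2^2c_3^2$, and $B$ is a constant such that $F+B>0$ on the hyperplane $S=\{c\in\mathbb{R}^3:c_1+c_2+c_3=1\}$. For $c\in S$ and $\{i,j,k\}=\{1,2,3\}$ set $$\mathcal{H}_i(c)=\frac12\,\frac{\Sigma_i(c_i-c_i^2)(1-2c_i)+6\Lambda c_ic_j^2c_k^2}{\sqrt{F(c)+B}}.$$ Let $c_i^\dagger=2c_i^n-c_i^{n-1}$, $H_i^\dagger=\mathcal{H}_i(c_1^\dagger,c_2^\dagger,c_3^\dagger)$, and $\beta^{n+1}=-\frac{8}{\epsilon}\Sigma_T\big(\frac{H_1^\dagger}{\Sigma_1}+\frac{H_2^\dagger}{\Sigma_2}+\frac{H_3^\dagger}{\Sigma_3}\big)U^{n+1}$. Boundary conditions (at every time level): either (i) all variables are periodic, or (ii) $\partial_{\mathbf n}c_i=\partial_{\mathbf n}\mu_i=0$ on $\partial\Omega$, $i=1,2,3$. Regularity: the functions $c_i,\mu_i$ lie in $H^2(\Omega)$ (periodic in case (i)), $U\in L^2(\Omega)$, and the equations hold almost everywhere. *)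

theory Defs
  imports "HOL-Analysis.Analysis"
begin

section \<open>Smooth functions and smooth domains\<close>

text \<open>
  Continuous partial derivatives up to order \<open>k\<close> on an open set \<open>S\<close>; derivatives are taken along
  the standard basis.
\<close>

primrec Ck_on :: "nat \<Rightarrow> 'a::euclidean_space set \<Rightarrow> ('a \<Rightarrow> 'b::real_normed_vector) \<Rightarrow> bool" where
  "Ck_on 0 S f \<longleftrightarrow> continuous_on S f"
| "Ck_on (Suc k) S f \<longleftrightarrow>
     (\<forall>x\<in>S. f differentiable (at x)) \<and>
     (\<forall>i\<in>Basis. Ck_on k S (\<lambda>x. frechet_derivative f (at x) i))"

definition smooth_on :: "'a::euclidean_space set \<Rightarrow> ('a \<Rightarrow> 'b::real_normed_vector) \<Rightarrow> bool" where
  "smooth_on S f \<longleftrightarrow> (\<forall>k. Ck_on k S f)"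

definition local_defining_function :: "'a::euclidean_space set \<Rightarrow> 'a set \<Rightarrow> ('a \<Rightarrow> real) \<Rightarrow> bool" where
  "local_defining_function \<Omega> V \<rho> \<longleftrightarrow>
     open V \<and> smooth_on V \<rho> \<and> (\<forall>x\<in>V. \<not> GDERIV \<rho> x :> 0) \<and>
     \<Omega> \<inter> V = {x \<in> V. \<rho> x < 0} \<and> frontier \<Omega> \<inter> V = {x \<in> V. \<rho> x = 0}"

definition smooth_boundary :: "'a::euclidean_space set \<Rightarrow> bool" where
  "smooth_boundary \<Omega> \<longleftrightarrow> (\<forall>x\<in>frontier \<Omega>. \<exists>V \<rho>. x \<in> V \<and> local_defining_function \<Omega> V \<rho>)"

definition smooth_bounded_domain :: "'a::euclidean_space set \<Rightarrow> bool" where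
  "smooth_bounded_domain \<Omega> \<longleftrightarrow>
     \<Omega> \<noteq> {} \<and> open \<Omega> \<and> bounded \<Omega> \<and> connected \<Omega> \<and> smooth_boundary \<Omega>"

text \<open>
  The outward unit normal is the normalised gradient \<open>sgn g = g /\<^sub>R norm g\<close> of any local defining
  function, as these are negative inside \<open>\<Omega>\<close>.
\<close>

definition outward_unit_normal :: "'a::euclidean_space set \<Rightarrow> 'a \<Rightarrow> 'a \<Rightarrow> bool" where
  "outward_unit_normal \<Omega> x \<nu> \<longleftrightarrow>
     (\<exists>V \<rho> g. x \<in> V \<and> local_defining_function \<Omega> V \<rho> \<and> GDERIV \<rho> x :> g \<and> \<nu> = sgn g)"


section \<open>Sobolev spaces\<close>

definition test_function :: "'a::euclidean_space set \<Rightarrow> ('a \<Rightarrow> real) \<Rightarrow> bool" where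
  "test_function \<Omega> \<phi> \<longleftrightarrow>
     smooth_on UNIV \<phi> \<and> compact (closure {x. \<phi> x \<noteq> 0}) \<and> closure {x. \<phi> x \<noteq> 0} \<subseteq> \<Omega>"

definition locally_integrable :: "'a::euclidean_space set \<Rightarrow> ('a \<Rightarrow> real) \<Rightarrow> bool" where
  "locally_integrable \<Omega> u \<longleftrightarrow> (\<forall>K. compact K \<and> K \<subseteq> \<Omega> \<longrightarrow> integrable (lebesgue_on K) u)"

definition has_weak_partial ::
    "'a::euclidean_space set \<Rightarrow> 'a \<Rightarrow> ('a \<Rightarrow> real) \<Rightarrow> ('a \<Rightarrow> real) \<Rightarrow> bool" where
  "has_weak_partial \<Omega> i u g \<longleftrightarrow>
     locally_integrable \<Omega> u \<and> locally_integrable \<Omega> g \<and>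
     (\<forall>\<phi>. test_function \<Omega> \<phi> \<longrightarrow>
        (\<integral>x. u x * frechet_derivative \<phi> (at x) i \<partial>lebesgue_on \<Omega>)
          = - (\<integral>x. g x * \<phi> x \<partial>lebesgue_on \<Omega>))"

text \<open>Weak derivatives are unique up to null sets; a representative is chosen.\<close>

definition weak_partial :: "'a::euclidean_space set \<Rightarrow> 'a \<Rightarrow> ('a \<Rightarrow> real) \<Rightarrow> 'a \<Rightarrow> real" where
  "weak_partial \<Omega> i u = (SOME g. has_weak_partial \<Omega> i u g)"

definition weak_grad :: "'a::euclidean_space set \<Rightarrow> ('a \<Rightarrow> real) \<Rightarrow> 'a \<Rightarrow> 'a" where
  "weak_grad \<Omega> u x = (\<Sum>i\<in>Basis. weak_partial \<Omega> i u x *\<^sub>R i)"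

definition weak_laplacian :: "'a::euclidean_space set \<Rightarrow> ('a \<Rightarrow> real) \<Rightarrow> 'a \<Rightarrow> real" where
  "weak_laplacian \<Omega> u x = (\<Sum>i\<in>Basis. weak_partial \<Omega> i (weak_partial \<Omega> i u) x)"

definition L2 :: "'a::euclidean_space set \<Rightarrow> ('a \<Rightarrow> real) \<Rightarrow> bool" where
  "L2 \<Omega> u \<longleftrightarrow> u \<in> borel_measurable (lebesgue_on \<Omega>) \<and> integrable (lebesgue_on \<Omega>) (\<lambda>x. (u x)\<^sup>2)"

definition L2norm :: "'a::euclidean_space set \<Rightarrow> ('a \<Rightarrow> 'b::real_normed_vector) \<Rightarrow> real" where
  "L2norm \<Omega> f = sqrt (\<integral>x. (norm (f x))\<^sup>2 \<partial>lebesgue_on \<Omega>)"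

definition H1 :: "'a::euclidean_space set \<Rightarrow> ('a \<Rightarrow> real) \<Rightarrow> bool" where
  "H1 \<Omega> u \<longleftrightarrow> L2 \<Omega> u \<and> (\<forall>i\<in>Basis. \<exists>g. L2 \<Omega> g \<and> has_weak_partial \<Omega> i u g)"

definition H2 :: "'a::euclidean_space set \<Rightarrow> ('a \<Rightarrow> real) \<Rightarrow> bool" where
  "H2 \<Omega> u \<longleftrightarrow> H1 \<Omega> u \<and> (\<forall>i\<in>Basis. H1 \<Omega> (weak_partial \<Omega> i u))"

definition H1norm :: "'a::euclidean_space set \<Rightarrow> ('a \<Rightarrow> real) \<Rightarrow> real" where
  "H1norm \<Omega> u = sqrt ((L2norm \<Omega> u)\<^sup>2 + (L2norm \<Omega> (weak_grad \<Omega> u))\<^sup>2)"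

text \<open>The closure of the test functions in \<open>H1\<close>, i.e. the functions with vanishing trace.\<close>

definition H1_0 :: "'a::euclidean_space set \<Rightarrow> ('a \<Rightarrow> real) \<Rightarrow> bool" where
  "H1_0 \<Omega> u \<longleftrightarrow> H1 \<Omega> u \<and>
     (\<exists>\<phi>. (\<forall>k::nat. test_function \<Omega> (\<phi> k)) \<and> (\<lambda>k. H1norm \<Omega> (\<lambda>x. u x - \<phi> k x)) \<longlonglongrightarrow> 0)"


section \<open>Boundary conditions\<close>

text \<open>
  For \<open>u\<close> in \<open>H2\<close>, the normal derivative is the trace on the boundary of \<open>N \<bullet> \<nabla>u\<close>, where \<open>N\<close> is any
  smooth vector field that agrees with the outward unit normal on the boundary.
\<close>

definition normal_derivative_zero :: "'a::euclidean_space set \<Rightarrow> ('a \<Rightarrow> real) \<Rightarrow> bool" where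
  "normal_derivative_zero \<Omega> u \<longleftrightarrow>
     (\<exists>N::'a \<Rightarrow> 'a. smooth_on UNIV N \<and> (\<forall>x\<in>frontier \<Omega>. outward_unit_normal \<Omega> x (N x)) \<and>
        H1_0 \<Omega> (\<lambda>x. N x \<bullet> weak_grad \<Omega> u x))"

text \<open>
  Periodicity on the box with corners \<open>a\<close>, \<open>b\<close>: the periodic extension is in \<open>H2\<close> locally on the
  whole space, so that values and first derivatives match on opposite faces.
\<close>

definition H2_periodic :: "'a::euclidean_space \<Rightarrow> 'a \<Rightarrow> ('a \<Rightarrow> real) \<Rightarrow> bool" where
  "H2_periodic a b u \<longleftrightarrow>
     (\<exists>v. (\<forall>x. \<forall>i\<in>Basis. v (x + ((b - a) \<bullet> i) *\<^sub>R i) = v x) \<and>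
          (\<forall>r>0. H2 (ball 0 r) v) \<and>
          (AE x in lebesgue_on (box a b). v x = u x))"


section \<open>The scheme\<close>

text \<open>The three phases are indexed by the three-element type \<open>3\<close>, with elements \<open>1, 2, 3\<close>.\<close>

definition F_pot :: "(3 \<Rightarrow> real) \<Rightarrow> real \<Rightarrow> (3 \<Rightarrow> real) \<Rightarrow> real" where
  "F_pot S \<Lambda> c = (\<Sum>i\<in>UNIV. S i / 2 * (c i)\<^sup>2 * (1 - c i)\<^sup>2) + 3 * \<Lambda> * (c 1)\<^sup>2 * (c 2)\<^sup>2 * (c 3)\<^sup>2"

definition H_fun :: "(3 \<Rightarrow> real) \<Rightarrow> real \<Rightarrow> real \<Rightarrow> 3 \<Rightarrow> (3 \<Rightarrow> real) \<Rightarrow> real" where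
  "H_fun S \<Lambda> B i c =
     1 / 2 * ((S i * (c i - (c i)\<^sup>2) * (1 - 2 * c i) + 6 * \<Lambda> * c i * (\<Prod>j\<in>UNIV - {i}. (c j)\<^sup>2))
              / sqrt (F_pot S \<Lambda> c + B))"

text \<open>In the following, \<open>c m i\<close> and \<open>U m\<close> are the fields at time level \<open>m\<close>.\<close>

definition H_dagger ::
    "(3 \<Rightarrow> real) \<Rightarrow> real \<Rightarrow> real \<Rightarrow> (nat \<Rightarrow> 3 \<Rightarrow> 'a \<Rightarrow> real) \<Rightarrow> nat \<Rightarrow> 3 \<Rightarrow> 'a \<Rightarrow> real" where
  "H_dagger S \<Lambda> B c n i x = H_fun S \<Lambda> B i (\<lambda>j. 2 * c n j x - c (n - 1) j x)"

definition beta_next ::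
    "real \<Rightarrow> (3 \<Rightarrow> real) \<Rightarrow> real \<Rightarrow> real \<Rightarrow> real \<Rightarrow> (nat \<Rightarrow> 3 \<Rightarrow> 'a \<Rightarrow> real) \<Rightarrow> (nat \<Rightarrow> 'a \<Rightarrow> real) \<Rightarrow>
     nat \<Rightarrow> 'a \<Rightarrow> real" where
  "beta_next \<epsilon> S ST \<Lambda> B c U n x =
     - (8 / \<epsilon>) * ST * (\<Sum>i\<in>UNIV. H_dagger S \<Lambda> B c n i x / S i) * U (n + 1) x"

definition E_bdf ::
    "'a::euclidean_space set \<Rightarrow> real \<Rightarrow> (3 \<Rightarrow> real) \<Rightarrow> real \<Rightarrow> (nat \<Rightarrow> 3 \<Rightarrow> 'a \<Rightarrow> real) \<Rightarrow>
     (nat \<Rightarrow> 'a \<Rightarrow> real) \<Rightarrow> nat \<Rightarrow> real" where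
  "E_bdf \<Omega> \<epsilon> S B c U n =
     (\<Sum>i\<in>UNIV. 3 / 8 * S i * \<epsilon> *
        ((L2norm \<Omega> (weak_grad \<Omega> (c n i)))\<^sup>2 / 2
         + (L2norm \<Omega> (\<lambda>x. 2 *\<^sub>R weak_grad \<Omega> (c n i) x - weak_grad \<Omega> (c (n - 1) i) x))\<^sup>2 / 2))
     + 12 / \<epsilon> * ((L2norm \<Omega> (U n))\<^sup>2 / 2 + (L2norm \<Omega> (\<lambda>x. 2 * U n x - U (n - 1) x))\<^sup>2 / 2)
     - 12 / \<epsilon> * B * measure lebesgue \<Omega>"

end

theory Submission
  imports Defs
begin

text \<open>
  The stability estimate is the result of testing the scheme with the right functions. Write
  \<open>D\<^sub>i = 3 c\<^sub>i\<^sup>n\<^sup>+\<^sup>1 - 4 c\<^sub>i\<^sup>n + c\<^sub>i\<^sup>n\<^sup>-\<^sup>1\<close>. Testing the first equation with \<open>\<mu>\<^sub>i\<close> turns \<open>\<integral> D\<^sub>i \<mu>\<^sub>i\<close> into the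
  dissipation \<open>- (2 \<delta>t M\<^sub>0 / \<Sigma>\<^sub>i) \<parallel>\<nabla>\<mu>\<^sub>i\<parallel>\<^sup>2\<close>. Testing the second equation with \<open>D\<^sub>i\<close> and summing over the
  phases, the Laplacian gives a multiple of \<open>\<integral> \<nabla>c\<^sub>i\<^sup>n\<^sup>+\<^sup>1 \<bullet> \<nabla>D\<^sub>i\<close>, the nonlinear terms combine by the third equation to a
  multiple of \<open>\<integral> U\<^sup>n\<^sup>+\<^sup>1 (3 U\<^sup>n\<^sup>+\<^sup>1 - 4 U\<^sup>n + U\<^sup>n\<^sup>-\<^sup>1)\<close>, and the Lagrange multiplier \<open>\<beta>\<close> drops out
  because \<open>\<Sum> D\<^sub>i = 0\<close>. The identity
  \<open>2 a (3 a - 4 b + c) = a\<^sup>2 + (2 a - b)\<^sup>2 - b\<^sup>2 - (2 b - c)\<^sup>2 + (a - 2 b + c)\<^sup>2\<close> (\<open>bdf_identity\<close>) then produces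
  the difference of the energies and a remainder of squares of second differences. The remainder
  is nonnegative even if some \<open>\<Sigma>\<^sub>i\<close> are negative: the gradients of the second differences add up to zero
  over the phases, so the coercivity on that plane applies. The second inequality is the same
  coercivity, applied to the fields \<open>\<nabla>\<mu>\<^sub>i / \<Sigma>\<^sub>i\<close>.

  Both uses of coercivity, and the disappearance of \<open>\<beta>\<close>, rest on one fact: the scheme conserves the
  constraint \<open>\<Sum> c\<^sub>i = 1\<close> and has \<open>\<nabla>\<Theta> = 0\<close> for \<open>\<Theta> = \<Sum> \<mu>\<^sub>i / \<Sigma>\<^sub>i\<close>. Here the definition of \<open>\<beta>\<close> gives
  \<open>\<Theta> = - (3/4) \<epsilon> \<Delta> \<Sum> c\<^sub>i\<close>, while the first equation gives \<open>\<Sum> D\<^sub>i = 2 \<delta>t M\<^sub>0 \<Delta>\<Theta>\<close>; testing each of these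
  with the other shows \<open>\<nabla>\<Theta> = 0\<close> and \<open>\<nabla> \<Sum> c\<^sub>i = 0\<close>, hence \<open>\<Sum> D\<^sub>i = 0\<close>.

  The analytic content is Green's formula \<open>\<integral> \<Delta>u v = - \<integral> \<nabla>u \<bullet> \<nabla>v\<close> for Sobolev functions under either
  boundary condition. Its core is \<open>weak_product_rule\<close>, the Leibniz rule for two functions that are
  both only weakly differentiable, inside the domain. For a periodic box (\<open>green_periodic\<close>) a cutoff
  whose translates by multiples of the period add up to 1 reduces the formula to this rule. For the
  Neumann condition (\<open>green_neumann\<close>) no trace theory is used: a globally defined function \<open>G\<close>
  with \<open>\<Omega> = {G < 0}\<close> (\<open>global_defining_function\<close>) gives cutoffs, and the error made by cutting off is
  controlled because the part of \<open>\<nabla>G\<close> orthogonal to the extended normal is of order \<open>G\<close>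
  (\<open>vanishing_on_frontier_bound\<close>). That weak derivatives may be chosen arbitrarily among
  almost everywhere equal functions is harmless by \<open>fundamental_lemma\<close>.
\<close>

section \<open>Calculus of smooth functions\<close>

abbreviation (input) pd :: "'a::euclidean_space \<Rightarrow> ('a \<Rightarrow> 'b::real_normed_vector) \<Rightarrow> 'a \<Rightarrow> 'b" where
  "pd i f x \<equiv> frechet_derivative f (at x) i"

lemma frechet_derivative_cong_open:
  assumes "open S" "x \<in> S" "\<And>y. y \<in> S \<Longrightarrow> f y = g y"
  shows "frechet_derivative f (at x) = frechet_derivative g (at x)"
proof -
  have "(f has_derivative D) (at x) \<longleftrightarrow> (g has_derivative D) (at x)" for D
    using has_derivative_transform_within_open[of f D x UNIV S g]
      has_derivative_transform_within_open[of g D x UNIV S f] assms by auto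
  then show ?thesis by (simp add: frechet_derivative_def)
qed

lemma differentiable_cong_open:
  assumes "open S" "x \<in> S" "\<And>y. y \<in> S \<Longrightarrow> f y = g y"
  shows "f differentiable (at x) \<longleftrightarrow> g differentiable (at x)"
  unfolding differentiable_def
    using has_derivative_transform_within_open[of f _ x UNIV S g]
      has_derivative_transform_within_open[of g _ x UNIV S f] assms by auto

lemma Ck_on_cong:
  assumes "open S" "\<And>x. x \<in> S \<Longrightarrow> f x = g x"
  shows "Ck_on k S f \<longleftrightarrow> Ck_on k S g"
  using assms(2)
proof (induction k arbitrary: f g)
  case 0
  then show ?case using continuous_on_cong[of S S f g] by simp
next
  case (Suc k)
  have "Ck_on k S (\<lambda>x. pd i f x) \<longleftrightarrow> Ck_on k S (\<lambda>x. pd i g x)" for i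
    by (rule Suc.IH) (simp add: frechet_derivative_cong_open[OF assms(1) _ Suc.prems])
  then show ?case
    using differentiable_cong_open[OF assms(1) _ Suc.prems] by (simp cong: ball_cong)
qed

lemma Ck_on_Suc_imp: "Ck_on (Suc k) S f \<Longrightarrow> Ck_on k S f"
proof (induction k arbitrary: f)
  case 0
  then show ?case
    by (auto intro!: continuous_at_imp_continuous_on differentiable_imp_continuous_within)
next
  case (Suc k)
  from Suc.prems have 1: "\<forall>x\<in>S. f differentiable (at x)"
    and 2: "\<forall>i\<in>Basis. Ck_on (Suc k) S (\<lambda>x. pd i f x)"
    by (auto simp only: Ck_on.simps)
  from 2 Suc.IH have "\<forall>i\<in>Basis. Ck_on k S (\<lambda>x. pd i f x)" by blast
  with 1 show ?case by simp
qed

lemma Ck_on_subset: "Ck_on k S f \<Longrightarrow> T \<subseteq> S \<Longrightarrow> Ck_on k T f"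
  by (induction k arbitrary: f) (auto intro: continuous_on_subset)

text \<open>Every derivation rule below has the same shape: the partial derivatives of the composite are
  built from functions of the same kind, one order of smoothness lower, so induction on the order
  applies.\<close>

lemma Ck_on_SucI:
  assumes "open S" "\<And>x. x \<in> S \<Longrightarrow> (f has_derivative f' x) (at x)"
    and "\<And>i. i \<in> Basis \<Longrightarrow> Ck_on k S (\<lambda>x. f' x i)"
  shows "Ck_on (Suc k) S f"
proof -
  have "f differentiable (at x)" if "x \<in> S" for x
    using assms(2)[OF that] by (auto simp: differentiable_def)
  moreover have "Ck_on k S (\<lambda>x. pd i f x)" if "i \<in> Basis" for i
    using assms(3)[OF that] Ck_on_cong[OF assms(1), of "\<lambda>x. pd i f x" "\<lambda>x. f' x i" k]
      frechet_derivative_at[OF assms(2)] by metis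
  ultimately show ?thesis by simp
qed

lemma Ck_on_SucD:
  assumes "Ck_on (Suc k) S f"
  shows "x \<in> S \<Longrightarrow> (f has_derivative frechet_derivative f (at x)) (at x)"
    and "i \<in> Basis \<Longrightarrow> Ck_on k S (\<lambda>x. pd i f x)" and "Ck_on k S f"
  using assms Ck_on_Suc_imp[OF assms] by (auto simp: frechet_derivative_works[symmetric])

lemma Ck_on_const: "open S \<Longrightarrow> Ck_on k S (\<lambda>x. a)"
proof (induction k arbitrary: a)
  case (Suc k) show ?case
    by (rule Ck_on_SucI[where f' = "\<lambda>x h. 0"]) (auto intro: Suc)
qed auto

lemma Ck_on_bounded_linear:
  assumes "open S" "bounded_linear L" shows "Ck_on k S L"
proof (cases k)
  case 0 then show ?thesis using assms by (auto intro: linear_continuous_on)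
next
  case (Suc m) then show ?thesis unfolding Suc
    using assms by (intro Ck_on_SucI[where f' = "\<lambda>x. L"] bounded_linear_imp_has_derivative)
      (auto intro: Ck_on_const)
qed

lemma Ck_on_add: "open S \<Longrightarrow> Ck_on k S f \<Longrightarrow> Ck_on k S g \<Longrightarrow> Ck_on k S (\<lambda>x. f x + g x)"
proof (induction k arbitrary: f g)
  case 0 then show ?case by (simp add: continuous_on_add)
next
  case (Suc k) note f = Ck_on_SucD[OF Suc.prems(2)] and g = Ck_on_SucD[OF Suc.prems(3)]
  show ?case
    by (rule Ck_on_SucI[OF \<open>open S\<close>, OF has_derivative_add[OF f(1) g(1)]])
      (use f(2) g(2) in \<open>auto intro: Suc.IH Suc.prems\<close>)
qed

lemma Ck_on_mult:
  fixes f g :: "'a::euclidean_space \<Rightarrow> real"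
  shows "open S \<Longrightarrow> Ck_on k S f \<Longrightarrow> Ck_on k S g \<Longrightarrow> Ck_on k S (\<lambda>x. f x * g x)"
proof (induction k arbitrary: f g)
  case 0 then show ?case by (simp add: continuous_on_mult)
next
  case (Suc k) note f = Ck_on_SucD[OF Suc.prems(2)] and g = Ck_on_SucD[OF Suc.prems(3)]
  show ?case
    by (rule Ck_on_SucI[OF \<open>open S\<close>, OF has_derivative_mult[OF f(1) g(1)]])
      (use f(2,3) g(2,3) in \<open>auto intro!: Ck_on_add Suc.IH Suc.prems(1)\<close>)
qed

lemma Ck_on_linear_image:
  assumes "bounded_linear L" shows "open S \<Longrightarrow> Ck_on k S f \<Longrightarrow> Ck_on k S (\<lambda>x. L (f x))"
proof (induction k arbitrary: f)
  case 0 then show ?case by (simp add: bounded_linear.continuous_on[OF assms])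
next
  case (Suc k) note f = Ck_on_SucD[OF Suc.prems(2)]
  show ?case
    by (rule Ck_on_SucI[OF \<open>open S\<close>, OF bounded_linear.has_derivative[OF assms f(1)]])
      (use f(2) in \<open>auto intro: Suc.IH Suc.prems\<close>)
qed

lemma Ck_on_compose:
  fixes f :: "'a::euclidean_space \<Rightarrow> real" and g :: "real \<Rightarrow> real"
  assumes "open S" "open T" "\<And>x. x \<in> S \<Longrightarrow> f x \<in> T"
  shows "Ck_on k S f \<Longrightarrow> Ck_on k T g \<Longrightarrow> Ck_on k S (\<lambda>x. g (f x))"
proof (induction k arbitrary: g)
  case 0
  have "continuous_on S (\<lambda>x. g (f x))"
    by (rule continuous_on_compose2[of T g S f]) (use 0 assms(3) in auto)
  then show ?case by simp
next
  case (Suc k)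
  note f = Ck_on_SucD[OF Suc.prems(1)] and g = Ck_on_SucD[OF Suc.prems(2)]
  have d: "frechet_derivative g (at y) h = h * pd 1 g y" if "y \<in> T" for y h
    using linear_cmul[OF has_derivative_linear[OF g(1)[OF that]], of h 1]
    by (simp only: real_scaleR_def mult_1_right)
  have d': "(\<lambda>h. frechet_derivative g (at (f x)) (frechet_derivative f (at x) h))
      = (\<lambda>h. frechet_derivative f (at x) h * pd 1 g (f x))" if "x \<in> S" for x
    by (rule ext, rule d[OF assms(3)[OF that]])
  show ?case
  proof (rule Ck_on_SucI[OF assms(1)])
    fix x assume x: "x \<in> S"
    show "((\<lambda>x. g (f x)) has_derivative (\<lambda>h. frechet_derivative f (at x) h * pd 1 g (f x))) (at x)"
      using has_derivative_compose[OF f(1)[OF x] g(1)[OF assms(3)[OF x]]]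
      unfolding d'[OF x] .
  next
    fix i :: 'a assume i: "i \<in> Basis"
    have "(1::real) \<in> Basis" by simp
    from Ck_on_mult[OF assms(1) f(2)[OF i] Suc.IH[OF f(3) g(2)[OF this]]]
    show "Ck_on k S (\<lambda>x. pd i f x * pd 1 g (f x))" .
  qed
qed

lemma Ck_on_affine:
  fixes f :: "'a::euclidean_space \<Rightarrow> 'b::real_normed_vector"
  shows "Ck_on k UNIV f \<Longrightarrow> Ck_on k UNIV (\<lambda>x. f (r *\<^sub>R x + a))"
proof (induction k arbitrary: f)
  case 0 then show ?case
    by (auto intro!: continuous_on_compose2[of UNIV f] continuous_on_add continuous_on_scaleR continuous_on_id continuous_on_const)
next
  case (Suc k)
  note f = Ck_on_SucD[OF Suc.prems]
  show ?case
  proof (rule Ck_on_SucI)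
    fix x
    have *: "((\<lambda>x. r *\<^sub>R x + a) has_derivative (\<lambda>h. r *\<^sub>R h)) (at x)"
      by (auto intro!: derivative_eq_intros)
    show "((\<lambda>x. f (r *\<^sub>R x + a)) has_derivative
        (\<lambda>h. r *\<^sub>R frechet_derivative f (at (r *\<^sub>R x + a)) h)) (at x)"
      using has_derivative_compose[OF * f(1)] linear_cmul[OF has_derivative_linear[OF f(1)]]
      by (simp add: )
  next
    fix i :: 'a assume "i \<in> Basis"
    from Ck_on_linear_image[OF bounded_linear_scaleR_right open_UNIV Suc.IH[OF f(2)[OF this]]]
    show "Ck_on k UNIV (\<lambda>x. r *\<^sub>R pd i f (r *\<^sub>R x + a))" .
  qed simp
qed

lemma Ck_on_inverse:
  fixes f :: "'a::euclidean_space \<Rightarrow> real"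
  assumes "open S" "\<And>x. x \<in> S \<Longrightarrow> f x \<noteq> 0"
  shows "Ck_on k S f \<Longrightarrow> Ck_on k S (\<lambda>x. inverse (f x))"
proof (induction k)
  case 0 then show ?case using assms(2) by (auto intro: continuous_on_inverse)
next
  case (Suc k)
  note f = Ck_on_SucD[OF Suc.prems]
  show ?case
  proof (rule Ck_on_SucI[OF assms(1)])
    fix x assume x: "x \<in> S"
    show "((\<lambda>x. inverse (f x)) has_derivative
       (\<lambda>h. (- 1) * (inverse (f x) * frechet_derivative f (at x) h * inverse (f x)))) (at x)"
      using f(1) x assms(2) by (auto intro!: derivative_eq_intros)
  next
    fix i :: 'a assume "i \<in> Basis"
    then show "Ck_on k S (\<lambda>x. (- 1) * (inverse (f x) * pd i f x * inverse (f x)))"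
      using f Suc.IH by (intro Ck_on_mult Ck_on_const assms(1)) auto
  qed
qed

text \<open>Smoothness is local. This serves to extend products with a bump function by zero.\<close>

lemma Ck_on_Un: "open S \<Longrightarrow> open T \<Longrightarrow> Ck_on k S f \<Longrightarrow> Ck_on k T f \<Longrightarrow> Ck_on k (S \<union> T) f"
  by (induction k arbitrary: f) (auto intro: continuous_on_open_Un)

lemma smooth_on_cong:
  "open S \<Longrightarrow> (\<And>x. x \<in> S \<Longrightarrow> f x = g x) \<Longrightarrow> smooth_on S f \<longleftrightarrow> smooth_on S g"
  using Ck_on_cong unfolding smooth_on_def by metis

lemma smooth_on_pd: "smooth_on S f \<Longrightarrow> i \<in> Basis \<Longrightarrow> smooth_on S (\<lambda>x. pd i f x)"
  unfolding smooth_on_def using Ck_on_SucD(2) by blast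

lemma smooth_on_has_derivative:
  "smooth_on S f \<Longrightarrow> x \<in> S \<Longrightarrow> (f has_derivative frechet_derivative f (at x)) (at x)"
  unfolding smooth_on_def using Ck_on_SucD(1) by blast

lemma smooth_on_continuous: "smooth_on S f \<Longrightarrow> continuous_on S f"
  unfolding smooth_on_def using Ck_on.simps(1) by blast

lemma smooth_on_subset: "smooth_on S f \<Longrightarrow> T \<subseteq> S \<Longrightarrow> smooth_on T f"
  unfolding smooth_on_def using Ck_on_subset by blast

lemma smooth_on_Un: "open S \<Longrightarrow> open T \<Longrightarrow> smooth_on S f \<Longrightarrow> smooth_on T f \<Longrightarrow> smooth_on (S \<union> T) f"
  unfolding smooth_on_def using Ck_on_Un by blast

lemma smooth_on_const: "open S \<Longrightarrow> smooth_on S (\<lambda>x. a)"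
  unfolding smooth_on_def using Ck_on_const by blast

lemma smooth_on_add: "open S \<Longrightarrow> smooth_on S f \<Longrightarrow> smooth_on S g \<Longrightarrow> smooth_on S (\<lambda>x. f x + g x)"
  unfolding smooth_on_def using Ck_on_add by blast

lemma smooth_on_mult:
  fixes f g :: "'a::euclidean_space \<Rightarrow> real"
  shows "open S \<Longrightarrow> smooth_on S f \<Longrightarrow> smooth_on S g \<Longrightarrow> smooth_on S (\<lambda>x. f x * g x)"
  unfolding smooth_on_def using Ck_on_mult by blast

lemma smooth_on_sum:
  "open S \<Longrightarrow> (\<And>i. i \<in> I \<Longrightarrow> smooth_on S (f i)) \<Longrightarrow> smooth_on S (\<lambda>x. \<Sum>i\<in>I. f i x)"
  by (induction I rule: infinite_finite_induct) (auto intro: smooth_on_add smooth_on_const)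

lemma smooth_on_prod:
  fixes f :: "'i \<Rightarrow> 'a::euclidean_space \<Rightarrow> real"
  shows "open S \<Longrightarrow> (\<And>i. i \<in> I \<Longrightarrow> smooth_on S (f i)) \<Longrightarrow> smooth_on S (\<lambda>x. \<Prod>i\<in>I. f i x)"
  by (induction I rule: infinite_finite_induct) (auto intro: smooth_on_mult smooth_on_const)

lemma smooth_on_inner: "open S \<Longrightarrow> smooth_on S f \<Longrightarrow> smooth_on S (\<lambda>x. f x \<bullet> j)"
  unfolding smooth_on_def using Ck_on_linear_image[OF bounded_linear_inner_left] by blast

lemma smooth_on_coordinate: "open S \<Longrightarrow> smooth_on S (\<lambda>x. x \<bullet> j)"
  unfolding smooth_on_def using Ck_on_bounded_linear[OF _ bounded_linear_inner_left] by blast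

lemma smooth_on_compose:
  fixes f :: "'a::euclidean_space \<Rightarrow> real" and g :: "real \<Rightarrow> real"
  shows "open S \<Longrightarrow> open T \<Longrightarrow> (\<And>x. x \<in> S \<Longrightarrow> f x \<in> T) \<Longrightarrow> smooth_on S f \<Longrightarrow> smooth_on T g
    \<Longrightarrow> smooth_on S (\<lambda>x. g (f x))"
  unfolding smooth_on_def using Ck_on_compose[of S T f] by blast

lemma smooth_on_affine: "smooth_on UNIV f \<Longrightarrow> smooth_on UNIV (\<lambda>x. f (r *\<^sub>R x + a))"
  unfolding smooth_on_def using Ck_on_affine by blast

lemma smooth_on_inverse:
  fixes f :: "'a::euclidean_space \<Rightarrow> real"
  shows "open S \<Longrightarrow> (\<And>x. x \<in> S \<Longrightarrow> f x \<noteq> 0) \<Longrightarrow> smooth_on S f \<Longrightarrow> smooth_on S (\<lambda>x. inverse (f x))"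
  unfolding smooth_on_def using Ck_on_inverse by blast

lemma pd_mult:
  fixes f g :: "'a::euclidean_space \<Rightarrow> real"
  assumes "f differentiable at x" "g differentiable at x"
  shows "pd i (\<lambda>x. f x * g x) x = f x * pd i g x + pd i f x * g x"
  using frechet_derivative_at[OF has_derivative_mult[OF assms[unfolded frechet_derivative_works]]]
  by metis

lemma pd_compose:
  fixes f :: "'a::euclidean_space \<Rightarrow> real" and g :: "real \<Rightarrow> real"
  assumes f: "f differentiable at x" and g: "(g has_real_derivative d) (at (f x))"
  shows "pd i (\<lambda>x. g (f x)) x = d * pd i f x"
proof -
  have "((\<lambda>x. g (f x)) has_derivative (\<lambda>h. d * frechet_derivative f (at x) h)) (at x)"
    using has_derivative_compose[OF f[unfolded frechet_derivative_works]
        g[unfolded has_field_derivative_def]] .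
  from frechet_derivative_at[OF this] show ?thesis by metis
qed

lemma smooth_on_differentiable: "smooth_on S f \<Longrightarrow> x \<in> S \<Longrightarrow> f differentiable at x"
  using smooth_on_has_derivative differentiable_def by blast


section \<open>Bump functions and smooth steps\<close>

text \<open>The family \<open>exp (- 1 / t) / t ^ m\<close> is closed under differentiation up to linear combinations,
  which gives smoothness of all members at once.\<close>

definition flat :: "nat \<Rightarrow> real \<Rightarrow> real" where
  "flat m t = (if t > 0 then exp (- 1 / t) / t ^ m else 0)"

lemma flat_tendsto_0: "(flat m \<longlongrightarrow> 0) (at 0)"
proof -
  have "((\<lambda>t. (inverse t) ^ m / exp (inverse t)) \<longlongrightarrow> 0) (at_right (0::real))"
    by (rule filterlim_compose[OF tendsto_power_div_exp_0 filterlim_inverse_at_top_right])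
  then have r: "(flat m \<longlongrightarrow> 0) (at_right 0)"
    by (rule Lim_transform_eventually)
      (auto simp: eventually_at_filter flat_def exp_minus field_simps)
  have l: "(flat m \<longlongrightarrow> 0) (at_left 0)"
    by (rule Lim_transform_eventually[OF tendsto_const])
      (auto simp: eventually_at_filter flat_def)
  show ?thesis using r l filterlim_split_at by blast
qed

lemma flat_has_real_derivative:
  "(flat m has_real_derivative flat (m + 2) t - real m * flat (m + 1) t) (at t)"
proof -
  consider "t > 0" | "t < 0" | "t = 0" by linarith
  then show ?thesis
  proof cases
    case 1
    have pow: "n = 0 \<or> t ^ n = t * t ^ (n - Suc 0)" for n
      by (cases n) auto
    have "((\<lambda>t. exp (- 1 / t) / t ^ m) has_real_derivative flat (m + 2) t - real m * flat (m + 1) t) (at t)"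
      using 1 pow by (cases m) (auto intro!: derivative_eq_intros simp: flat_def field_simps power2_eq_square)
    then show ?thesis
      by (rule has_field_derivative_transform_within_open[where S = "{0<..}"])
        (use 1 in \<open>auto simp: flat_def\<close>)
  next
    case 2
    have "((\<lambda>t. 0) has_real_derivative flat (m + 2) t - real m * flat (m + 1) t) (at t)"
      using 2 by (auto simp: flat_def)
    then show ?thesis
      by (rule has_field_derivative_transform_within_open[where S = "{..<0}"])
        (use 2 in \<open>auto simp: flat_def\<close>)
  next
    case 3
    have "((\<lambda>y. (flat m y - flat m 0) / (y - 0)) \<longlongrightarrow> 0) (at 0)"
      by (rule Lim_transform_eventually[OF flat_tendsto_0[of "m + 1"]])
        (auto simp: eventually_at_filter flat_def)
    then show ?thesis using 3 by (simp add: has_field_derivative_iff flat_def)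
  qed
qed

lemma smooth_flat: "smooth_on UNIV (flat m)"
proof -
  have "Ck_on k UNIV (flat m)" for k
  proof (induction k arbitrary: m)
    case 0
    show ?case using flat_has_real_derivative
      by (auto intro!: continuous_at_imp_continuous_on DERIV_isCont)
  next
    case (Suc k)
    show ?case
    proof (rule Ck_on_SucI)
      show "(flat m has_derivative (\<lambda>h. (flat (m + 2) t + (- real m) * flat (m + 1) t) * h)) (at t)" for t
        using flat_has_real_derivative[of m t] by (simp add: has_field_derivative_def)
    next
    fix i :: real assume "i \<in> Basis"
    have "Ck_on k UNIV (\<lambda>t. (flat (m + 2) t + (- real m) * flat (m + 1) t) * i)"
      by (intro Suc Ck_on_mult Ck_on_add Ck_on_const open_UNIV)
    then show "Ck_on k UNIV (\<lambda>t. (flat (m + 2) t + (- real m) * flat (m + 1) t) * i)" .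
  qed simp
  qed
  then show ?thesis by (simp add: smooth_on_def)
qed

lemma flat0_bounds: "0 \<le> flat 0 t" "flat 0 t \<le> 1" "flat 0 t > 0 \<longleftrightarrow> t > 0" "flat 0 t = 0 \<longleftrightarrow> t \<le> 0"
  by (auto simp: flat_def)

definition step :: "real \<Rightarrow> real" where
  "step t = flat 0 t * inverse (flat 0 t + flat 0 (1 - t))"

lemma step_denominator_pos: "flat 0 t + flat 0 (1 - t) > 0"
  using flat0_bounds(1)[of t] flat0_bounds(1)[of "1 - t"] flat0_bounds(3)[of t]
    flat0_bounds(3)[of "1 - t"] by linarith

lemma smooth_step: "smooth_on UNIV step"
proof -
  have "smooth_on UNIV (\<lambda>t. flat 0 (1 - t))"
    using smooth_on_affine[OF smooth_flat, of 0 "- 1" 1] by simp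
  then have "smooth_on UNIV (\<lambda>t. flat 0 t * inverse (flat 0 t + flat 0 (1 - t)))"
    using step_denominator_pos
    by (intro smooth_on_mult smooth_on_inverse smooth_on_add smooth_flat) (auto simp: less_imp_neq[symmetric])
  then show ?thesis by (simp add: step_def[abs_def])
qed

lemma step_0: "t \<le> 0 \<Longrightarrow> step t = 0"
  by (simp add: step_def flat_def)

lemma step_1: "t \<ge> 1 \<Longrightarrow> step t = 1"
  by (simp add: step_def flat_def)

lemma step_bounds: "0 \<le> step t" "step t \<le> 1"
  using flat0_bounds(1)[of t] flat0_bounds(1)[of "1 - t"] step_denominator_pos[of t]
  by (auto simp: step_def field_simps)

text \<open>For growing \<open>k\<close> the slopes steepen, and in the limit the indicator function of the open interval from
  \<open>a\<close> to \<open>b\<close> is obtained.\<close>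

definition bump :: "real \<Rightarrow> real \<Rightarrow> real \<Rightarrow> real \<Rightarrow> real" where
  "bump k a b t = flat 0 (k * (t - a)) * flat 0 (k * (b - t))"

lemma smooth_bump: "smooth_on UNIV (bump k a b)"
proof -
  have "smooth_on UNIV (\<lambda>t. flat 0 (k * (t - a)))" "smooth_on UNIV (\<lambda>t. flat 0 (k * (b - t)))"
    using smooth_on_affine[OF smooth_flat, of 0 k "- (k * a)"]
      smooth_on_affine[OF smooth_flat, of 0 "- k" "k * b"] by (simp_all add: algebra_simps)
  then show ?thesis unfolding bump_def[abs_def] by (intro smooth_on_mult) auto
qed

lemma bump_bounds: "0 \<le> bump k a b t" "bump k a b t \<le> 1"
  by (auto simp: bump_def flat0_bounds intro: mult_le_one)

lemma bump_pos_iff: "k > 0 \<Longrightarrow> bump k a b t > 0 \<longleftrightarrow> a < t \<and> t < b"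
  using flat0_bounds(1)[of "k * (t - a)"] flat0_bounds(1)[of "k * (b - t)"]
    flat0_bounds(3)[of "k * (t - a)"] flat0_bounds(3)[of "k * (b - t)"]
  by (auto simp: bump_def zero_less_mult_iff)

lemma bump_tendsto_indicator: "(\<lambda>k. bump (real (Suc k)) a b t) \<longlonglongrightarrow> indicator {a<..<b} t"
proof -
  have flat: "(\<lambda>k. flat 0 (real (Suc k) * s)) \<longlonglongrightarrow> 1" if "s > 0" for s
  proof -
    have "(\<lambda>k. (- 1 / s) * inverse (real (Suc k))) \<longlonglongrightarrow> (- 1 / s) * 0"
      by (intro tendsto_mult tendsto_const LIMSEQ_inverse_real_of_nat)
    then have "(\<lambda>k. exp ((- 1 / s) * inverse (real (Suc k)))) \<longlonglongrightarrow> exp 0"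
      by (intro tendsto_exp) simp
    moreover have "exp ((- 1 / s) * inverse (real (Suc k))) = flat 0 (real (Suc k) * s)" for k
      using that by (simp add: flat_def divide_simps)
    ultimately show ?thesis by simp
  qed
  show ?thesis
  proof (cases "a < t \<and> t < b")
    case True
    then show ?thesis
      using tendsto_mult[OF flat[of "t - a"] flat[of "b - t"]] by (simp add: bump_def)
  next
    case False
    then have "bump (real (Suc k)) a b t = 0" for k
      using bump_pos_iff[of "real (Suc k)" a b t] bump_bounds(1)[of "real (Suc k)" a b t] by auto
    then show ?thesis using False by simp
  qed
qed

text \<open>The set \<open>J\<close> of coordinates is all of the basis for a bump function of a box; it omits a direction
  that is to be cut off differently.\<close>

definition bump_box :: "real \<Rightarrow> 'a::euclidean_space \<Rightarrow> 'a \<Rightarrow> 'a set \<Rightarrow> 'a \<Rightarrow> real" where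
  "bump_box k a b J x = (\<Prod>j\<in>J. bump k (a \<bullet> j) (b \<bullet> j) (x \<bullet> j))"

lemma smooth_bump_box: "smooth_on UNIV (bump_box k a b J)"
  unfolding bump_box_def[abs_def]
  by (intro smooth_on_prod smooth_on_compose[where T = UNIV, OF _ _ _ _ smooth_bump] smooth_on_coordinate) auto

lemma bump_box_bounds: "0 \<le> bump_box k a b J x" "bump_box k a b J x \<le> 1"
  unfolding bump_box_def by (auto intro: prod_nonneg prod_le_1 simp: bump_bounds)

lemma bump_box_pos_iff:
  "k > 0 \<Longrightarrow> bump_box k a b Basis x > 0 \<longleftrightarrow> x \<in> box a b"
proof -
  assume k: "k > 0"
  have "bump_box k a b Basis x > 0 \<longleftrightarrow> bump_box k a b Basis x \<noteq> 0"
    using bump_box_bounds(1)[of k a b Basis x] by auto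
  also have "\<dots> \<longleftrightarrow> (\<forall>j\<in>Basis. bump k (a \<bullet> j) (b \<bullet> j) (x \<bullet> j) \<noteq> 0)"
    by (simp add: bump_box_def)
  also have "\<dots> \<longleftrightarrow> (\<forall>j\<in>Basis. bump k (a \<bullet> j) (b \<bullet> j) (x \<bullet> j) > 0)"
    using bump_bounds(1) by (metis less_le)
  finally show ?thesis using bump_pos_iff[OF k] by (auto simp: mem_box)
qed

lemma bump_box_tendsto:
  "finite J \<Longrightarrow> (\<lambda>k. bump_box (real (Suc k)) a b J x) \<longlonglongrightarrow> (\<Prod>j\<in>J. indicator {a \<bullet> j<..<b \<bullet> j} (x \<bullet> j))"
  unfolding bump_box_def by (intro tendsto_prod bump_tendsto_indicator)

section \<open>Test functions and local integrability\<close>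

lemma test_functionI:
  assumes "smooth_on UNIV \<phi>" "compact K" "K \<subseteq> \<Omega>" "\<And>x. x \<notin> K \<Longrightarrow> \<phi> x = 0"
  shows "test_function \<Omega> \<phi>"
proof -
  have "closure {x. \<phi> x \<noteq> 0} \<subseteq> K"
    using assms(4) by (intro closure_minimal compact_imp_closed[OF assms(2)]) auto
  moreover from this have "compact (closure {x. \<phi> x \<noteq> 0})"
    using compact_Int_closed[OF assms(2) closed_closure, of "{x. \<phi> x \<noteq> 0}"]
    by (simp add: Int_absorb1)
  ultimately show ?thesis
    using assms(1,3) by (auto simp: test_function_def)
qed

lemma test_function_smooth: "test_function \<Omega> \<phi> \<Longrightarrow> smooth_on UNIV \<phi>"
  by (simp add: test_function_def)

lemma test_function_mono: "test_function \<Omega> \<phi> \<Longrightarrow> \<Omega> \<subseteq> \<Omega>' \<Longrightarrow> test_function \<Omega>' \<phi>"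
  by (auto simp: test_function_def)

lemma pd_outside_support:
  assumes "x \<notin> closure {x. \<phi> x \<noteq> 0}" shows "pd i \<phi> x = 0"
proof -
  have "frechet_derivative \<phi> (at x) = frechet_derivative (\<lambda>x. 0) (at x)"
    using assms closure_subset[of "{x. \<phi> x \<noteq> 0}"]
    by (intro frechet_derivative_cong_open[of "- closure {x. \<phi> x \<noteq> 0}"]) auto
  then show ?thesis by simp
qed

lemma test_function_pd:
  assumes "test_function \<Omega> \<phi>" "i \<in> Basis" shows "test_function \<Omega> (\<lambda>x. pd i \<phi> x)"
  using assms pd_outside_support[of _ \<phi> i]
  by (intro test_functionI[of _ "closure {x. \<phi> x \<noteq> 0}"])
    (auto simp: test_function_def intro: smooth_on_pd)

lemma test_function_zero:
  assumes "test_function \<Omega> \<phi>" "x \<notin> \<Omega>" shows "\<phi> x = 0" "pd i \<phi> x = 0"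
  using assms closure_subset[of "{x. \<phi> x \<noteq> 0}"] pd_outside_support[of x \<phi> i]
  by (auto simp: test_function_def)

lemma test_function_smooth_mult:
  assumes "smooth_on UNIV \<psi>" "test_function \<Omega> \<phi>" shows "test_function \<Omega> (\<lambda>x. \<psi> x * \<phi> x)"
  using assms closure_subset[of "{x. \<phi> x \<noteq> 0}"]
  by (intro test_functionI[of _ "closure {x. \<phi> x \<noteq> 0}"])
    (auto simp: test_function_def intro!: smooth_on_mult)

lemma test_function_bounded:
  assumes "test_function \<Omega> \<phi>" obtains C where "C > 0" "\<And>x. \<bar>\<phi> x\<bar> \<le> C"
proof -
  let ?K = "closure {x. \<phi> x \<noteq> 0}"
  have "compact (\<phi> ` ?K)"
    using assms smooth_on_continuous[OF test_function_smooth[OF assms]]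
    by (intro compact_continuous_image) (auto simp: test_function_def intro: continuous_on_subset)
  then obtain C where C: "C > 0" "\<forall>y\<in>\<phi> ` ?K. \<bar>y\<bar> \<le> C"
    using compact_imp_bounded bounded_pos by (metis real_norm_def)
  have "\<bar>\<phi> x\<bar> \<le> C" for x
    using C closure_subset[of "{x. \<phi> x \<noteq> 0}"] by (cases "\<phi> x = 0") auto
  with C(1) show ?thesis using that by blast
qed

lemma smooth_borel_measurable: "smooth_on UNIV f \<Longrightarrow> f \<in> borel_measurable borel"
  using smooth_on_continuous borel_measurable_continuous_onI by blast

lemma borel_imp_lebesgue_on: "f \<in> borel_measurable borel \<Longrightarrow> f \<in> borel_measurable (lebesgue_on S)"
  by (rule measurable_restrict_space1, rule measurable_completion) simp

lemma
  fixes f :: "'a::euclidean_space \<Rightarrow> real"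
  assumes "S \<in> sets lebesgue" "\<And>x. x \<notin> S \<Longrightarrow> f x = 0"
  shows integral_lebesgue_on_eq: "integral\<^sup>L (lebesgue_on S) f = integral\<^sup>L lebesgue f"
    and integrable_lebesgue_on_iff: "integrable (lebesgue_on S) f \<longleftrightarrow> integrable lebesgue f"
proof -
  have *: "(\<lambda>x. indicator S x * f x) = f" using assms(2) by (auto simp: indicator_def fun_eq_iff)
  show "integral\<^sup>L (lebesgue_on S) f = integral\<^sup>L lebesgue f"
    using assms(1) by (subst integral_restrict_space) (auto simp: *)
  show "integrable (lebesgue_on S) f \<longleftrightarrow> integrable lebesgue f"
    using assms(1) by (subst integrable_restrict_space) (auto simp: *)
qed

lemma open_sets_lebesgue: "open S \<Longrightarrow> S \<in> sets lebesgue"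
  by auto

lemma closed_sets_lebesgue: "closed S \<Longrightarrow> S \<in> sets lebesgue"
  by auto

lemma integrable_bounded_mult:
  fixes f g :: "'a \<Rightarrow> real"
  assumes "integrable M f" "g \<in> borel_measurable M" "\<And>x. x \<in> space M \<Longrightarrow> \<bar>g x\<bar> \<le> C"
  shows "integrable M (\<lambda>x. f x * g x)"
proof (rule Bochner_Integration.integrable_bound)
  show "integrable M (\<lambda>x. C * f x)" using assms(1) by simp
  have [measurable]: "f \<in> borel_measurable M" using assms(1) by simp
  show "(\<lambda>x. f x * g x) \<in> borel_measurable M" using assms(2) by simp
  have "\<bar>f x * g x\<bar> \<le> \<bar>C * f x\<bar>" if "x \<in> space M" for x
    using mult_left_mono[OF assms(3)[OF that], of "\<bar>f x\<bar>"] mult_right_mono[OF abs_ge_self[of C], of "\<bar>f x\<bar>"]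
    by (simp add: abs_mult mult.commute)
  then show "AE x in M. norm (f x * g x) \<le> norm (C * f x)" by auto
qed

lemma locally_integrable_mult_test:
  assumes "locally_integrable \<Omega> u" "test_function \<Omega> \<phi>"
  shows "integrable lebesgue (\<lambda>x. u x * \<phi> x)"
proof -
  let ?K = "closure {x. \<phi> x \<noteq> 0}"
  have u: "integrable (lebesgue_on ?K) u"
    using assms by (auto simp: locally_integrable_def test_function_def)
  obtain C where C: "\<And>x. \<bar>\<phi> x\<bar> \<le> C" using test_function_bounded[OF assms(2)] by metis
  have "integrable (lebesgue_on ?K) (\<lambda>x. u x * \<phi> x)"
    by (rule integrable_bounded_mult[OF u borel_imp_lebesgue_on[OF
            smooth_borel_measurable[OF test_function_smooth[OF assms(2)]]], where C = C]) (rule C)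
  moreover have "u x * \<phi> x = 0" if "x \<notin> ?K" for x
    using that closure_subset[of "{x. \<phi> x \<noteq> 0}"] by auto
  ultimately show ?thesis
    by (rule iffD1[OF integrable_lebesgue_on_iff[OF closed_sets_lebesgue[OF closed_closure]], rotated])
qed

lemma locally_integrable_subset:
  "locally_integrable \<Omega> u \<Longrightarrow> \<Omega>' \<subseteq> \<Omega> \<Longrightarrow> locally_integrable \<Omega>' u"
  by (auto simp: locally_integrable_def)

lemma locally_integrable_lincomb:
  assumes "locally_integrable \<Omega> u" "locally_integrable \<Omega> v"
  shows "locally_integrable \<Omega> (\<lambda>x. a * u x + b * v x)"
  using assms unfolding locally_integrable_def
  by (simp add: Bochner_Integration.integrable_add integrable_mult_right)

lemma AE_lebesgue_on_subset:
  assumes "AE x in lebesgue_on \<Omega>. P x" "\<Omega>' \<subseteq> \<Omega>" "\<Omega> \<in> sets lebesgue" "\<Omega>' \<in> sets lebesgue"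
  shows "AE x in lebesgue_on \<Omega>'. P x"
proof -
  have "AE x in lebesgue. x \<in> \<Omega> \<longrightarrow> P x"
    using assms by (subst (asm) AE_restrict_space_iff) auto
  then have "AE x in lebesgue. x \<in> \<Omega>' \<longrightarrow> P x"
    by (rule AE_mp) (use assms(2) in auto)
  then show ?thesis using assms(4) by (subst AE_restrict_space_iff) auto
qed

lemma borel_measurable_lebesgue_on_AE:
  fixes f g :: "'a::euclidean_space \<Rightarrow> real"
  assumes "f \<in> borel_measurable (lebesgue_on S)" "AE x in lebesgue_on S. f x = g x" "S \<in> sets lebesgue"
  shows "g \<in> borel_measurable (lebesgue_on S)"
proof -
  have "(\<lambda>x. if x \<in> S then f x else 0) \<in> borel_measurable lebesgue"
    using assms by (simp add: borel_measurable_if)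
  moreover have "AE x in lebesgue. (if x \<in> S then f x else 0) = (if x \<in> S then g x else 0)"
    using assms(2,3) by (subst (asm) AE_restrict_space_iff) auto
  ultimately have "(\<lambda>x. if x \<in> S then g x else 0) \<in> borel_measurable lebesgue"
    by (rule borel_measurable_AE)
  then show ?thesis using assms(3) by (simp add: borel_measurable_if)
qed

lemma
  fixes f :: "'a::euclidean_space \<Rightarrow> real"
  assumes "AE x in lebesgue_on S. f x = g x" "S \<in> sets lebesgue"
  shows integrable_lebesgue_on_cong_AE: "integrable (lebesgue_on S) f \<longleftrightarrow> integrable (lebesgue_on S) g"
    and integral_lebesgue_on_cong_AE: "integral\<^sup>L (lebesgue_on S) f = integral\<^sup>L (lebesgue_on S) g"
proof -
  have sym: "AE x in lebesgue_on S. g x = f x" using assms(1) by auto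
  have *: "f \<in> borel_measurable (lebesgue_on S) \<longleftrightarrow> g \<in> borel_measurable (lebesgue_on S)"
    using borel_measurable_lebesgue_on_AE[OF _ assms] borel_measurable_lebesgue_on_AE[OF _ sym assms(2)]
    by blast
  show i: "integrable (lebesgue_on S) f \<longleftrightarrow> integrable (lebesgue_on S) g"
    using * assms(1) integrable_cong_AE[of f "lebesgue_on S" g] borel_measurable_integrable by blast
  show "integral\<^sup>L (lebesgue_on S) f = integral\<^sup>L (lebesgue_on S) g"
  proof (cases "f \<in> borel_measurable (lebesgue_on S)")
    case True
    then show ?thesis using * assms(1) by (intro integral_cong_AE) auto
  next
    case False
    then have "\<not> integrable (lebesgue_on S) f" "\<not> integrable (lebesgue_on S) g"
      using i borel_measurable_integrable by blast+
    then show ?thesis by (simp add: not_integrable_integral_eq)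
  qed
qed

lemma translation_lebesgue:
  fixes h :: "'a::euclidean_space"
  shows "(\<lambda>x. x + h) \<in> lebesgue \<rightarrow>\<^sub>M lebesgue" "distr lebesgue lebesgue (\<lambda>x. x + h) = lebesgue"
proof -
  have *: "(\<lambda>x::'a. h + (\<Sum>j\<in>Basis. (1 * (x \<bullet> j)) *\<^sub>R j)) = (\<lambda>x. x + h)"
    by (auto simp: euclidean_representation add.commute)
  show "(\<lambda>x. x + h) \<in> lebesgue \<rightarrow>\<^sub>M lebesgue"
    using lebesgue_affine_measurable[of "\<lambda>_. 1" h] by (simp add: *[simplified])
  show "distr lebesgue lebesgue (\<lambda>x. x + h) = lebesgue"
    using lebesgue_affine_euclidean[of "\<lambda>_. 1" h] by (simp add: *[simplified] density_1)
qed

lemma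
  fixes f :: "'a::euclidean_space \<Rightarrow> real"
  shows integrable_lebesgue_translation: "integrable lebesgue f \<Longrightarrow> integrable lebesgue (\<lambda>x. f (x + h))"
    and integral_lebesgue_translation: "integrable lebesgue f \<Longrightarrow> (\<integral>x. f (x + h) \<partial>lebesgue) = (\<integral>x. f x \<partial>lebesgue)"
  using integrable_distr[OF translation_lebesgue(1)[of h], of f]
    integral_distr[OF translation_lebesgue(1)[of h], of f]
  by (auto simp: translation_lebesgue(2))


section \<open>The fundamental lemma of the calculus of variations\<close>

text \<open>The boxes are stable under intersection and generate the Borel sets, so the integrals over all Borel
  sets vanish; the integral over the whole space enters through complements.\<close>

lemma AE_zero_if_box_integrals_zero:
  fixes g :: "'a::euclidean_space \<Rightarrow> real"
  assumes g: "integrable lborel g"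
    and box: "\<And>c d. (\<integral>x. indicator (box c d) x * g x \<partial>lborel) = 0"
    and all: "(\<integral>x. g x \<partial>lborel) = 0"
  shows "AE x in lborel. g x = 0"
proof (rule density_unique_real[OF g])
  show "integrable lborel (\<lambda>x. 0 :: real)" by simp
  fix A :: "'a set" assume "A \<in> sets lborel"
  then have A: "A \<in> sigma_sets UNIV (range (\<lambda>(a, b). box a b))"
    unfolding sets_lborel borel_eq_box by simp
  have "Int_stable (range (\<lambda>(a, b). box a b :: 'a set))"
    by (auto simp: Int_stable_def box_Int_box)
  moreover have "range (\<lambda>(a, b). box a b :: 'a set) \<subseteq> Pow UNIV"
    by auto
  moreover note A
  ultimately have "(\<integral>x. indicator A x * g x \<partial>lborel) = 0"
  proof (induction rule: sigma_sets_induct_disjoint)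
    case (basic A) then show ?case using box by auto
  next
    case empty show ?case by simp
  next
    case (compl A)
    then have A: "A \<in> sets lborel" by (simp add: borel_eq_box)
    have "integrable lborel (\<lambda>x. indicator A x * g x)"
      using integrable_mult_indicator[OF A g] by simp
    note this [simp]
    have "(\<integral>x. indicator (UNIV - A) x * g x \<partial>lborel) = (\<integral>x. g x - indicator A x * g x \<partial>lborel)"
      by (intro Bochner_Integration.integral_cong) (auto simp: indicator_def)
    also have "\<dots> = 0"
      using compl all g by (subst Bochner_Integration.integral_diff) auto
    finally show ?case .
  next
    case (union F)
    then have F: "F i \<in> sets lborel" for i by (auto simp: borel_eq_box subset_eq)
    then have U: "(\<Union>i. F i) \<in> sets lborel" by blast
    have "(\<integral>x\<in>(\<Union>i. F i). g x \<partial>lborel) = (\<Sum>i. (\<integral>x\<in>F i. g x \<partial>lborel))"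
    proof (rule lebesgue_integral_countable_add[OF F])
      show "set_integrable lborel (\<Union>i. F i) g"
        unfolding set_integrable_def by (rule integrable_mult_indicator[OF U g])
    qed (use union(1) in \<open>auto simp: disjoint_family_on_def\<close>)
    then show ?case using union by (simp add: set_lebesgue_integral_def)
  qed
  then show "(\<integral>x\<in>A. g x \<partial>lborel) = (\<integral>x\<in>A. 0 \<partial>lborel)"
    by (simp add: set_lebesgue_integral_def)
qed

lemma bump_box_test_function:
  assumes "k > 0" "cbox a b \<subseteq> \<Omega>"
  shows "test_function \<Omega> (bump_box k a b Basis)"
proof (rule test_functionI[OF smooth_bump_box compact_cbox assms(2)])
  fix x assume "x \<notin> cbox a b"
  then show "bump_box k a b Basis x = 0"
    using bump_box_pos_iff[OF assms(1), of a b x] bump_box_bounds(1)[of k a b Basis x]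
      box_subset_cbox[of a b] by fastforce
qed

lemma bump_box_tendsto_indicator:
  "(\<lambda>k. bump_box (real (Suc k)) a b Basis x) \<longlonglongrightarrow> indicator (box a b) x"
proof -
  have "(\<Prod>j\<in>Basis. indicator {a \<bullet> j<..<b \<bullet> j} (x \<bullet> j)) = (indicator (box a b) x :: real)"
    by (auto simp: indicator_def mem_box prod_zero_iff)
  then show ?thesis using bump_box_tendsto[OF finite_Basis, of a b x] by simp
qed

text \<open>The bump functions of a box are test functions and converge boundedly to its indicator function.\<close>

lemma integral_box_zero_if_test_integrals_zero:
  fixes g :: "'a::euclidean_space \<Rightarrow> real"
  assumes g: "locally_integrable \<Omega> g" and sub: "cbox c d \<subseteq> \<Omega>"
    and test: "\<And>\<phi>. test_function \<Omega> \<phi> \<Longrightarrow> (\<integral>x. g x * \<phi> x \<partial>lebesgue) = 0"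
  shows "(\<integral>x. indicator (box c d) x * g x \<partial>lebesgue) = 0"
proof -
  let ?w = "\<lambda>x. indicator (cbox c d) x * g x"
  let ?\<psi> = "\<lambda>k. bump_box (real (Suc k)) c d Basis"
  have w: "integrable lebesgue ?w"
    using g sub integrable_restrict_space[of "cbox c d" lebesgue g]
    by (auto simp: locally_integrable_def)
  have \<psi>: "test_function \<Omega> (?\<psi> k)" for k by (intro bump_box_test_function sub) simp
  have \<psi>0: "?\<psi> k x = 0" if "x \<notin> cbox c d" for k x
    using test_function_zero(1)[OF bump_box_test_function[of "real (Suc k)" c d "cbox c d"] that] by simp
  have eq: "g x * ?\<psi> k x = ?w x * ?\<psi> k x" for k x
    using \<psi>0[of x k] by (auto simp: indicator_def)
  have "(\<lambda>k. \<integral>x. ?w x * ?\<psi> k x \<partial>lebesgue) \<longlonglongrightarrow> (\<integral>x. ?w x * indicator (box c d) x \<partial>lebesgue)"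
  proof (rule integral_dominated_convergence[where w = "\<lambda>x. \<bar>?w x\<bar>"])
    show "(\<lambda>x. ?w x * indicator (box c d) x) \<in> borel_measurable lebesgue"
      by (rule borel_measurable_times[OF borel_measurable_integrable[OF w] borel_measurable_indicator]) auto
    show "(\<lambda>x. ?w x * ?\<psi> k x) \<in> borel_measurable lebesgue" for k
      using borel_imp_lebesgue_on[OF smooth_borel_measurable[OF smooth_bump_box, of "real (Suc k)" c d Basis], of UNIV]
      by (intro borel_measurable_times[OF borel_measurable_integrable[OF w]]) (simp add: lebesgue_on_UNIV_eq)
    show "AE x in lebesgue. (\<lambda>k. ?w x * ?\<psi> k x) \<longlonglongrightarrow> ?w x * indicator (box c d) x"
      by (intro AE_I2 tendsto_mult tendsto_const bump_box_tendsto_indicator)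
    show "AE x in lebesgue. norm (?w x * ?\<psi> k x) \<le> \<bar>?w x\<bar>" for k
      using bump_box_bounds[of "real (Suc k)" c d Basis]
      by (intro AE_I2) (simp add: abs_mult mult_left_le)
  qed (use w in auto)
  moreover have "(\<integral>x. ?w x * ?\<psi> k x \<partial>lebesgue) = 0" for k
    using test[OF \<psi>[of k]] unfolding eq .
  ultimately have "(\<integral>x. ?w x * indicator (box c d) x \<partial>lebesgue) = 0"
    by (simp add: LIMSEQ_const_iff)
  moreover have "?w x * indicator (box c d) x = indicator (box c d) x * g x" for x
    using box_subset_cbox[of c d] by (auto simp: indicator_def)
  ultimately show ?thesis by simp
qed

text \<open>A locally integrable function need not be integrable, so the previous lemmas are applied on boxes whose
  closure lies in the domain; countably many of them exhaust it.\<close>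

lemma fundamental_lemma:
  fixes g :: "'a::euclidean_space \<Rightarrow> real"
  assumes "open \<Omega>" and g: "locally_integrable \<Omega> g"
    and test: "\<And>\<phi>. test_function \<Omega> \<phi> \<Longrightarrow> (\<integral>x. g x * \<phi> x \<partial>lebesgue) = 0"
  shows "AE x in lebesgue_on \<Omega>. g x = 0"
proof -
  have local: "AE x in lebesgue. x \<in> box a b \<longrightarrow> g x = 0" if sub: "cbox a b \<subseteq> \<Omega>" for a b
  proof -
    let ?w = "\<lambda>x. indicator (box a b) x * g x"
    have "integrable (lebesgue_on (cbox a b)) g"
      using g sub by (auto simp: locally_integrable_def)
    then have "integrable lebesgue (\<lambda>x. indicator (box a b) x * (indicator (cbox a b) x * g x))"
      using integrable_mult_indicator[of "box a b" lebesgue "\<lambda>x. indicator (cbox a b) x * g x"]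
      by (simp add: integrable_restrict_space)
    then have w: "integrable lebesgue ?w"
      by (rule back_subst[where P = "integrable lebesgue"])
        (use box_subset_cbox[of a b] in \<open>auto simp: indicator_def fun_eq_iff\<close>)
    have z: "(\<integral>x. indicator (box c d) x * ?w x \<partial>lebesgue) = 0" for c d
    proof -
      obtain e f where ef: "box c d \<inter> box a b = box e f" by (auto simp: box_Int_box)
      have "(\<integral>x. indicator (box e f) x * g x \<partial>lebesgue) = 0"
      proof (cases "box e f = {}")
        case False
        then have "cbox e f \<subseteq> \<Omega>"
          using closure_mono[of "box e f" "box a b"] ef sub closure_box[of e f]
            closure_mono[OF box_subset_cbox[of a b]] by auto
        then show ?thesis using integral_box_zero_if_test_integrals_zero[OF g _ test] by blast
      qed simp
      moreover have "(\<lambda>x. indicator (box c d) x * ?w x) = (\<lambda>x. indicator (box e f) x * g x)"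
        unfolding ef[symmetric] by (simp add: indicator_inter_arith mult.assoc)
      ultimately show ?thesis by (simp only:)
    qed
    obtain h where h[measurable]: "h \<in> borel_measurable lborel" and ae: "AE x in lborel. ?w x = h x"
      using completion_ex_borel_measurable_real[of ?w lborel] w by auto
    have aeL: "AE x in lebesgue. ?w x = h x" using ae by (rule AE_completion)
    have wm: "?w \<in> borel_measurable lebesgue" and hm: "h \<in> borel_measurable lebesgue"
      using w measurable_completion[OF h] by auto
    have hI: "integrable lborel h"
      using w integrable_cong_AE[OF wm hm aeL] integrable_completion[OF h] by simp
    have "(\<integral>x. indicator (box c d) x * h x \<partial>lborel) = 0" for c d
    proof -
      have "(\<integral>x. indicator (box c d) x * h x \<partial>lborel) = (\<integral>x. indicator (box c d) x * h x \<partial>lebesgue)"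
        by (intro integral_completion[symmetric]) simp
      also have "\<dots> = (\<integral>x. indicator (box c d) x * ?w x \<partial>lebesgue)"
      proof (rule integral_cong_AE)
        show "(\<lambda>x. indicator (box c d) x * h x) \<in> borel_measurable lebesgue"
          by (rule borel_measurable_times[OF borel_measurable_indicator hm]) auto
        show "(\<lambda>x. indicator (box c d) x * ?w x) \<in> borel_measurable lebesgue"
          by (rule borel_measurable_times[OF borel_measurable_indicator wm]) auto
        show "AE x in lebesgue. indicator (box c d) x * h x = indicator (box c d) x * ?w x"
          using aeL by eventually_elim simp
      qed
      finally show ?thesis using z by simp
    qed
    moreover have "(\<integral>x. h x \<partial>lborel) = 0"
    proof -
      have "(\<integral>x. h x \<partial>lborel) = (\<integral>x. h x \<partial>lebesgue)"
        by (intro integral_completion[symmetric]) simp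
      also have "\<dots> = (\<integral>x. indicator (box a b) x * ?w x \<partial>lebesgue)"
      proof (rule integral_cong_AE[OF hm])
        show "(\<lambda>x. indicator (box a b) x * ?w x) \<in> borel_measurable lebesgue"
          by (rule borel_measurable_times[OF borel_measurable_indicator wm]) auto
        show "AE x in lebesgue. h x = indicator (box a b) x * ?w x"
          using aeL by eventually_elim (auto simp: indicator_def)
      qed
      finally show ?thesis using z by simp
    qed
    ultimately have "AE x in lborel. h x = 0"
      using AE_zero_if_box_integrals_zero[OF hI] by blast
    then have "AE x in lebesgue. h x = 0" by (rule AE_completion)
    with aeL show ?thesis by eventually_elim (auto simp: indicator_def)
  qed
  obtain \<D> where \<D>: "countable \<D>" "\<D> \<subseteq> Pow \<Omega>" "\<And>X. X \<in> \<D> \<Longrightarrow> \<exists>a b. X = cbox a b" "\<Union>\<D> = \<Omega>"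
    using open_countable_Union_open_cbox[OF \<open>open \<Omega>\<close>] by metis
  have "AE x in lebesgue. x \<in> X \<longrightarrow> g x = 0" if XD: "X \<in> \<D>" for X
  proof -
    obtain a b where X: "X = cbox a b" using \<D>(3)[OF XD] by blast
    have "cbox a b \<subseteq> \<Omega>" using \<D>(2) XD X by auto
    moreover have "AE x in lebesgue. x \<notin> cbox a b - box a b"
      using negligible_frontier_interval[of a b]
      by (intro AE_not_in) (simp add: negligible_iff_null_sets)
    ultimately show ?thesis using local[of a b] unfolding X by auto
  qed
  then have "AE x in lebesgue. \<forall>X\<in>\<D>. x \<in> X \<longrightarrow> g x = 0"
    using \<D>(1) by (subst AE_ball_countable) auto
  then have "AE x in lebesgue. x \<in> \<Omega> \<longrightarrow> g x = 0"
    by eventually_elim (use \<D>(4) in blast)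
  then show ?thesis using assms(1) by (subst AE_restrict_space_iff) auto
qed

lemma smooth_bounded_on:
  fixes f :: "'a::euclidean_space \<Rightarrow> real"
  assumes "smooth_on UNIV f" "bounded \<Omega>" obtains C where "C > 0" "\<And>x. x \<in> \<Omega> \<Longrightarrow> \<bar>f x\<bar> \<le> C"
proof -
  have "compact (f ` closure \<Omega>)"
    using assms smooth_on_continuous[OF assms(1)]
    by (intro compact_continuous_image) (auto intro: continuous_on_subset)
  then obtain C where C: "C > 0" "\<forall>y\<in>f ` closure \<Omega>. \<bar>y\<bar> \<le> C"
    using compact_imp_bounded bounded_pos by (metis real_norm_def)
  have "\<bar>f x\<bar> \<le> C" if "x \<in> \<Omega>" for x
    using C(2) closure_subset[of \<Omega>] that by (auto simp: subset_iff)
  with C(1) show ?thesis using that by blast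
qed

lemma locally_integrable_smooth_mult:
  fixes f u :: "'a::euclidean_space \<Rightarrow> real"
  assumes u: "locally_integrable \<Omega> u" and f: "smooth_on UNIV f"
  shows "locally_integrable \<Omega> (\<lambda>x. f x * u x)"
  unfolding locally_integrable_def
proof (intro allI impI)
  fix K assume K: "compact K \<and> K \<subseteq> \<Omega>"
  obtain C where C: "\<And>x. x \<in> K \<Longrightarrow> \<bar>f x\<bar> \<le> C"
    using smooth_bounded_on[OF f, of K] K compact_imp_bounded by metis
  have "integrable (lebesgue_on K) (\<lambda>x. u x * f x)"
    by (rule integrable_bounded_mult[OF _ borel_imp_lebesgue_on[OF smooth_borel_measurable[OF f]], where C = C])
      (use u K C in \<open>auto simp: locally_integrable_def\<close>)
  then show "integrable (lebesgue_on K) (\<lambda>x. f x * u x)" by (simp add: mult.commute)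
qed

lemma locally_integrable_smooth:
  fixes f :: "'a::euclidean_space \<Rightarrow> real"
  assumes "smooth_on UNIV f" shows "locally_integrable \<Omega> f"
proof -
  have "integrable (lebesgue_on K) (\<lambda>x. 1 :: real)" if "compact K" for K :: "'a set"
    using that integrable_restrict_space[of K lebesgue "\<lambda>x. 1 :: real"] lmeasurable_compact[of K]
    by (auto simp: fmeasurable_def compact_imp_closed closed_sets_lebesgue)
  then have "locally_integrable \<Omega> (\<lambda>x::'a. 1 :: real)" by (simp add: locally_integrable_def)
  from locally_integrable_smooth_mult[OF this assms] show ?thesis by simp
qed

section \<open>Weak derivatives\<close>

lemma has_weak_partialD:
  assumes "has_weak_partial \<Omega> i u g" "open \<Omega>" "i \<in> Basis"
  shows "locally_integrable \<Omega> u" "locally_integrable \<Omega> g"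
    "test_function \<Omega> \<phi> \<Longrightarrow> (\<integral>x. u x * pd i \<phi> x \<partial>lebesgue) = - (\<integral>x. g x * \<phi> x \<partial>lebesgue)"
proof -
  show "locally_integrable \<Omega> u" "locally_integrable \<Omega> g"
    using assms(1) by (simp_all add: has_weak_partial_def)
  assume \<phi>: "test_function \<Omega> \<phi>"
  have "(\<integral>x. u x * pd i \<phi> x \<partial>lebesgue_on \<Omega>) = - (\<integral>x. g x * \<phi> x \<partial>lebesgue_on \<Omega>)"
    using assms(1) \<phi> by (simp add: has_weak_partial_def)
  moreover have "(\<integral>x. u x * pd i \<phi> x \<partial>lebesgue_on \<Omega>) = (\<integral>x. u x * pd i \<phi> x \<partial>lebesgue)"
    by (rule integral_lebesgue_on_eq) (use assms(2) test_function_zero(2)[OF \<phi>] in auto)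
  moreover have "(\<integral>x. g x * \<phi> x \<partial>lebesgue_on \<Omega>) = (\<integral>x. g x * \<phi> x \<partial>lebesgue)"
    by (rule integral_lebesgue_on_eq) (use assms(2) test_function_zero(1)[OF \<phi>] in auto)
  ultimately show "(\<integral>x. u x * pd i \<phi> x \<partial>lebesgue) = - (\<integral>x. g x * \<phi> x \<partial>lebesgue)"
    by simp
qed

lemma has_weak_partialI:
  assumes "open \<Omega>" "locally_integrable \<Omega> u" "locally_integrable \<Omega> g"
    "\<And>\<phi>. test_function \<Omega> \<phi> \<Longrightarrow> (\<integral>x. u x * pd i \<phi> x \<partial>lebesgue) = - (\<integral>x. g x * \<phi> x \<partial>lebesgue)"
  shows "has_weak_partial \<Omega> i u g"
  unfolding has_weak_partial_def
proof (intro conjI assms(2,3) allI impI)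
  fix \<phi> assume \<phi>: "test_function \<Omega> \<phi>"
  have "(\<integral>x. u x * pd i \<phi> x \<partial>lebesgue_on \<Omega>) = (\<integral>x. u x * pd i \<phi> x \<partial>lebesgue)"
    by (rule integral_lebesgue_on_eq) (use assms(1) test_function_zero(2)[OF \<phi>] in auto)
  moreover have "(\<integral>x. g x * \<phi> x \<partial>lebesgue_on \<Omega>) = (\<integral>x. g x * \<phi> x \<partial>lebesgue)"
    by (rule integral_lebesgue_on_eq) (use assms(1) test_function_zero(1)[OF \<phi>] in auto)
  ultimately show "(\<integral>x. u x * pd i \<phi> x \<partial>lebesgue_on \<Omega>) = - (\<integral>x. g x * \<phi> x \<partial>lebesgue_on \<Omega>)"
    using assms(4)[OF \<phi>] by simp
qed

lemma has_weak_partial_lincomb: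
  assumes "open \<Omega>" "i \<in> Basis" "has_weak_partial \<Omega> i u g" "has_weak_partial \<Omega> i v h"
  shows "has_weak_partial \<Omega> i (\<lambda>x. a * u x + b * v x) (\<lambda>x. a * g x + b * h x)"
proof (rule has_weak_partialI[OF assms(1)])
  note u = has_weak_partialD[OF assms(3,1,2)] and v = has_weak_partialD[OF assms(4,1,2)]
  show "locally_integrable \<Omega> (\<lambda>x. a * u x + b * v x)" "locally_integrable \<Omega> (\<lambda>x. a * g x + b * h x)"
    using u(1,2) v(1,2) by (auto intro: locally_integrable_lincomb)
  have lin: "(\<integral>x. (a * p x + b * q x) * \<psi> x \<partial>lebesgue)
      = a * (\<integral>x. p x * \<psi> x \<partial>lebesgue) + b * (\<integral>x. q x * \<psi> x \<partial>lebesgue)"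
    if "locally_integrable \<Omega> p" "locally_integrable \<Omega> q" "test_function \<Omega> \<psi>" for p q \<psi>
  proof -
    have "(\<lambda>x. (a * p x + b * q x) * \<psi> x) = (\<lambda>x. a * (p x * \<psi> x) + b * (q x * \<psi> x))"
      by (simp add: algebra_simps)
    then show ?thesis
      using locally_integrable_mult_test[OF that(1,3)] locally_integrable_mult_test[OF that(2,3)] by simp
  qed
  fix \<phi> assume \<phi>: "test_function \<Omega> \<phi>"
  show "(\<integral>x. (a * u x + b * v x) * pd i \<phi> x \<partial>lebesgue) = - (\<integral>x. (a * g x + b * h x) * \<phi> x \<partial>lebesgue)"
    unfolding lin[OF u(1) v(1) test_function_pd[OF \<phi> assms(2)]] lin[OF u(2) v(2) \<phi>]
    by (simp add: u(3)[OF \<phi>] v(3)[OF \<phi>])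
qed

lemma locally_integrable_cong_AE:
  assumes "locally_integrable \<Omega> u" "AE x in lebesgue_on \<Omega>. u x = v x" "open \<Omega>"
  shows "locally_integrable \<Omega> v"
  unfolding locally_integrable_def
proof (intro allI impI)
  fix K :: "'a set" assume K: "compact K \<and> K \<subseteq> \<Omega>"
  then have Ks: "K \<in> sets lebesgue" by (simp add: compact_imp_closed closed_sets_lebesgue)
  have "AE x in lebesgue_on K. u x = v x"
    using K assms(3) by (intro AE_lebesgue_on_subset[OF assms(2) _ _ Ks]) auto
  then show "integrable (lebesgue_on K) v"
    using integrable_lebesgue_on_cong_AE[OF _ Ks] assms(1) K by (auto simp: locally_integrable_def)
qed

lemma has_weak_partial_cong_AE:
  assumes w: "has_weak_partial \<Omega> i u g" and o: "open \<Omega>"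
    and u: "AE x in lebesgue_on \<Omega>. u x = v x" and g: "AE x in lebesgue_on \<Omega>. g x = h x"
  shows "has_weak_partial \<Omega> i v h"
  unfolding has_weak_partial_def
proof (intro conjI allI impI)
  show "locally_integrable \<Omega> v" "locally_integrable \<Omega> h"
    using w locally_integrable_cong_AE[OF _ u o] locally_integrable_cong_AE[OF _ g o]
    by (auto simp: has_weak_partial_def)
  fix \<phi> assume \<phi>: "test_function \<Omega> \<phi>"
  have "(\<integral>x. v x * pd i \<phi> x \<partial>lebesgue_on \<Omega>) = (\<integral>x. u x * pd i \<phi> x \<partial>lebesgue_on \<Omega>)"
    by (rule integral_lebesgue_on_cong_AE) (use u o in auto)
  moreover have "(\<integral>x. h x * \<phi> x \<partial>lebesgue_on \<Omega>) = (\<integral>x. g x * \<phi> x \<partial>lebesgue_on \<Omega>)"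
    by (rule integral_lebesgue_on_cong_AE) (use g o in auto)
  ultimately show "(\<integral>x. v x * pd i \<phi> x \<partial>lebesgue_on \<Omega>) = - (\<integral>x. h x * \<phi> x \<partial>lebesgue_on \<Omega>)"
    using w \<phi> by (simp add: has_weak_partial_def)
qed

text \<open>Uniqueness makes the arbitrary choice in the definition of the weak partial derivative harmless.\<close>

lemma has_weak_partial_unique:
  assumes "has_weak_partial \<Omega> i u g" "has_weak_partial \<Omega> i v h" "open \<Omega>" "i \<in> Basis"
    and eq: "AE x in lebesgue_on \<Omega>. u x = v x"
  shows "AE x in lebesgue_on \<Omega>. g x = h x"
proof -
  have u: "has_weak_partial \<Omega> i v g"
    by (rule has_weak_partial_cong_AE[OF assms(1,3) eq]) simp
  note d = has_weak_partial_lincomb[OF assms(3,4) u assms(2), of 1 "- 1"]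
  have "(\<integral>x. (g x - h x) * \<phi> x \<partial>lebesgue) = 0" if "test_function \<Omega> \<phi>" for \<phi>
    using has_weak_partialD(3)[OF d assms(3,4) that] by simp
  then have "AE x in lebesgue_on \<Omega>. g x - h x = 0"
    using has_weak_partialD(2)[OF d assms(3,4)] by (intro fundamental_lemma assms(3)) auto
  then show ?thesis by simp
qed

lemma has_weak_partial_subset:
  assumes "has_weak_partial \<Omega> i u g" "open \<Omega>" "open \<Omega>'" "\<Omega>' \<subseteq> \<Omega>" "i \<in> Basis"
  shows "has_weak_partial \<Omega>' i u g"
  using has_weak_partialD[OF assms(1,2,5)] assms(3,4)
  by (intro has_weak_partialI) (auto intro: locally_integrable_subset test_function_mono)

lemma pd_translation:
  fixes f :: "'a::euclidean_space \<Rightarrow> real"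
  assumes "smooth_on UNIV f" shows "pd i (\<lambda>x. f (x + h)) x = pd i f (x + h)"
proof -
  have "((\<lambda>x. x + h) has_derivative (\<lambda>v. v)) (at x)"
    by (auto intro!: derivative_eq_intros)
  from has_derivative_compose[OF this smooth_on_has_derivative[OF assms]]
  have "((\<lambda>x. f (x + h)) has_derivative frechet_derivative f (at (x + h))) (at x)" by simp
  from frechet_derivative_at[OF this] show ?thesis by metis
qed

lemma smooth_on_translation: "smooth_on UNIV f \<Longrightarrow> smooth_on UNIV (\<lambda>x. f (x + h))"
  using smooth_on_affine[of f 1 h] by simp

lemma compact_image_translation: "compact K \<Longrightarrow> compact ((\<lambda>x. x + h) ` K)"
  for h :: "'a::real_normed_vector"
  by (intro compact_continuous_image continuous_intros)

lemma has_weak_partial_translation: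
  assumes w: "has_weak_partial \<Omega> i u g" and o: "open \<Omega>" "open \<Omega>'" and i: "i \<in> Basis"
    and sub: "\<And>x. x \<in> \<Omega>' \<Longrightarrow> x + h \<in> \<Omega>"
  shows "has_weak_partial \<Omega>' i (\<lambda>x. u (x + h)) (\<lambda>x. g (x + h))"
proof (rule has_weak_partialI[OF o(2)])
  note u = has_weak_partialD[OF w o(1) i]
  have loc: "locally_integrable \<Omega>' (\<lambda>x. p (x + h))" if p: "locally_integrable \<Omega> p" for p
    unfolding locally_integrable_def
  proof (intro allI impI)
    fix K assume K: "compact K \<and> K \<subseteq> \<Omega>'"
    let ?L = "(\<lambda>x. x + h) ` K"
    have L: "compact ?L" "?L \<subseteq> \<Omega>" using K sub by (auto intro: compact_image_translation)
    then have "integrable (lebesgue_on ?L) p" using p by (auto simp: locally_integrable_def)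
    then have "integrable lebesgue (\<lambda>x. indicator ?L x * p x)"
      using integrable_restrict_space[of ?L lebesgue p] L(1)
      by (simp add: compact_imp_closed closed_sets_lebesgue)
    from integrable_lebesgue_translation[OF this, of h]
    have "integrable lebesgue (\<lambda>x. indicator ?L (x + h) * p (x + h))" .
    moreover have "indicator ?L (x + h) = (indicator K x :: real)" for x
      by (auto simp: indicator_def)
    ultimately show "integrable (lebesgue_on K) (\<lambda>x. p (x + h))"
      using integrable_restrict_space[of K lebesgue "\<lambda>x. p (x + h)"] K
      by (simp add: compact_imp_closed closed_sets_lebesgue)
  qed
  show "locally_integrable \<Omega>' (\<lambda>x. u (x + h))" "locally_integrable \<Omega>' (\<lambda>x. g (x + h))"
    using loc u(1,2) by blast+
  fix \<phi> assume \<phi>: "test_function \<Omega>' \<phi>"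
  let ?\<phi> = "\<lambda>x. \<phi> (x + - h)"
  let ?K = "(\<lambda>x. x + h) ` closure {x. \<phi> x \<noteq> 0}"
  have t: "test_function \<Omega> ?\<phi>"
  proof (rule test_functionI[of _ ?K])
    show "smooth_on UNIV ?\<phi>" by (intro smooth_on_translation test_function_smooth[OF \<phi>])
    show "compact ?K" using \<phi> by (auto simp: test_function_def intro!: compact_image_translation)
    show "?K \<subseteq> \<Omega>" using \<phi> sub by (auto simp: test_function_def)
    fix x assume "x \<notin> ?K"
    then have "x + - h \<notin> closure {x. \<phi> x \<noteq> 0}"
      using image_eqI[of x "\<lambda>x. x + h" "x + - h"] by auto
    then show "\<phi> (x + - h) = 0" using closure_subset[of "{x. \<phi> x \<noteq> 0}"] by blast
  qed
  have s: "pd i ?\<phi> x = pd i \<phi> (x + - h)" for x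
    by (rule pd_translation[OF test_function_smooth[OF \<phi>]])
  have "(\<integral>x. u x * pd i ?\<phi> x \<partial>lebesgue) = (\<integral>x. u (x + h) * pd i ?\<phi> (x + h) \<partial>lebesgue)"
    unfolding s using integral_lebesgue_translation[OF locally_integrable_mult_test[OF u(1) test_function_pd[OF t i]], of h]
    unfolding s by simp
  moreover have "(\<integral>x. g x * ?\<phi> x \<partial>lebesgue) = (\<integral>x. g (x + h) * ?\<phi> (x + h) \<partial>lebesgue)"
    using integral_lebesgue_translation[OF locally_integrable_mult_test[OF u(2) t], of h]
    by simp
  ultimately show "(\<integral>x. u (x + h) * pd i \<phi> x \<partial>lebesgue) = - (\<integral>x. g (x + h) * \<phi> x \<partial>lebesgue)"
    using u(3)[OF t] unfolding s by simp
qed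

text \<open>Both terms of the Leibniz rule come from testing with the product of \<open>\<psi>\<close> and a test function.\<close>

lemma has_weak_partial_smooth_mult:
  assumes w: "has_weak_partial \<Omega> i u g" and o: "open \<Omega>" and i: "i \<in> Basis" and \<psi>: "smooth_on UNIV \<psi>"
  shows "has_weak_partial \<Omega> i (\<lambda>x. \<psi> x * u x) (\<lambda>x. \<psi> x * g x + pd i \<psi> x * u x)"
proof (rule has_weak_partialI[OF o])
  note u = has_weak_partialD[OF w o i]
  note \<psi>' = smooth_on_pd[OF \<psi> i]
  show 1: "locally_integrable \<Omega> (\<lambda>x. \<psi> x * u x)" using u(1) \<psi> by (rule locally_integrable_smooth_mult)
  have 2: "locally_integrable \<Omega> (\<lambda>x. pd i \<psi> x * u x)" using u(1) \<psi>' by (rule locally_integrable_smooth_mult)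
  have 3: "locally_integrable \<Omega> (\<lambda>x. \<psi> x * g x)" using u(2) \<psi> by (rule locally_integrable_smooth_mult)
  show "locally_integrable \<Omega> (\<lambda>x. \<psi> x * g x + pd i \<psi> x * u x)"
    using locally_integrable_lincomb[OF 3 2, of 1 1] by simp
  fix \<phi> assume \<phi>: "test_function \<Omega> \<phi>"
  have d: "pd i (\<lambda>x. \<psi> x * \<phi> x) x = \<psi> x * pd i \<phi> x + pd i \<psi> x * \<phi> x" for x
    using \<psi> test_function_smooth[OF \<phi>] by (intro pd_mult smooth_on_differentiable[of UNIV]) auto
  note t = test_function_smooth_mult[OF \<psi> \<phi>]
  have "(\<lambda>x. u x * pd i (\<lambda>x. \<psi> x * \<phi> x) x) = (\<lambda>x. \<psi> x * u x * pd i \<phi> x + pd i \<psi> x * u x * \<phi> x)"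
    by (simp only: d) (simp add: algebra_simps)
  then have "(\<integral>x. u x * pd i (\<lambda>x. \<psi> x * \<phi> x) x \<partial>lebesgue)
      = (\<integral>x. \<psi> x * u x * pd i \<phi> x \<partial>lebesgue) + (\<integral>x. pd i \<psi> x * u x * \<phi> x \<partial>lebesgue)"
    using locally_integrable_mult_test[OF 1 test_function_pd[OF \<phi> i]] locally_integrable_mult_test[OF 2 \<phi>]
    by simp
  moreover have "(\<lambda>x. (\<psi> x * g x + pd i \<psi> x * u x) * \<phi> x) = (\<lambda>x. \<psi> x * g x * \<phi> x + pd i \<psi> x * u x * \<phi> x)"
    by (simp add: algebra_simps)
  then have "(\<integral>x. (\<psi> x * g x + pd i \<psi> x * u x) * \<phi> x \<partial>lebesgue)
      = (\<integral>x. \<psi> x * g x * \<phi> x \<partial>lebesgue) + (\<integral>x. pd i \<psi> x * u x * \<phi> x \<partial>lebesgue)"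
    using locally_integrable_mult_test[OF 3 \<phi>] locally_integrable_mult_test[OF 2 \<phi>]
    by simp
  moreover have "g x * (\<psi> x * \<phi> x) = \<psi> x * g x * \<phi> x" for x by simp
  ultimately show "(\<integral>x. \<psi> x * u x * pd i \<phi> x \<partial>lebesgue)
      = - (\<integral>x. (\<psi> x * g x + pd i \<psi> x * u x) * \<phi> x \<partial>lebesgue)"
    using u(3)[OF t] by simp
qed

lemma has_real_derivative_along_line:
  fixes f :: "'a::euclidean_space \<Rightarrow> real"
  assumes "f differentiable (at (x + t *\<^sub>R v))"
  shows "((\<lambda>t. f (x + t *\<^sub>R v)) has_real_derivative frechet_derivative f (at (x + t *\<^sub>R v)) v) (at t)"
proof -
  let ?D = "frechet_derivative f (at (x + t *\<^sub>R v))"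
  have D: "(f has_derivative ?D) (at (x + t *\<^sub>R v))"
    using assms frechet_derivative_works by blast
  have "((\<lambda>t. x + t *\<^sub>R v) has_derivative (\<lambda>h. h *\<^sub>R v)) (at t)"
    by (auto intro!: derivative_eq_intros)
  from has_derivative_compose[OF this D]
  show ?thesis
    unfolding has_field_derivative_def
    by (rule back_subst[where P = "\<lambda>D. ((\<lambda>t. f (x + t *\<^sub>R v)) has_derivative D) (at t)"])
      (simp add: linear_cmul[OF has_derivative_linear[OF D]] fun_eq_iff)
qed

text \<open>The integral of a difference quotient vanishes by translation invariance, so the integral of
  the derivative of a test function vanishes as well.\<close>

lemma integral_pd_test_function:
  fixes \<phi> :: "'a::euclidean_space \<Rightarrow> real"
  assumes \<phi>: "test_function UNIV \<phi>" and i: "i \<in> Basis"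
  shows "(\<integral>x. pd i \<phi> x \<partial>lebesgue) = 0"
proof -
  note sm = test_function_smooth[OF \<phi>]
  have int: "integrable lebesgue \<phi>"
    using locally_integrable_mult_test[OF locally_integrable_smooth[OF smooth_on_const[OF open_UNIV, of 1]] \<phi>] by simp
  obtain C where C: "\<And>x. \<bar>pd i \<phi> x\<bar> \<le> C"
    using test_function_bounded[OF test_function_pd[OF \<phi> i]] by metis
  obtain R where R: "closure {x. \<phi> x \<noteq> 0} \<subseteq> ball 0 R"
    using \<phi> by (metis test_function_def bounded_subset_ballD compact_imp_bounded)
  define h :: "nat \<Rightarrow> real" where "h k = inverse (real (Suc k))" for k
  have h: "0 < h k" "h k \<le> 1" for k by (auto simp: h_def field_simps)
  define q where "q k x = (\<phi> (x + h k *\<^sub>R i) - \<phi> x) / h k" for k x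
  have "(\<lambda>k. \<integral>x. q k x \<partial>lebesgue) \<longlonglongrightarrow> (\<integral>x. pd i \<phi> x \<partial>lebesgue)"
  proof (rule integral_dominated_convergence[where w = "\<lambda>x. C * indicator (cball 0 (R + 1)) x"])
    show "(\<lambda>x. pd i \<phi> x) \<in> borel_measurable lebesgue"
      using borel_imp_lebesgue_on[OF smooth_borel_measurable[OF smooth_on_pd[OF sm i]], of UNIV]
      by (simp add: lebesgue_on_UNIV_eq)
    show "q k \<in> borel_measurable lebesgue" for k
      unfolding q_def using int integrable_lebesgue_translation[OF int] by auto
    show "integrable lebesgue (\<lambda>x. C * indicator (cball 0 (R + 1)) x)"
      using lmeasurable_cball[of 0 "R + 1"] by (auto simp: fmeasurable_def)
    have lim: "(\<lambda>k. q k x) \<longlonglongrightarrow> pd i \<phi> x" for x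
    proof -
      have "((\<lambda>t. \<phi> (x + t *\<^sub>R i)) has_real_derivative pd i \<phi> (x + 0 *\<^sub>R i)) (at 0)"
        using smooth_on_differentiable[OF sm] by (intro has_real_derivative_along_line) auto
      then have "((\<lambda>t. (\<phi> (x + t *\<^sub>R i) - \<phi> x) / t) \<longlongrightarrow> pd i \<phi> x) (at 0)"
        by (simp add: has_field_derivative_iff)
      moreover have "filterlim h (at 0) sequentially"
        unfolding filterlim_at using h LIMSEQ_inverse_real_of_nat
        by (auto simp: h_def[abs_def] eventually_sequentially)
      ultimately show ?thesis unfolding q_def by (rule filterlim_compose)
    qed
    then show "AE x in lebesgue. (\<lambda>k. q k x) \<longlonglongrightarrow> pd i \<phi> x" by simp
    have "\<bar>q k x\<bar> \<le> C * indicator (cball 0 (R + 1)) x" for k x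
    proof (cases "x \<in> cball 0 (R + 1)")
      case True
      have "\<exists>z. 0 < z \<and> z < h k \<and> \<phi> (x + h k *\<^sub>R i) - \<phi> (x + 0 *\<^sub>R i) = (h k - 0) * pd i \<phi> (x + z *\<^sub>R i)"
        by (rule MVT2[OF h(1)], rule has_real_derivative_along_line)
          (use smooth_on_differentiable[OF sm] in auto)
      then obtain z where "\<phi> (x + h k *\<^sub>R i) - \<phi> x = h k * pd i \<phi> (x + z *\<^sub>R i)" by auto
      then show ?thesis using h(1)[of k] C True by (simp add: q_def)
    next
      case False
      have "\<phi> y = 0" if "norm y \<ge> R" for y
        using R that closure_subset[of "{x. \<phi> x \<noteq> 0}"] by (auto simp: subset_iff)
      moreover have "norm (x + h k *\<^sub>R i) \<ge> R"
        using False h[of k] norm_triangle_ineq4[of "x + h k *\<^sub>R i" "h k *\<^sub>R i"] i by simp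
      ultimately show ?thesis using False by (simp add: q_def)
    qed
    then show "AE x in lebesgue. norm (q k x) \<le> C * indicator (cball 0 (R + 1)) x" for k by simp
  qed
  moreover have "(\<integral>x. q k x \<partial>lebesgue) = 0" for k
    unfolding q_def using int integrable_lebesgue_translation[OF int] integral_lebesgue_translation[OF int]
    by simp
  ultimately show ?thesis by (simp add: LIMSEQ_const_iff)
qed

lemma has_weak_partial_smooth:
  assumes f: "smooth_on UNIV f" and o: "open \<Omega>" and i: "i \<in> Basis"
  shows "has_weak_partial \<Omega> i f (\<lambda>x. pd i f x)"
proof (rule has_weak_partialI[OF o])
  note f' = smooth_on_pd[OF f i]
  show 1: "locally_integrable \<Omega> f" "locally_integrable \<Omega> (\<lambda>x. pd i f x)"
    using f f' by (auto intro: locally_integrable_smooth)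
  fix \<phi> assume \<phi>: "test_function \<Omega> \<phi>"
  have d: "pd i (\<lambda>x. f x * \<phi> x) x = f x * pd i \<phi> x + pd i f x * \<phi> x" for x
    using f test_function_smooth[OF \<phi>] by (intro pd_mult smooth_on_differentiable[of UNIV]) auto
  have "(\<integral>x. f x * pd i \<phi> x + pd i f x * \<phi> x \<partial>lebesgue) = 0"
    using integral_pd_test_function[OF test_function_mono[OF test_function_smooth_mult[OF f \<phi>]] i]
    by (simp add: d)
  then show "(\<integral>x. f x * pd i \<phi> x \<partial>lebesgue) = - (\<integral>x. pd i f x * \<phi> x \<partial>lebesgue)"
    using locally_integrable_mult_test[OF 1(1) test_function_pd[OF \<phi> i]]
      locally_integrable_mult_test[OF 1(2) \<phi>] by simp
qed

section \<open>Square integrable functions and Sobolev functions\<close>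

lemma abs_mult_le_sum_squares: "\<bar>a * b\<bar> \<le> a\<^sup>2 + b\<^sup>2" for a b :: real
  using sum_squares_bound[of "\<bar>a\<bar>" "\<bar>b\<bar>"] mult_nonneg_nonneg[OF abs_ge_zero abs_ge_zero, of a b]
  unfolding abs_mult power2_abs by linarith

lemma L2_mult_integrable:
  assumes "L2 \<Omega> u" "L2 \<Omega> v" shows "integrable (lebesgue_on \<Omega>) (\<lambda>x. u x * v x)"
proof (rule Bochner_Integration.integrable_bound)
  show "integrable (lebesgue_on \<Omega>) (\<lambda>x. (u x)\<^sup>2 + (v x)\<^sup>2)"
    using assms by (simp add: L2_def)
  show "(\<lambda>x. u x * v x) \<in> borel_measurable (lebesgue_on \<Omega>)"
    using assms by (simp add: L2_def borel_measurable_times)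
  show "AE x in lebesgue_on \<Omega>. norm (u x * v x) \<le> norm ((u x)\<^sup>2 + (v x)\<^sup>2)"
    using abs_mult_le_sum_squares by simp
qed

lemma L2_mult_bounded:
  assumes "L2 \<Omega> u" "g \<in> borel_measurable (lebesgue_on \<Omega>)" "\<And>x. x \<in> \<Omega> \<Longrightarrow> \<bar>g x\<bar> \<le> C"
  shows "L2 \<Omega> (\<lambda>x. g x * u x)"
proof -
  have "integrable (lebesgue_on \<Omega>) (\<lambda>x. (u x)\<^sup>2 * (g x)\<^sup>2)"
  proof (rule integrable_bounded_mult[where C = "C\<^sup>2"])
    show "\<bar>(g x)\<^sup>2\<bar> \<le> C\<^sup>2" if "x \<in> space (lebesgue_on \<Omega>)" for x
      using power_mono[of "\<bar>g x\<bar>" C 2] assms(3)[of x] that by (simp add: space_restrict_space)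
  qed (use assms in \<open>auto simp: L2_def\<close>)
  then show ?thesis
    using assms by (simp add: L2_def power_mult_distrib mult.commute borel_measurable_times)
qed

lemma L2_lincomb:
  assumes "L2 \<Omega> u" "L2 \<Omega> v" shows "L2 \<Omega> (\<lambda>x. a * u x + b * v x)"
proof -
  have "(\<lambda>x. (a * u x + b * v x)\<^sup>2) = (\<lambda>x. a\<^sup>2 * (u x)\<^sup>2 + 2 * a * b * (u x * v x) + b\<^sup>2 * (v x)\<^sup>2)"
    by (simp add: power2_eq_square algebra_simps)
  then have "integrable (lebesgue_on \<Omega>) (\<lambda>x. (a * u x + b * v x)\<^sup>2)"
    using assms L2_mult_integrable[OF assms] by (simp add: L2_def)
  then show ?thesis
    using assms by (auto simp: L2_def intro!: borel_measurable_add borel_measurable_times)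
qed

lemma L2_add: "L2 \<Omega> u \<Longrightarrow> L2 \<Omega> v \<Longrightarrow> L2 \<Omega> (\<lambda>x. u x + v x)"
  using L2_lincomb[of \<Omega> u v 1 1] by simp

lemma L2_diff: "L2 \<Omega> u \<Longrightarrow> L2 \<Omega> v \<Longrightarrow> L2 \<Omega> (\<lambda>x. u x - v x)"
  using L2_lincomb[of \<Omega> u v 1 "- 1"] by simp

lemma L2_cmult: "L2 \<Omega> u \<Longrightarrow> L2 \<Omega> (\<lambda>x. a * u x)"
  using L2_lincomb[of \<Omega> u u a 0] by simp

lemma L2_zero: "L2 \<Omega> (\<lambda>x. 0)"
  by (simp add: L2_def)

lemma L2_sum: "(\<And>i. i \<in> I \<Longrightarrow> L2 \<Omega> (u i)) \<Longrightarrow> L2 \<Omega> (\<lambda>x. \<Sum>i\<in>I. u i x)"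
  by (induction I rule: infinite_finite_induct) (auto intro: L2_add L2_zero)

lemma L2_cong_AE:
  assumes "L2 \<Omega> u" "AE x in lebesgue_on \<Omega>. u x = v x" "open \<Omega>"
  shows "L2 \<Omega> v"
proof -
  have o: "\<Omega> \<in> sets lebesgue" using assms(3) by auto
  have "AE x in lebesgue_on \<Omega>. (u x)\<^sup>2 = (v x)\<^sup>2" using assms(2) by auto
  then show ?thesis
    using assms(1) borel_measurable_lebesgue_on_AE[OF _ assms(2) o] integrable_lebesgue_on_cong_AE[OF _ o]
    unfolding L2_def by metis
qed

lemma L2_subset:
  assumes "L2 \<Omega> u" "\<Omega>' \<subseteq> \<Omega>" "\<Omega> \<in> sets lebesgue" "\<Omega>' \<in> sets lebesgue"
  shows "L2 \<Omega>' u"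
proof -
  have m: "u \<in> borel_measurable (lebesgue_on \<Omega>')"
    using assms by (auto simp: L2_def intro: measurable_restrict_mono)
  have "integrable lebesgue (\<lambda>x. indicator \<Omega> x *\<^sub>R (u x)\<^sup>2)"
    using assms integrable_restrict_space[of \<Omega> lebesgue "\<lambda>x. (u x)\<^sup>2"] by (simp add: L2_def)
  from integrable_mult_indicator[OF assms(4) this]
  have "integrable lebesgue (\<lambda>x. indicator \<Omega>' x *\<^sub>R (u x)\<^sup>2)"
    by (rule back_subst[where P = "integrable lebesgue"])
      (use assms(2) in \<open>auto simp: indicator_def fun_eq_iff\<close>)
  then show ?thesis
    using m integrable_restrict_space[of \<Omega>' lebesgue "\<lambda>x. (u x)\<^sup>2"] assms(4) by (simp add: L2_def)
qed

lemma weak_partial_props: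
  assumes "has_weak_partial \<Omega> i u g" "open \<Omega>" "i \<in> Basis"
  shows "has_weak_partial \<Omega> i u (weak_partial \<Omega> i u)"
    "AE x in lebesgue_on \<Omega>. weak_partial \<Omega> i u x = g x"
proof -
  show 1: "has_weak_partial \<Omega> i u (weak_partial \<Omega> i u)"
    unfolding weak_partial_def using someI[of "\<lambda>g. has_weak_partial \<Omega> i u g", OF assms(1)] .
  show "AE x in lebesgue_on \<Omega>. weak_partial \<Omega> i u x = g x"
    by (rule has_weak_partial_unique[OF 1 assms]) simp
qed

lemma H1_weak_partial:
  assumes "H1 \<Omega> u" "open \<Omega>" "i \<in> Basis"
  shows "has_weak_partial \<Omega> i u (weak_partial \<Omega> i u)" "L2 \<Omega> (weak_partial \<Omega> i u)"
proof -
  obtain g where g: "L2 \<Omega> g" "has_weak_partial \<Omega> i u g"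
    using assms by (auto simp: H1_def)
  show "has_weak_partial \<Omega> i u (weak_partial \<Omega> i u)"
    using weak_partial_props(1)[OF g(2) assms(2,3)] .
  show "L2 \<Omega> (weak_partial \<Omega> i u)"
    using weak_partial_props(2)[OF g(2) assms(2,3)]
    by (intro L2_cong_AE[OF g(1) _ assms(2)]) auto
qed

section \<open>Approximation in the mean square\<close>

lemma square_sum_le: "(a + b)\<^sup>2 \<le> 2 * a\<^sup>2 + 2 * b\<^sup>2" for a b :: real
  using sum_squares_bound[of a b] by (simp add: power2_sum)

lemma square_sum3_le: "(a + b + c)\<^sup>2 \<le> 3 * (a\<^sup>2 + b\<^sup>2 + c\<^sup>2)" for a b c :: real
  using sum_squares_bound[of a b] sum_squares_bound[of a c] sum_squares_bound[of b c]
  by (simp add: power2_eq_square algebra_simps)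

lemma young_inequality: "a > 0 \<Longrightarrow> \<bar>x\<bar> * \<bar>y\<bar> \<le> a / 2 * x\<^sup>2 + (1 / (2 * a)) * y\<^sup>2" for a x y :: real
  using sum_squares_bound[of "a * \<bar>x\<bar>" "\<bar>y\<bar>"] by (simp add: field_simps power2_eq_square)

lemma square_integrable_add:
  fixes p q :: "'a \<Rightarrow> real"
  assumes [measurable]: "p \<in> borel_measurable M" "q \<in> borel_measurable M"
    and "integrable M (\<lambda>x. (p x)\<^sup>2)" "integrable M (\<lambda>x. (q x)\<^sup>2)"
  shows "integrable M (\<lambda>x. (p x + q x)\<^sup>2)"
    "(\<integral>x. (p x + q x)\<^sup>2 \<partial>M) \<le> 2 * (\<integral>x. (p x)\<^sup>2 \<partial>M) + 2 * (\<integral>x. (q x)\<^sup>2 \<partial>M)"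
proof -
  have b: "integrable M (\<lambda>x. 2 * (p x)\<^sup>2 + 2 * (q x)\<^sup>2)" using assms by simp
  show i: "integrable M (\<lambda>x. (p x + q x)\<^sup>2)"
    by (rule Bochner_Integration.integrable_bound[OF b]) (auto intro!: AE_I2 square_sum_le)
  have "(\<integral>x. (p x + q x)\<^sup>2 \<partial>M) \<le> (\<integral>x. 2 * (p x)\<^sup>2 + 2 * (q x)\<^sup>2 \<partial>M)"
    by (rule integral_mono[OF i b]) (rule square_sum_le)
  then show "(\<integral>x. (p x + q x)\<^sup>2 \<partial>M) \<le> 2 * (\<integral>x. (p x)\<^sup>2 \<partial>M) + 2 * (\<integral>x. (q x)\<^sup>2 \<partial>M)"
    using assms by simp
qed

definition clamp_real :: "real \<Rightarrow> real \<Rightarrow> real" where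
  "clamp_real m t = max (- m) (min m t)"

lemma truncation_measurable:
  fixes q :: "'a::euclidean_space \<Rightarrow> real"
  assumes "q \<in> borel_measurable borel"
  shows "(\<lambda>x. indicator (cball 0 r) x * clamp_real m (q x)) \<in> borel_measurable borel"
  unfolding clamp_real_def using assms
  by (intro borel_measurable_times borel_measurable_indicator borel_measurable_max borel_measurable_min) auto

lemma truncation_approx:
  fixes q :: "'a::euclidean_space \<Rightarrow> real"
  assumes q[measurable]: "q \<in> borel_measurable borel" and i: "integrable lborel (\<lambda>x. (q x)\<^sup>2)" and e: "e > 0"
  obtains m :: nat where
    "(\<integral>x. (q x - indicator (cball 0 (real m)) x * clamp_real m (q x))\<^sup>2 \<partial>lborel) < e"
    "integrable lborel (\<lambda>x. (q x - indicator (cball 0 (real m)) x * clamp_real m (q x))\<^sup>2)"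
proof -
  let ?d = "\<lambda>m x. (q x - indicator (cball 0 (real m)) x * clamp_real m (q x))\<^sup>2"
  have m[measurable]: "?d m \<in> borel_measurable lborel" for m :: nat
    using truncation_measurable[OF q, of "real m" m] by simp
  have b: "?d m x \<le> (q x)\<^sup>2" for x and m :: nat
    unfolding abs_le_square_iff[symmetric] by (auto simp: clamp_real_def indicator_def)
  have "(\<lambda>m. \<integral>x. ?d m x \<partial>lborel) \<longlonglongrightarrow> (\<integral>x. (0::real) \<partial>(lborel :: 'a measure))"
  proof (rule integral_dominated_convergence[where w = "\<lambda>x. (q x)\<^sup>2"])
    have "(\<lambda>m. ?d m x) \<longlonglongrightarrow> 0" for x
    proof (rule tendsto_eventually)
      obtain N :: nat where N: "norm x + \<bar>q x\<bar> \<le> real N" using real_arch_simple by blast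
      show "\<forall>\<^sub>F m in sequentially. ?d m x = 0"
        using eventually_ge_at_top[of N]
      proof eventually_elim
        case (elim m)
        then have "norm x \<le> real m" "\<bar>q x\<bar> \<le> real m"
          using N norm_ge_zero[of x] abs_ge_zero[of "q x"] of_nat_mono[OF elim, where 'a = real] by linarith+
        then show ?case by (auto simp: clamp_real_def abs_le_iff)
      qed
    qed
    then show "AE x in lborel. (\<lambda>m. ?d m x) \<longlonglongrightarrow> 0" by simp
    show "AE x in lborel. norm (?d m x) \<le> (q x)\<^sup>2" for m using b by simp
  qed (use i in auto)
  then have "\<forall>\<^sub>F m in sequentially. (\<integral>x. ?d m x \<partial>lborel) < e"
    using e order_tendstoD(2) by fastforce
  then obtain m where "(\<integral>x. ?d m x \<partial>lborel) < e" by (auto simp: eventually_sequentially)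
  moreover have "integrable lborel (?d m)"
    by (rule Bochner_Integration.integrable_bound[OF i]) (use b in auto)
  ultimately show ?thesis using that by blast
qed

text \<open>Continuous functions with bounded support are dense among the square integrable ones: after
  truncation, a measurable function is an almost everywhere limit of continuous functions, and
  truncating those as well makes the convergence dominated.\<close>

lemma continuous_approx_L2:
  fixes q :: "'a::euclidean_space \<Rightarrow> real"
  assumes q[measurable]: "q \<in> borel_measurable borel" and i: "integrable lborel (\<lambda>x. (q x)\<^sup>2)" and e: "e > 0"
  obtains g R where "continuous_on UNIV g" "\<And>x. norm x \<ge> R \<Longrightarrow> g x = 0"
    "integrable lborel (\<lambda>x. (q x - g x)\<^sup>2)" "(\<integral>x. (q x - g x)\<^sup>2 \<partial>lborel) < e"
proof -
  obtain m :: nat where m: "(\<integral>x. (q x - indicator (cball 0 (real m)) x * clamp_real m (q x))\<^sup>2 \<partial>lborel) < e / 4"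
    "integrable lborel (\<lambda>x. (q x - indicator (cball 0 (real m)) x * clamp_real m (q x))\<^sup>2)"
    using truncation_approx[OF q i, of "e / 4"] e by auto
  define r where "r x = indicator (cball 0 (real m)) x * clamp_real m (q x)" for x
  have r[measurable]: "r \<in> borel_measurable borel"
    unfolding r_def by (rule truncation_measurable[OF q])
  have "r measurable_on UNIV"
    using measurable_on_iff_borel_measurable[of UNIV r] borel_imp_lebesgue_on[OF r, of UNIV] by simp
  then obtain N g where N: "negligible N" "\<And>n. continuous_on UNIV (g n)"
    "\<And>x. x \<notin> N \<Longrightarrow> (\<lambda>n. g n x) \<longlonglongrightarrow> r x"
    by (auto simp: measurable_on_def)
  define cut where "cut x = max 0 (min 1 (real m + 1 - norm x))" for x :: 'a
  define h where "h n x = cut x * clamp_real m (g n x)" for n x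
  have hc: "continuous_on UNIV (h n)" for n
    unfolding h_def cut_def clamp_real_def by (intro continuous_intros N(2))
  then have hm[measurable]: "h n \<in> borel_measurable borel" for n
    by (rule borel_measurable_continuous_onI)
  have cut0: "cut x = 0" if "norm x \<ge> real m + 1" for x using that by (simp add: cut_def)
  have cut1: "cut x = 1" if "norm x \<le> real m" for x using that by (simp add: cut_def)
  have cut01: "0 \<le> cut x" "cut x \<le> 1" for x by (auto simp: cut_def)
  have cl: "\<bar>clamp_real m t\<bar> \<le> real m" for t by (auto simp: clamp_real_def)
  let ?w = "\<lambda>x::'a. (2 * real m)\<^sup>2 * indicator (cball 0 (real m + 1)) x"
  have wi: "integrable lborel ?w"
    using emeasure_bounded_finite[of "cball (0::'a) (real m + 1)"]
    by (intro integrable_mult_right integrable_real_indicator) auto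
  have b: "(r x - h n x)\<^sup>2 \<le> ?w x" for n x
  proof (cases "x \<in> cball 0 (real m + 1)")
    case True
    have "\<bar>r x\<bar> \<le> real m" using cl by (auto simp: r_def indicator_def)
    moreover have "\<bar>h n x\<bar> \<le> real m"
      using mult_mono[OF cut01(2) cl, of "g n x" x] cut01(1)[of x] by (simp add: h_def abs_mult)
    ultimately have "\<bar>r x - h n x\<bar> \<le> \<bar>2 * real m\<bar>" by linarith
    then show ?thesis
      using True abs_le_square_iff[of "r x - h n x" "2 * real m"] by simp
  next
    case False
    then show ?thesis using cut0[of x] by (simp add: r_def h_def)
  qed
  have "(\<lambda>n. \<integral>x. (r x - h n x)\<^sup>2 \<partial>lborel) \<longlonglongrightarrow> (\<integral>x. (0::real) \<partial>(lborel :: 'a measure))"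
  proof (rule integral_dominated_convergence[OF _ _ wi])
    have "(\<lambda>n. (r x - h n x)\<^sup>2) \<longlonglongrightarrow> 0" if "x \<notin> N" for x
    proof -
      have "(\<lambda>n. h n x) \<longlonglongrightarrow> cut x * clamp_real m (r x)"
        unfolding h_def clamp_real_def by (intro tendsto_intros N(3) that)
      moreover have "cut x * clamp_real m (r x) = r x"
        using cut1[of x] by (auto simp: r_def clamp_real_def indicator_def)
      ultimately have "(\<lambda>n. (r x - h n x)\<^sup>2) \<longlonglongrightarrow> (r x - r x)\<^sup>2" by (intro tendsto_intros) simp
      then show ?thesis by simp
    qed
    moreover have "AE x in lebesgue. x \<notin> N"
      using N(1) by (simp add: negligible_iff_null_sets AE_not_in)
    ultimately have "AE x in lebesgue. (\<lambda>n. (r x - h n x)\<^sup>2) \<longlonglongrightarrow> 0" by auto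
    then show "AE x in lborel. (\<lambda>n. (r x - h n x)\<^sup>2) \<longlonglongrightarrow> 0" by (simp add: AE_completion_iff)
  qed (use b in auto)
  then have "\<forall>\<^sub>F n in sequentially. (\<integral>x. (r x - h n x)\<^sup>2 \<partial>lborel) < e / 4"
    using e order_tendstoD(2)[of _ _ _ "e / 4"] by fastforce
  then obtain n where n: "(\<integral>x. (r x - h n x)\<^sup>2 \<partial>lborel) < e / 4" by (auto simp: eventually_sequentially)
  have ni: "integrable lborel (\<lambda>x. (r x - h n x)\<^sup>2)"
    by (rule Bochner_Integration.integrable_bound[OF wi]) (use b in \<open>auto intro: order_trans[OF _ abs_ge_self]\<close>)
  have "(\<lambda>x. q x - r x) \<in> borel_measurable lborel" "(\<lambda>x. r x - h n x) \<in> borel_measurable lborel"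
    by simp_all
  note square_integrable_add[OF this m(2)[folded r_def] ni]
  then have "integrable lborel (\<lambda>x. (q x - h n x)\<^sup>2)" "(\<integral>x. (q x - h n x)\<^sup>2 \<partial>lborel) < e"
    using m(1) n by (simp_all add: r_def)
  moreover have "h n x = 0" if "norm x \<ge> real m + 1" for x using cut0[OF that] by (simp add: h_def)
  ultimately show ?thesis using that[OF hc] by blast
qed

text \<open>By translation and reflection invariance of Lebesgue measure, integrating out one variable of a kernel
  in \<open>x - y\<close> leaves its total mass.\<close>

lemma
  fixes r k :: "'a::euclidean_space \<Rightarrow> real"
  assumes r: "integrable lborel r" and k: "integrable lborel k"
  shows kernel_marginal_fst: "has_bochner_integral (lborel \<Otimes>\<^sub>M lborel) (\<lambda>(x, y). r x * k (x - y))
      ((\<integral>x. r x \<partial>lborel) * (\<integral>x. k x \<partial>lborel))"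
    and kernel_marginal_snd: "has_bochner_integral (lborel \<Otimes>\<^sub>M lborel) (\<lambda>(x, y). r y * k (x - y))
      ((\<integral>x. r x \<partial>lborel) * (\<integral>x. k x \<partial>lborel))"
proof -
  have [measurable]: "r \<in> borel_measurable borel" "k \<in> borel_measurable borel"
    using r k by (auto dest: borel_measurable_integrable)
  have refl: "integrable lborel (\<lambda>y. j (x - y))" "(\<integral>y. j (x - y) \<partial>lborel) = (\<integral>y. j y \<partial>lborel)"
    if j: "integrable lborel j" for j :: "'a \<Rightarrow> real" and x
  proof -
    have [measurable]: "j \<in> borel_measurable borel" using j by (auto dest: borel_measurable_integrable)
    have d: "distr lborel borel (\<lambda>y. x - y) = lborel"
      using lborel_affine[of "- 1" x] by (simp add: density_1)
    show "integrable lborel (\<lambda>y. j (x - y))" "(\<integral>y. j (x - y) \<partial>lborel) = (\<integral>y. j y \<partial>lborel)"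
      using integrable_distr_eq[of "\<lambda>y. x - y" lborel borel j] integral_distr[of "\<lambda>y. x - y" lborel borel j] j
      by (simp_all add: d)
  qed
  have shift: "integrable lborel (\<lambda>x. j (x - y))" "(\<integral>x. j (x - y) \<partial>lborel) = (\<integral>y. j y \<partial>lborel)"
    if j: "integrable lborel j" for j :: "'a \<Rightarrow> real" and y
  proof -
    have [measurable]: "j \<in> borel_measurable borel" using j by (auto dest: borel_measurable_integrable)
    have "(+) (- y) = (\<lambda>x. x - y)" by (simp add: fun_eq_iff)
    then have d: "distr lborel borel (\<lambda>x. x - y) = lborel"
      using lborel_distr_plus[of "- y"] by simp
    show "integrable lborel (\<lambda>x. j (x - y))" "(\<integral>x. j (x - y) \<partial>lborel) = (\<integral>y. j y \<partial>lborel)"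
      using integrable_distr_eq[of "\<lambda>x. x - y" lborel borel j] integral_distr[of "\<lambda>x. x - y" lborel borel j] j
      by (simp_all add: d)
  qed
  note [simp] = refl[OF k] shift[OF k] refl[OF integrable_abs[OF k]] shift[OF integrable_abs[OF k]]
  have i1: "integrable (lborel \<Otimes>\<^sub>M lborel) (\<lambda>(x, y). r x * k (x - y))"
    by (rule lborel_pair.Fubini_integrable) (use r in \<open>auto simp: abs_mult\<close>)
  have i2': "integrable (lborel \<Otimes>\<^sub>M lborel) (\<lambda>(y, x). r y * k (x - y))"
    by (rule lborel_pair.Fubini_integrable) (use r in \<open>auto simp: abs_mult\<close>)
  have i2: "integrable (lborel \<Otimes>\<^sub>M lborel) (\<lambda>(x, y). r y * k (x - y))"
    using lborel_pair.integrable_product_swap[OF i2'] by simp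
  show "has_bochner_integral (lborel \<Otimes>\<^sub>M lborel) (\<lambda>(x, y). r x * k (x - y))
      ((\<integral>x. r x \<partial>lborel) * (\<integral>x. k x \<partial>lborel))"
    using i1 lborel_pair.integral_fst'[OF i1] by (simp add: has_bochner_integral_iff)
  show "has_bochner_integral (lborel \<Otimes>\<^sub>M lborel) (\<lambda>(x, y). r y * k (x - y))
      ((\<integral>x. r x \<partial>lborel) * (\<integral>x. k x \<partial>lborel))"
    using i2 lborel_pair.integral_snd[OF i2] by (simp add: has_bochner_integral_iff)
qed

lemma kernel_product_integrable:
  fixes p q k :: "'a::euclidean_space \<Rightarrow> real"
  assumes [measurable]: "p \<in> borel_measurable borel" "q \<in> borel_measurable borel"
    and p: "integrable lborel (\<lambda>x. (p x)\<^sup>2)" and q: "integrable lborel (\<lambda>x. (q x)\<^sup>2)" and k: "integrable lborel k"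
  shows "integrable (lborel \<Otimes>\<^sub>M lborel) (\<lambda>(x, y). p x * q y * k (x - y))"
proof -
  have [measurable]: "k \<in> borel_measurable borel" using k by (auto dest: borel_measurable_integrable)
  have "integrable (lborel \<Otimes>\<^sub>M lborel) (\<lambda>z. (case z of (x, y) \<Rightarrow> (p x)\<^sup>2 * \<bar>k (x - y)\<bar>) + (case z of (x, y) \<Rightarrow> (q y)\<^sup>2 * \<bar>k (x - y)\<bar>))"
    using kernel_marginal_fst[OF p integrable_abs[OF k]] kernel_marginal_snd[OF q integrable_abs[OF k]]
    by (intro Bochner_Integration.integrable_add) (auto simp: has_bochner_integral_iff)
  then show ?thesis
  proof (rule Bochner_Integration.integrable_bound)
    from mult_right_mono[OF abs_mult_le_sum_squares abs_ge_zero]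
    show "AE z in lborel \<Otimes>\<^sub>M lborel. norm (case z of (x, y) \<Rightarrow> p x * q y * k (x - y))
      \<le> norm ((case z of (x, y) \<Rightarrow> (p x)\<^sup>2 * \<bar>k (x - y)\<bar>) + (case z of (x, y) \<Rightarrow> (q y)\<^sup>2 * \<bar>k (x - y)\<bar>))"
      by (auto intro!: AE_I2 simp: abs_mult distrib_right)
  qed measurable
qed

text \<open>Mollification converges weakly. The error splits into three squares, two of which come from
  the approximation of \<open>q\<close> by a continuous function and one from its modulus of continuity.\<close>

lemma mollification_converges:
  fixes p q :: "'a::euclidean_space \<Rightarrow> real"
  assumes pm[measurable]: "p \<in> borel_measurable borel" and qm[measurable]: "q \<in> borel_measurable borel"
    and p: "integrable lborel (\<lambda>x. (p x)\<^sup>2)" and q: "integrable lborel (\<lambda>x. (q x)\<^sup>2)" and e: "e > 0"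
  shows "\<exists>d>0. \<forall>\<eta>. integrable lborel \<eta> \<longrightarrow> (\<forall>x. \<eta> x \<ge> 0) \<longrightarrow> (\<integral>x. \<eta> x \<partial>lborel) = 1 \<longrightarrow>
     (\<forall>x. x \<notin> ball 0 d \<longrightarrow> \<eta> x = 0) \<longrightarrow>
     \<bar>(\<integral>(x, y). p x * q y * \<eta> (x - y) \<partial>(lborel \<Otimes>\<^sub>M lborel)) - (\<integral>x. p x * q x \<partial>lborel)\<bar> < e"
proof -
  define P where "P = (\<integral>x. (p x)\<^sup>2 \<partial>lborel)"
  have P0: "P \<ge> 0" unfolding P_def by simp
  \<comment> \<open>The error is at most \<open>a P / 2\<close>, which is below \<open>e / 2\<close>, plus three terms \<open>3 s / (2 a) = e / 16\<close>.\<close>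
  define a where "a = e / (P + 1)"
  have a: "a > 0" "a * P < e" using e P0 by (auto simp: a_def field_simps)
  define s where "s = e * a / 24"
  have s: "s > 0" using a e by (simp add: s_def)
  obtain g R where g: "continuous_on UNIV g" and gR: "\<And>x. norm x \<ge> R \<Longrightarrow> g x = 0"
    and gi: "integrable lborel (\<lambda>x. (q x - g x)\<^sup>2)" and gs: "(\<integral>x. (q x - g x)\<^sup>2 \<partial>lborel) < s"
    by (rule continuous_approx_L2[OF qm q s]) (rule that)
  have gm[measurable]: "g \<in> borel_measurable borel"
    using g by (rule borel_measurable_continuous_onI)
  define B where "B = cball (0::'a) (R + 1)"
  define w where "w = sqrt (s / (measure lborel B + 1))"
  have w: "w > 0" "w\<^sup>2 * measure lborel B < s"
  proof -
    have b: "measure lborel B + 1 > 0" using measure_nonneg[of lborel B] by linarith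
    then have pos: "s / (measure lborel B + 1) > 0" using s by simp
    then show "w > 0" by (simp add: w_def)
    have "w\<^sup>2 * measure lborel B = s * measure lborel B / (measure lborel B + 1)"
      using pos by (simp add: w_def)
    also have "\<dots> < s"
      using b s by (simp add: pos_divide_less_eq distrib_left)
    finally show "w\<^sup>2 * measure lborel B < s" .
  qed
  have "uniformly_continuous_on (cball 0 (R + 2)) g"
    by (rule compact_uniformly_continuous) (use g in \<open>auto intro: continuous_on_subset\<close>)
  then obtain d where d: "d > 0" "\<And>x y. x \<in> cball 0 (R + 2) \<Longrightarrow> y \<in> cball 0 (R + 2) \<Longrightarrow> dist y x < d \<Longrightarrow> dist (g y) (g x) < w"
    using w(1) unfolding uniformly_continuous_on_def by metis
  define d' where "d' = min d 1"
  have d': "d' > 0" using d by (simp add: d'_def)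
  have gdiff: "(g y - g x)\<^sup>2 \<le> w\<^sup>2 * indicator B x" if "norm (x - y) < d'" for x y
  proof (cases "x \<in> B")
    case True
    then have "norm y \<le> R + 2" using that norm_triangle_ineq4[of x "x - y"] by (auto simp: B_def d'_def)
    then have "dist (g y) (g x) < w"
      using True that by (intro d(2)) (auto simp: B_def d'_def dist_norm norm_minus_commute)
    then have "\<bar>g y - g x\<bar> \<le> \<bar>w\<bar>" by (simp add: dist_real_def)
    then show ?thesis using True by (simp add: abs_le_square_iff[symmetric])
  next
    case False
    then have "norm x > R + 1" by (simp add: B_def)
    moreover from this have "norm y \<ge> R" using that norm_triangle_sub[of x y] by (auto simp: d'_def)
    ultimately have "g x = 0" "g y = 0" using gR by auto
    then show ?thesis by simp
  qed
  show ?thesis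
  proof (intro exI[of _ d'] conjI d' allI impI)
    fix \<eta> :: "'a \<Rightarrow> real"
    assume \<eta>: "integrable lborel \<eta>" "\<forall>x. \<eta> x \<ge> 0" "(\<integral>x. \<eta> x \<partial>lborel) = 1" "\<forall>x. x \<notin> ball 0 d' \<longrightarrow> \<eta> x = 0"
    have [measurable]: "\<eta> \<in> borel_measurable borel" using \<eta>(1) by (auto dest: borel_measurable_integrable)
    let ?M = "lborel \<Otimes>\<^sub>M lborel :: ('a \<times> 'a) measure"
    have pq: "integrable lborel (\<lambda>x. p x * q x)"
    proof (rule Bochner_Integration.integrable_bound)
      show "integrable lborel (\<lambda>x. (p x)\<^sup>2 + (q x)\<^sup>2)" using p q by simp
      show "AE x in lborel. norm (p x * q x) \<le> norm ((p x)\<^sup>2 + (q x)\<^sup>2)"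
        using abs_mult_le_sum_squares by simp
    qed measurable
    have ti: "integrable ?M (\<lambda>(x, y). p x * q y * \<eta> (x - y))"
      by (rule kernel_product_integrable[OF pm qm p q \<eta>(1)])
    have di: "has_bochner_integral ?M (\<lambda>(x, y). p x * q x * \<eta> (x - y)) (\<integral>x. p x * q x \<partial>lborel)"
      using kernel_marginal_fst[OF pq \<eta>(1)] \<eta>(3) by simp
    define E where "E = (\<lambda>(x, y). (a / 2 * (p x)\<^sup>2) * \<eta> (x - y) + ((3 / (2 * a)) * (q x - g x)\<^sup>2) * \<eta> (x - y)
      + ((3 / (2 * a)) * (w\<^sup>2 * indicator B x)) * \<eta> (x - y) + ((3 / (2 * a)) * (q y - g y)\<^sup>2) * \<eta> (x - y))"
    have B: "integrable lborel (\<lambda>x. w\<^sup>2 * indicator B x)" 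
      using emeasure_bounded_finite[of B] by (simp add: B_def)
    have hbE: "has_bochner_integral ?M E (a / 2 * P + (3 / (2 * a)) * (\<integral>x. (q x - g x)\<^sup>2 \<partial>lborel)
       + (3 / (2 * a)) * (w\<^sup>2 * measure lborel B) + (3 / (2 * a)) * (\<integral>x. (q x - g x)\<^sup>2 \<partial>lborel))"
    proof -
      have 1: "has_bochner_integral ?M (\<lambda>(x, y). (a / 2 * (p x)\<^sup>2) * \<eta> (x - y)) (a / 2 * P)"
        using kernel_marginal_fst[OF integrable_mult_right[OF p, of "a / 2"] \<eta>(1)] \<eta>(3) by (simp add: P_def)
      have 2: "has_bochner_integral ?M (\<lambda>(x, y). ((3 / (2 * a)) * (q x - g x)\<^sup>2) * \<eta> (x - y)) ((3 / (2 * a)) * (\<integral>x. (q x - g x)\<^sup>2 \<partial>lborel))"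
        using kernel_marginal_fst[OF integrable_mult_right[OF gi, of "3 / (2 * a)"] \<eta>(1)] \<eta>(3) by simp
      have 3: "has_bochner_integral ?M (\<lambda>(x, y). ((3 / (2 * a)) * (w\<^sup>2 * indicator B x)) * \<eta> (x - y)) ((3 / (2 * a)) * (w\<^sup>2 * measure lborel B))"
        using kernel_marginal_fst[OF integrable_mult_right[OF B, of "3 / (2 * a)"] \<eta>(1)] \<eta>(3) by simp
      have 4: "has_bochner_integral ?M (\<lambda>(x, y). ((3 / (2 * a)) * (q y - g y)\<^sup>2) * \<eta> (x - y)) ((3 / (2 * a)) * (\<integral>x. (q x - g x)\<^sup>2 \<partial>lborel))"
        using kernel_marginal_snd[OF integrable_mult_right[OF gi, of "3 / (2 * a)"] \<eta>(1)] \<eta>(3) by simp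
      show ?thesis
        using has_bochner_integral_add[OF has_bochner_integral_add[OF has_bochner_integral_add[OF 1 2] 3] 4]
        by (simp add: E_def case_prod_beta')
    qed
    have bound: "\<bar>p x * q y * \<eta> (x - y) - p x * q x * \<eta> (x - y)\<bar> \<le> E (x, y)" for x y
    proof (cases "norm (x - y) < d'")
      case True
      let ?u = "q y - g y" and ?v = "g y - g x" and ?z = "g x - q x"
      have sq: "(?u + ?v + ?z)\<^sup>2 \<le> 3 * (?u\<^sup>2 + ?v\<^sup>2 + ?z\<^sup>2)"
        by (rule square_sum3_le)
      have "\<bar>p x\<bar> * \<bar>q y - q x\<bar> \<le> a / 2 * (p x)\<^sup>2 + (1 / (2 * a)) * (q y - q x)\<^sup>2"
        by (rule young_inequality[OF a(1)])
      also have "(1 / (2 * a)) * (q y - q x)\<^sup>2 \<le> (1 / (2 * a)) * (3 * (?u\<^sup>2 + ?v\<^sup>2 + ?z\<^sup>2))"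
        using sq a(1) by (intro mult_left_mono) auto
      also have "\<dots> \<le> (1 / (2 * a)) * (3 * (?u\<^sup>2 + w\<^sup>2 * indicator B x + ?z\<^sup>2))"
        using gdiff[OF True] a(1) by (intro mult_left_mono add_mono) auto
      finally have "\<bar>p x\<bar> * \<bar>q y - q x\<bar> * \<eta> (x - y)
        \<le> (a / 2 * (p x)\<^sup>2 + (1 / (2 * a)) * (3 * (?u\<^sup>2 + w\<^sup>2 * indicator B x + ?z\<^sup>2))) * \<eta> (x - y)"
        using \<eta>(2) by (intro mult_right_mono) auto
      also have "\<dots> = E (x, y)"
        by (simp add: E_def algebra_simps power2_commute[of "g x" "q x"])
      finally show ?thesis
        using \<eta>(2) by (simp add: abs_mult left_diff_distrib[symmetric] right_diff_distrib[symmetric] mult.assoc)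
    next
      case False
      then have "\<eta> (x - y) = 0" using \<eta>(4) by simp
      then show ?thesis by (simp add: E_def)
    qed
    have "(\<integral>(x, y). p x * q y * \<eta> (x - y) \<partial>?M) - (\<integral>x. p x * q x \<partial>lborel)
        = (\<integral>z. (case z of (x, y) \<Rightarrow> p x * q y * \<eta> (x - y)) - (case z of (x, y) \<Rightarrow> p x * q x * \<eta> (x - y)) \<partial>?M)"
      unfolding Bochner_Integration.integral_diff[OF ti integrable.intros[OF di]]
        has_bochner_integral_integral_eq[OF di] ..
    also have "\<bar>\<dots>\<bar> \<le> (\<integral>z. E z \<partial>?M)"
    proof (rule order_trans[OF integral_abs_bound], rule integral_mono)
      show "integrable ?M (\<lambda>z. \<bar>(case z of (x, y) \<Rightarrow> p x * q y * \<eta> (x - y)) - (case z of (x, y) \<Rightarrow> p x * q x * \<eta> (x - y))\<bar>)"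
        by (intro integrable_abs Bochner_Integration.integrable_diff[OF ti integrable.intros[OF di]])
      show "integrable ?M E" using hbE by (rule integrable.intros)
    qed (use bound in \<open>auto split: prod.splits\<close>)
    also have "\<dots> = a / 2 * P + (3 / (2 * a)) * (\<integral>x. (q x - g x)\<^sup>2 \<partial>lborel)
       + (3 / (2 * a)) * (w\<^sup>2 * measure lborel B) + (3 / (2 * a)) * (\<integral>x. (q x - g x)\<^sup>2 \<partial>lborel)"
      using hbE by (simp add: has_bochner_integral_iff)
    also have "\<dots> \<le> a / 2 * P + (3 / (2 * a)) * s + (3 / (2 * a)) * s + (3 / (2 * a)) * s"
      using gs w(2) a(1) by (intro add_mono mult_left_mono) auto
    also have "\<dots> < e"
      using a e by (simp add: s_def field_simps)
    finally show "\<bar>(\<integral>(x, y). p x * q y * \<eta> (x - y) \<partial>?M) - (\<integral>x. p x * q x \<partial>lborel)\<bar> < e" .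
  qed
qed

section \<open>The product rule for Sobolev functions\<close>

lemma mollifier_exists:
  fixes e :: real assumes "e > 0"
  obtains \<eta> :: "'a::euclidean_space \<Rightarrow> real" where "test_function (ball 0 e) \<eta>" "\<And>x. \<eta> x \<ge> 0"
    "integrable lborel \<eta>" "(\<integral>x. \<eta> x \<partial>lborel) = 1"
proof -
  obtain a b :: 'a where ab: "cbox a b \<subseteq> ball 0 e" "0 \<in> box a b" "\<forall>i\<in>Basis. a \<bullet> i < b \<bullet> i"
    using open_contains_cbox[of "ball 0 e" 0] assms by auto
  let ?b = "bump_box 1 a b Basis"
  have t: "test_function (ball 0 e) ?b" by (rule bump_box_test_function[OF _ ab(1)]) simp
  have m: "?b \<in> borel_measurable borel" by (rule smooth_borel_measurable[OF smooth_bump_box])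
  have "integrable lebesgue (\<lambda>x. 1 * ?b x)"
    by (rule locally_integrable_mult_test[OF locally_integrable_smooth[OF smooth_on_const] t]) simp
  then have i: "integrable lborel ?b" using m by (simp add: integrable_completion)
  define c where "c = (\<integral>x. ?b x \<partial>lborel)"
  have "c \<ge> 0" unfolding c_def by (intro integral_nonneg_AE AE_I2 bump_box_bounds)
  moreover have "c \<noteq> 0"
  proof
    assume "c = 0"
    then have "AE x in lborel. ?b x = 0"
      using integral_nonneg_eq_0_iff_AE[OF i AE_I2[OF bump_box_bounds(1)]] by (simp add: c_def)
    then have "AE x in lborel. x \<notin> box a b"
      by eventually_elim (use bump_box_pos_iff[of 1 a b] in force)
    then have "emeasure lborel (box a b) = 0"
      using AE_iff_measurable[of "box a b" lborel "\<lambda>x. x \<notin> box a b"] by simp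
    moreover have "emeasure lborel (box a b) = ennreal (\<Prod>i\<in>Basis. (b - a) \<bullet> i)"
      using ab(3) by (simp add: emeasure_lborel_box_eq less_imp_le)
    moreover have "(\<Prod>i\<in>Basis. (b - a) \<bullet> i) > 0"
      using ab(3) by (intro prod_pos) (simp add: inner_diff_left)
    ultimately show False by (simp add: ennreal_eq_0_iff)
  qed
  ultimately have c: "c > 0" by simp
  show ?thesis
  proof (rule that[of "\<lambda>x. inverse c * ?b x"])
    show "test_function (ball 0 e) (\<lambda>x. inverse c * ?b x)"
      by (rule test_function_smooth_mult[OF smooth_on_const t]) simp
    show "(\<integral>x. inverse c * ?b x \<partial>lborel) = 1" using c i by (simp add: c_def)
    show "0 \<le> inverse c * ?b x" for x
      using c bump_box_bounds(1)[of 1 a b Basis x] by simp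
  qed (use i in simp)
qed

lemma integral_lborel_eq_lebesgue:
  fixes p r :: "'a::euclidean_space \<Rightarrow> real"
  assumes "p \<in> borel_measurable borel" "AE x in lebesgue. p x = r x"
  shows "(\<integral>x. p x \<partial>lborel) = (\<integral>x. r x \<partial>lebesgue)"
  using integral_completion[of p lborel] integral_lebesgue_on_cong_AE[where S = UNIV and f = p and g = r, unfolded lebesgue_on_UNIV_eq] assms
  by simp

lemma L2_borel_representative:
  assumes "L2 \<Omega> f" "open \<Omega>"
  obtains F where "F \<in> borel_measurable borel" "integrable lborel (\<lambda>x. (F x)\<^sup>2)"
    "AE x in lebesgue. F x = (if x \<in> \<Omega> then f x else 0)"
proof -
  have o: "\<Omega> \<in> sets lebesgue" using assms(2) by auto
  let ?f = "\<lambda>x. if x \<in> \<Omega> then f x else 0"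
  have "?f \<in> borel_measurable lebesgue"
    using assms o by (simp add: borel_measurable_if L2_def)
  from completion_ex_borel_measurable_real[OF this]
  obtain F where F: "F \<in> borel_measurable lborel" and ae: "AE x in lborel. ?f x = F x" by auto
  have ae': "AE x in lebesgue. (?f x)\<^sup>2 = (F x)\<^sup>2" using AE_completion[OF ae] by auto
  have "integrable lebesgue (\<lambda>x. indicator \<Omega> x *\<^sub>R (f x)\<^sup>2)"
    using assms o integrable_restrict_space[of \<Omega> lebesgue "\<lambda>x. (f x)\<^sup>2"] by (simp add: L2_def)
  then have "integrable lebesgue (\<lambda>x. (?f x)\<^sup>2)"
    by (rule back_subst[where P = "integrable lebesgue"]) (auto simp: indicator_def fun_eq_iff)
  then have "integrable lebesgue (\<lambda>x. (F x)\<^sup>2)"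
    using integrable_lebesgue_on_cong_AE[where S = UNIV and f = "\<lambda>x. (?f x)\<^sup>2" and g = "\<lambda>x. (F x)\<^sup>2", unfolded lebesgue_on_UNIV_eq] ae'
    by simp
  then have "integrable lborel (\<lambda>x. (F x)\<^sup>2)" using F by (simp add: integrable_completion)
  moreover have "AE x in lebesgue. F x = ?f x" using AE_completion[OF ae] by auto
  ultimately show ?thesis using that F by simp
qed

text \<open>The pairing of two rough functions is regularised by a kernel in the difference of the
  arguments. A derivative falls on the kernel from either variable with opposite signs, so for each
  kernel the product rule holds exactly, and the kernels may then shrink to the diagonal.\<close>

lemma weak_product_rule:
  fixes f f' v v' \<zeta> :: "'a::euclidean_space \<Rightarrow> real"
  assumes o: "open \<Omega>" and i: "i \<in> Basis"
    and wf: "has_weak_partial \<Omega> i f f'" and wv: "has_weak_partial \<Omega> i v v'"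
    and L2: "L2 \<Omega> f" "L2 \<Omega> f'" "L2 \<Omega> v" "L2 \<Omega> v'" and \<zeta>: "test_function \<Omega> \<zeta>"
  shows "(\<integral>x. \<zeta> x * (f' x * v x + f x * v' x) + pd i \<zeta> x * (f x * v x) \<partial>lebesgue_on \<Omega>) = 0"
proof -
  obtain F where F[measurable]: "F \<in> borel_measurable borel" and Fi: "integrable lborel (\<lambda>x. (F x)\<^sup>2)"
    and Fe: "AE x in lebesgue. F x = (if x \<in> \<Omega> then f x else 0)" by (rule L2_borel_representative[OF L2(1) o])
  obtain F' where F'[measurable]: "F' \<in> borel_measurable borel" and F'i: "integrable lborel (\<lambda>x. (F' x)\<^sup>2)"
    and F'e: "AE x in lebesgue. F' x = (if x \<in> \<Omega> then f' x else 0)" by (rule L2_borel_representative[OF L2(2) o])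
  obtain W where W[measurable]: "W \<in> borel_measurable borel" and Wi: "integrable lborel (\<lambda>x. (W x)\<^sup>2)"
    and We: "AE x in lebesgue. W x = (if x \<in> \<Omega> then v x else 0)" by (rule L2_borel_representative[OF L2(3) o])
  obtain W' where W'[measurable]: "W' \<in> borel_measurable borel" and W'i: "integrable lborel (\<lambda>x. (W' x)\<^sup>2)"
    and W'e: "AE x in lebesgue. W' x = (if x \<in> \<Omega> then v' x else 0)" by (rule L2_borel_representative[OF L2(4) o])
  note \<zeta>' = test_function_pd[OF \<zeta> i]
  have meas[measurable]: "\<zeta> \<in> borel_measurable borel" "(\<lambda>x. pd i \<zeta> x) \<in> borel_measurable borel"
    using test_function_smooth[OF \<zeta>] test_function_smooth[OF \<zeta>'] by (auto intro: smooth_borel_measurable)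
  define V where "V x = \<zeta> x * W x" for x
  define G where "G x = \<zeta> x * W' x + pd i \<zeta> x * W x" for x
  have Vm[measurable]: "V \<in> borel_measurable borel" and Gm[measurable]: "G \<in> borel_measurable borel"
    unfolding V_def G_def by measurable
  have bnd: "integrable lborel (\<lambda>x. (\<psi> x * p x)\<^sup>2)"
    if \<psi>: "test_function \<Omega> \<psi>" and p: "integrable lborel (\<lambda>x. (p x)\<^sup>2)" for \<psi> p :: "'a \<Rightarrow> real"
  proof -
    obtain C where C: "\<And>x. \<bar>\<psi> x\<bar> \<le> C" using test_function_bounded[OF \<psi>] by metis
    have [measurable]: "\<psi> \<in> borel_measurable borel"
      using test_function_smooth[OF \<psi>] by (rule smooth_borel_measurable)
    have "integrable lborel (\<lambda>x. (p x)\<^sup>2 * (\<psi> x)\<^sup>2)"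
    proof (rule integrable_bounded_mult[OF p, where C = "C\<^sup>2"])
      show "\<bar>(\<psi> x)\<^sup>2\<bar> \<le> C\<^sup>2" for x using power_mono[OF C abs_ge_zero, of x 2] by simp
    qed measurable
    then show ?thesis by (simp add: power_mult_distrib mult.commute)
  qed
  have Vi: "integrable lborel (\<lambda>x. (V x)\<^sup>2)" unfolding V_def by (rule bnd[OF \<zeta> Wi])
  have Gi: "integrable lborel (\<lambda>x. (G x)\<^sup>2)"
    unfolding G_def by (rule square_integrable_add(1)) (use bnd[OF \<zeta> W'i] bnd[OF \<zeta>' Wi] in auto)
  let ?K = "closure {x. \<zeta> x \<noteq> 0}"
  have K: "compact ?K" "?K \<subseteq> \<Omega>" using \<zeta> by (auto simp: test_function_def)
  obtain e where e: "e > 0" "(\<Union>y\<in>?K. ball y e) \<subseteq> \<Omega>"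
    using compact_subset_open_imp_ball_epsilon_subset[OF K(1) o K(2)] by metis
  have VK: "V y = 0" if "y \<notin> ?K" for y
    using that closure_subset[of "{x. \<zeta> x \<noteq> 0}"] by (auto simp: V_def)
  let ?M = "lborel \<Otimes>\<^sub>M lborel :: ('a \<times> 'a) measure"
  have exact: "(\<integral>(x, y). F' x * V y * \<eta> (x - y) \<partial>?M) + (\<integral>(x, y). F x * G y * \<eta> (x - y) \<partial>?M) = 0"
    if \<eta>: "test_function (ball 0 e) \<eta>" and \<eta>i: "integrable lborel \<eta>" for \<eta>
  proof -
    note \<eta>s = test_function_smooth[OF \<eta>] and \<eta>' = test_function_pd[OF \<eta> i]
    have [measurable]: "\<eta> \<in> borel_measurable borel" "(\<lambda>x. pd i \<eta> x) \<in> borel_measurable borel"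
      using \<eta>s test_function_smooth[OF \<eta>'] by (auto intro: smooth_borel_measurable)
    have "integrable lebesgue (\<lambda>x. 1 * pd i \<eta> x)"
      by (rule locally_integrable_mult_test[OF locally_integrable_smooth[OF smooth_on_const] \<eta>']) simp
    then have \<eta>'i: "integrable lborel (\<lambda>x. pd i \<eta> x)" by (simp add: integrable_completion)
    have inner_x: "(\<integral>x. F x * V y * pd i \<eta> (x - y) \<partial>lborel) = - (\<integral>x. F' x * V y * \<eta> (x - y) \<partial>lborel)" for y
    proof (cases "y \<in> ?K")
      case False
      then show ?thesis using VK by simp
    next
      case True
      let ?\<phi> = "\<lambda>x. \<eta> (x + - y)"
      have t: "test_function \<Omega> ?\<phi>"
      proof (rule test_functionI[OF smooth_on_translation[OF \<eta>s] compact_image_translation[of "closure {x. \<eta> x \<noteq> 0}" y]])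
        show "compact (closure {x. \<eta> x \<noteq> 0})" using \<eta> by (simp add: test_function_def)
        have "x + y \<in> \<Omega>" if "x \<in> ball 0 e" for x
          using e(2) True that by (force simp: dist_norm)
        then show "(\<lambda>x. x + y) ` closure {x. \<eta> x \<noteq> 0} \<subseteq> \<Omega>"
          using \<eta> by (auto simp: test_function_def)
        fix x assume "x \<notin> (\<lambda>x. x + y) ` closure {x. \<eta> x \<noteq> 0}"
        then have "x + - y \<notin> closure {x. \<eta> x \<noteq> 0}"
          using image_eqI[of x "\<lambda>x. x + y" "x + - y"] by auto
        then show "\<eta> (x + - y) = 0" using closure_subset[of "{x. \<eta> x \<noteq> 0}"] by blast
      qed
      have d: "pd i ?\<phi> x = pd i \<eta> (x - y)" for x using pd_translation[OF \<eta>s, where i = i and h = "- y" and x = x] by simp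
      have "(\<integral>x. F x * pd i \<eta> (x - y) \<partial>lborel) = (\<integral>x. f x * pd i ?\<phi> x \<partial>lebesgue)"
      proof (rule integral_lborel_eq_lebesgue)
        show "AE x in lebesgue. F x * pd i \<eta> (x - y) = f x * pd i ?\<phi> x"
          using Fe by eventually_elim (use test_function_zero(2)[OF t, of _ i] in \<open>auto simp only: d split: if_splits\<close>)
      qed measurable
      moreover have "(\<integral>x. F' x * \<eta> (x - y) \<partial>lborel) = (\<integral>x. f' x * ?\<phi> x \<partial>lebesgue)"
      proof (rule integral_lborel_eq_lebesgue)
        show "AE x in lebesgue. F' x * \<eta> (x - y) = f' x * ?\<phi> x"
          using F'e by eventually_elim (use test_function_zero(1)[OF t] in \<open>auto split: if_splits\<close>)
      qed measurable
      ultimately have "(\<integral>x. F x * pd i \<eta> (x - y) \<partial>lborel) = - (\<integral>x. F' x * \<eta> (x - y) \<partial>lborel)"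
        using has_weak_partialD(3)[OF wf o i t] by simp
      then have "V y * (\<integral>x. F x * pd i \<eta> (x - y) \<partial>lborel) = - (V y * (\<integral>x. F' x * \<eta> (x - y) \<partial>lborel))" by simp
      then show ?thesis
        unfolding integral_mult_right_zero[symmetric] by (simp add: mult_ac)
    qed
    have inner_y: "(\<integral>y. F x * V y * pd i \<eta> (x - y) \<partial>lborel) = (\<integral>y. F x * G y * \<eta> (x - y) \<partial>lborel)" for x
    proof -
      let ?\<psi> = "\<lambda>y. \<eta> ((- 1) *\<^sub>R y + x)"
      have \<psi>s: "smooth_on UNIV ?\<psi>" by (rule smooth_on_affine[OF \<eta>s])
      have d: "pd i ?\<psi> y = - pd i \<eta> (x - y)" for y
      proof -
        have "((\<lambda>y. (- 1) *\<^sub>R y + x) has_derivative (\<lambda>v. - v)) (at y)"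
          by (auto intro!: derivative_eq_intros)
        from has_derivative_compose[OF this smooth_on_has_derivative[OF \<eta>s UNIV_I]]
        have "(?\<psi> has_derivative (\<lambda>v. frechet_derivative \<eta> (at ((- 1) *\<^sub>R y + x)) (- v))) (at y)" .
        from frechet_derivative_at[OF this]
        have "pd i ?\<psi> y = frechet_derivative \<eta> (at ((- 1) *\<^sub>R y + x)) (- i)" by metis
        also have "\<dots> = - pd i \<eta> ((- 1) *\<^sub>R y + x)"
          using linear_neg[OF has_derivative_linear[OF smooth_on_has_derivative[OF \<eta>s UNIV_I]]] .
        finally show ?thesis by simp
      qed
      have t: "test_function \<Omega> (\<lambda>y. ?\<psi> y * \<zeta> y)" by (rule test_function_smooth_mult[OF \<psi>s \<zeta>])
      have t1: "test_function \<Omega> (\<lambda>y. pd i ?\<psi> y * \<zeta> y)"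
        by (rule test_function_smooth_mult[OF smooth_on_pd[OF \<psi>s i] \<zeta>])
      have t2: "test_function \<Omega> (\<lambda>y. ?\<psi> y * pd i \<zeta> y)"
        by (rule test_function_smooth_mult[OF \<psi>s \<zeta>'])
      note loc = has_weak_partialD(1,2)[OF wv o i]
      note int = locally_integrable_mult_test[OF loc(1) t1] locally_integrable_mult_test[OF loc(1) t2]
        locally_integrable_mult_test[OF loc(2) t]
      have "pd i (\<lambda>y. ?\<psi> y * \<zeta> y) y = ?\<psi> y * pd i \<zeta> y + pd i ?\<psi> y * \<zeta> y" for y
        using \<psi>s test_function_smooth[OF \<zeta>] by (intro pd_mult smooth_on_differentiable[of UNIV]) auto
      then have "(\<integral>y. v y * (pd i ?\<psi> y * \<zeta> y) \<partial>lebesgue) + (\<integral>y. v y * (?\<psi> y * pd i \<zeta> y) \<partial>lebesgue)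
          = - (\<integral>y. v' y * (?\<psi> y * \<zeta> y) \<partial>lebesgue)"
        using has_weak_partialD(3)[OF wv o i t] int(1,2) by (simp add: distrib_left)
      then have "(\<integral>y. - (v y * (pd i ?\<psi> y * \<zeta> y)) \<partial>lebesgue)
          = (\<integral>y. v y * (?\<psi> y * pd i \<zeta> y) + v' y * (?\<psi> y * \<zeta> y) \<partial>lebesgue)"
        using int by simp
      moreover have "(\<integral>y. V y * pd i \<eta> (x - y) \<partial>lborel) = (\<integral>y. - (v y * (pd i ?\<psi> y * \<zeta> y)) \<partial>lebesgue)"
      proof (rule integral_lborel_eq_lebesgue)
        show "AE y in lebesgue. V y * pd i \<eta> (x - y) = - (v y * (pd i ?\<psi> y * \<zeta> y))"
          unfolding V_def d using We
          by eventually_elim (use test_function_zero(1)[OF \<zeta>] in \<open>auto split: if_splits\<close>)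
      qed measurable
      moreover have "(\<integral>y. G y * \<eta> (x - y) \<partial>lborel)
          = (\<integral>y. v y * (?\<psi> y * pd i \<zeta> y) + v' y * (?\<psi> y * \<zeta> y) \<partial>lebesgue)"
      proof (rule integral_lborel_eq_lebesgue)
        show "AE y in lebesgue. G y * \<eta> (x - y) = v y * (?\<psi> y * pd i \<zeta> y) + v' y * (?\<psi> y * \<zeta> y)"
          using We W'e
          by eventually_elim (use test_function_zero[OF \<zeta>] in \<open>auto simp add: G_def algebra_simps split: if_splits\<close>)
      qed measurable
      ultimately have "F x * (\<integral>y. V y * pd i \<eta> (x - y) \<partial>lborel) = F x * (\<integral>y. G y * \<eta> (x - y) \<partial>lborel)" by simp
      then show ?thesis
        unfolding integral_mult_right_zero[symmetric] by (simp add: mult_ac)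
    qed
    note I1 = kernel_product_integrable[OF F Vm Fi Vi \<eta>'i]
    note I2 = kernel_product_integrable[OF F' Vm F'i Vi \<eta>i]
    note I3 = kernel_product_integrable[OF F Gm Fi Gi \<eta>i]
    have "(\<integral>(x, y). F x * V y * pd i \<eta> (x - y) \<partial>?M) = (\<integral>y. \<integral>x. F x * V y * pd i \<eta> (x - y) \<partial>lborel \<partial>lborel)"
      using lborel_pair.integral_snd[OF I1] by simp
    also have "\<dots> = - (\<integral>y. \<integral>x. F' x * V y * \<eta> (x - y) \<partial>lborel \<partial>lborel)"
      by (simp add: inner_x)
    also have "\<dots> = - (\<integral>(x, y). F' x * V y * \<eta> (x - y) \<partial>?M)"
      using lborel_pair.integral_snd[OF I2] by simp
    finally have 1: "(\<integral>(x, y). F x * V y * pd i \<eta> (x - y) \<partial>?M) = - (\<integral>(x, y). F' x * V y * \<eta> (x - y) \<partial>?M)" .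
    have "(\<integral>(x, y). F x * V y * pd i \<eta> (x - y) \<partial>?M) = (\<integral>x. \<integral>y. F x * V y * pd i \<eta> (x - y) \<partial>lborel \<partial>lborel)"
      using lborel_pair.integral_fst'[OF I1] by simp
    also have "\<dots> = (\<integral>x. \<integral>y. F x * G y * \<eta> (x - y) \<partial>lborel \<partial>lborel)"
      by (simp add: inner_y)
    also have "\<dots> = (\<integral>(x, y). F x * G y * \<eta> (x - y) \<partial>?M)"
      using lborel_pair.integral_fst'[OF I3] by simp
    finally show ?thesis using 1 by simp
  qed
  have prod_int: "integrable lborel (\<lambda>x. p x * q x)"
    if [measurable]: "p \<in> borel_measurable borel" "q \<in> borel_measurable borel"
      and "integrable lborel (\<lambda>x. (p x)\<^sup>2)" "integrable lborel (\<lambda>x. (q x)\<^sup>2)" for p q :: "'a \<Rightarrow> real"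
    by (rule Bochner_Integration.integrable_bound[of _ "\<lambda>x. (p x)\<^sup>2 + (q x)\<^sup>2"])
      (use that abs_mult_le_sum_squares in auto)
  have "\<bar>(\<integral>x. F' x * V x \<partial>lborel) + (\<integral>x. F x * G x \<partial>lborel)\<bar> < 2 * \<epsilon>" if \<epsilon>: "\<epsilon> > 0" for \<epsilon> :: real
  proof -
    obtain d1 where d1: "d1 > 0" "\<forall>\<eta>. integrable lborel \<eta> \<longrightarrow> (\<forall>x. \<eta> x \<ge> 0) \<longrightarrow> (\<integral>x. \<eta> x \<partial>lborel) = 1 \<longrightarrow>
     (\<forall>x. x \<notin> ball 0 d1 \<longrightarrow> \<eta> x = 0) \<longrightarrow>
     \<bar>(\<integral>(x, y). F' x * V y * \<eta> (x - y) \<partial>?M) - (\<integral>x. F' x * V x \<partial>lborel)\<bar> < \<epsilon>"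
      using mollification_converges[OF F' Vm F'i Vi \<epsilon>] by blast
    obtain d2 where d2: "d2 > 0" "\<forall>\<eta>. integrable lborel \<eta> \<longrightarrow> (\<forall>x. \<eta> x \<ge> 0) \<longrightarrow> (\<integral>x. \<eta> x \<partial>lborel) = 1 \<longrightarrow>
     (\<forall>x. x \<notin> ball 0 d2 \<longrightarrow> \<eta> x = 0) \<longrightarrow>
     \<bar>(\<integral>(x, y). F x * G y * \<eta> (x - y) \<partial>?M) - (\<integral>x. F x * G x \<partial>lborel)\<bar> < \<epsilon>"
      using mollification_converges[OF F Gm Fi Gi \<epsilon>] by blast
    obtain \<eta> :: "'a \<Rightarrow> real" where \<eta>: "test_function (ball 0 (min e (min d1 d2))) \<eta>" "\<And>x. \<eta> x \<ge> 0"
      "integrable lborel \<eta>" "(\<integral>x. \<eta> x \<partial>lborel) = 1"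
      by (rule mollifier_exists[of "min e (min d1 d2)"]) (use e(1) d1(1) d2(1) in auto)
    have z: "\<eta> x = 0" if "x \<notin> ball 0 d1 \<or> x \<notin> ball 0 d2" for x
      by (rule test_function_zero(1)[OF \<eta>(1)]) (use that in auto)
    have "(\<integral>(x, y). F' x * V y * \<eta> (x - y) \<partial>?M) + (\<integral>(x, y). F x * G y * \<eta> (x - y) \<partial>?M) = 0"
      by (rule exact[OF test_function_mono[OF \<eta>(1)] \<eta>(3)]) auto
    moreover have "\<bar>(\<integral>(x, y). F' x * V y * \<eta> (x - y) \<partial>?M) - (\<integral>x. F' x * V x \<partial>lborel)\<bar> < \<epsilon>"
      using z \<eta> d1(2) by blast
    moreover have "\<bar>(\<integral>(x, y). F x * G y * \<eta> (x - y) \<partial>?M) - (\<integral>x. F x * G x \<partial>lborel)\<bar> < \<epsilon>"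
      using z \<eta> d2(2) by blast
    ultimately show ?thesis by linarith
  qed
  from this[of "\<bar>(\<integral>x. F' x * V x \<partial>lborel) + (\<integral>x. F x * G x \<partial>lborel)\<bar> / 2"]
  have "(\<integral>x. F' x * V x \<partial>lborel) + (\<integral>x. F x * G x \<partial>lborel) = 0" by auto
  then have "(\<integral>x. F' x * V x + F x * G x \<partial>lborel) = 0"
    using prod_int[OF F' Vm F'i Vi] prod_int[OF F Gm Fi Gi] by simp
  moreover have "(\<integral>x. F' x * V x + F x * G x \<partial>lborel)
      = (\<integral>x. \<zeta> x * (f' x * v x + f x * v' x) + pd i \<zeta> x * (f x * v x) \<partial>lebesgue)"
  proof (rule integral_lborel_eq_lebesgue)
    show "AE x in lebesgue. F' x * V x + F x * G x = \<zeta> x * (f' x * v x + f x * v' x) + pd i \<zeta> x * (f x * v x)"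
      using Fe F'e We W'e
      by eventually_elim
        (use test_function_zero[OF \<zeta>] in \<open>auto simp add: V_def G_def algebra_simps split: if_splits\<close>)
  qed measurable
  moreover have "(\<integral>x. \<zeta> x * (f' x * v x + f x * v' x) + pd i \<zeta> x * (f x * v x) \<partial>lebesgue_on \<Omega>)
      = (\<integral>x. \<zeta> x * (f' x * v x + f x * v' x) + pd i \<zeta> x * (f x * v x) \<partial>lebesgue)"
    by (rule integral_lebesgue_on_eq) (use o test_function_zero[OF \<zeta>] in auto)
  ultimately show ?thesis by simp
qed

section \<open>Defining functions of a smooth domain\<close>

definition grad :: "('a::euclidean_space \<Rightarrow> real) \<Rightarrow> 'a \<Rightarrow> 'a" where
  "grad f x = (\<Sum>i\<in>Basis. pd i f x *\<^sub>R i)"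

lemma frechet_derivative_eq_grad:
  assumes "f differentiable at x" shows "frechet_derivative f (at x) h = h \<bullet> grad f x"
proof -
  have lin: "linear (frechet_derivative f (at x))"
    using assms frechet_derivative_works has_derivative_linear by blast
  have "frechet_derivative f (at x) h = frechet_derivative f (at x) (\<Sum>i\<in>Basis. (h \<bullet> i) *\<^sub>R i)"
    by (simp add: euclidean_representation)
  also have "\<dots> = (\<Sum>i\<in>Basis. (h \<bullet> i) * pd i f x)"
    by (simp add: linear_sum[OF lin] linear_cmul[OF lin])
  also have "\<dots> = h \<bullet> grad f x"
    by (simp add: grad_def inner_sum_right mult.commute)
  finally show ?thesis .
qed

lemma GDERIV_grad:
  assumes "f differentiable at x" shows "GDERIV f x :> grad f x"
proof -
  have "frechet_derivative f (at x) = (\<lambda>h. h \<bullet> grad f x)"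
    using frechet_derivative_eq_grad[OF assms] by (rule ext)
  then show ?thesis
    unfolding gderiv_def using assms frechet_derivative_works by metis
qed

lemma grad_inner_Basis: "i \<in> Basis \<Longrightarrow> grad f x \<bullet> i = pd i f x"
  by (simp add: grad_def inner_sum_left inner_Basis if_distrib cong: if_cong)

text \<open>If two defining functions had gradients that are not positively parallel, there would be a
  direction along which one increases and the other decreases.\<close>

lemma sgn_grad_unique:
  assumes \<rho>: "local_defining_function \<Omega> V \<rho>" "x \<in> V" "GDERIV \<rho> x :> g"
    and \<rho>': "local_defining_function \<Omega> V' \<rho>'" "x \<in> V'" "GDERIV \<rho>' x :> g'"
    and x: "x \<in> frontier \<Omega>"
  shows "sgn g = sgn g'"
proof (rule ccontr)
  assume ne: "sgn g \<noteq> sgn g'"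
  have g0: "g \<noteq> 0" "g' \<noteq> 0" using \<rho> \<rho>' by (auto simp: local_defining_function_def)
  then have n1: "norm (sgn g) = 1" "norm (sgn g') = 1" by (auto simp: norm_sgn)
  have c: "sgn g \<bullet> sgn g' < 1"
  proof -
    have "(norm (sgn g - sgn g'))\<^sup>2 = 2 - 2 * (sgn g \<bullet> sgn g')"
      using n1 by (simp add: power2_norm_eq_inner inner_diff_left inner_diff_right inner_commute
          norm_eq_1)
    moreover have "(norm (sgn g - sgn g'))\<^sup>2 > 0" using ne by simp
    ultimately show ?thesis by simp
  qed
  define d where "d = sgn g' - sgn g"
  have gs: "g = norm g *\<^sub>R sgn g" "g' = norm g' *\<^sub>R sgn g'"
    using g0 by (auto simp: sgn_div_norm)
  have "g \<bullet> d = norm g * (sgn g \<bullet> sgn g' - 1)"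
    using n1 by (subst gs(1)) (simp add: d_def inner_diff_right norm_eq_1 right_diff_distrib)
  then have d1: "d \<bullet> g < 0" using c g0 by (simp add: inner_commute mult_pos_neg)
  have "g' \<bullet> d = norm g' * (1 - sgn g \<bullet> sgn g')"
    using n1 by (subst gs(2)) (simp add: d_def inner_diff_right norm_eq_1 inner_commute right_diff_distrib)
  then have d2: "d \<bullet> g' > 0" using c g0 by (simp add: inner_commute)
  have line: "((\<lambda>t. r (x + t *\<^sub>R d)) has_real_derivative d \<bullet> k) (at 0)" if "GDERIV r x :> k" for r k
  proof -
    have D: "(r has_derivative (\<lambda>h. h \<bullet> k)) (at (x + 0 *\<^sub>R d))" using that by (simp add: gderiv_def)
    have "((\<lambda>t. x + t *\<^sub>R d) has_derivative (\<lambda>h. h *\<^sub>R d)) (at 0)"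
      by (auto intro!: derivative_eq_intros)
    from has_derivative_compose[OF this D] show ?thesis
      by (simp add: has_field_derivative_def mult.commute[of _ "d \<bullet> k"])
  qed
  have z: "\<rho> x = 0" "\<rho>' x = 0" using \<rho> \<rho>' x by (auto simp: local_defining_function_def)
  obtain e1 where e1: "e1 > 0" "\<And>t. t > 0 \<Longrightarrow> t < e1 \<Longrightarrow> \<rho> (x + t *\<^sub>R d) < 0"
    using DERIV_neg_dec_right[OF line[OF \<rho>(3)] d1] z by auto
  obtain e2 where e2: "e2 > 0" "\<And>t. t > 0 \<Longrightarrow> t < e2 \<Longrightarrow> \<rho>' (x + t *\<^sub>R d) > 0"
    using DERIV_pos_inc_right[OF line[OF \<rho>'(3)] d2] z by auto
  have "open (V \<inter> V')" "x \<in> V \<inter> V'" using \<rho> \<rho>' by (auto simp: local_defining_function_def)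
  then obtain e3 where e3: "e3 > 0" "ball x e3 \<subseteq> V \<inter> V'" using open_contains_ball by metis
  have dp: "norm d + 1 > 0" by (simp add: add_nonneg_pos)
  define m where "m = e3 / (norm d + 1)"
  have m: "m > 0" using e3(1) dp by (simp add: m_def)
  define t where "t = min (min e1 e2) m / 2"
  have t: "t > 0" "t < e1" "t < e2" "t < m"
    using e1(1) e2(1) m by (auto simp: t_def min_def)
  have "t * norm d < e3"
  proof -
    have "t * norm d \<le> t * (norm d + 1)" using t(1) by simp
    also have "\<dots> < e3" using t(4) dp by (simp add: m_def pos_less_divide_eq)
    finally show ?thesis .
  qed
  then have "x + t *\<^sub>R d \<in> V \<inter> V'" using t(1) by (intro subsetD[OF e3(2)]) (simp add: dist_norm)
  moreover have "\<Omega> \<inter> V = {x \<in> V. \<rho> x < 0}" "\<Omega> \<inter> V' = {x \<in> V'. \<rho>' x < 0}"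
    using \<rho>(1) \<rho>'(1) by (simp_all add: local_defining_function_def)
  moreover have "\<rho> (x + t *\<^sub>R d) < 0" "\<not> \<rho>' (x + t *\<^sub>R d) < 0"
    using e1(2)[OF t(1,2)] e2(2)[OF t(1,3)] by auto
  ultimately show False by blast
qed

lemma outward_unit_normal_grad:
  assumes \<rho>: "local_defining_function \<Omega> V \<rho>" "x \<in> V" and x: "x \<in> frontier \<Omega>"
    and \<nu>: "outward_unit_normal \<Omega> x \<nu>"
  shows "grad \<rho> x = norm (grad \<rho> x) *\<^sub>R \<nu>" "grad \<rho> x \<noteq> 0" "norm \<nu> = 1"
proof -
  have "\<rho> differentiable at x"
    using \<rho> smooth_on_differentiable by (auto simp: local_defining_function_def)
  then have G: "GDERIV \<rho> x :> grad \<rho> x" by (rule GDERIV_grad)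
  show n0: "grad \<rho> x \<noteq> 0" using G \<rho> by (auto simp: local_defining_function_def)
  have "\<nu> = sgn (grad \<rho> x)"
    using \<nu> sgn_grad_unique[OF \<rho> G _ _ _ x] by (auto simp: outward_unit_normal_def)
  then show "grad \<rho> x = norm (grad \<rho> x) *\<^sub>R \<nu>" "norm \<nu> = 1"
    using n0 by (auto simp: sgn_div_norm)
qed

text \<open>Local defining functions are glued with bump functions as weights. No partition of unity is
  needed: nonnegative weights preserve the sign, and on the boundary the gradients of all terms are
  nonnegative multiples of the same normal.\<close>

lemma global_defining_function:
  fixes \<Omega> :: "'a::euclidean_space set"
  assumes dom: "smooth_bounded_domain \<Omega>"
  obtains G where "smooth_on UNIV G" "\<And>x. x \<in> \<Omega> \<Longrightarrow> G x < 0" "\<And>x. x \<notin> \<Omega> \<Longrightarrow> G x \<ge> 0"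
    "\<And>x. x \<in> frontier \<Omega> \<Longrightarrow> G x = 0"
    "\<And>x \<nu>. x \<in> frontier \<Omega> \<Longrightarrow> outward_unit_normal \<Omega> x \<nu> \<Longrightarrow>
       \<exists>l>0. \<forall>i\<in>Basis. pd i G x = l * (\<nu> \<bullet> i)"
proof -
  have o: "open \<Omega>" and bd: "bounded \<Omega>" and sb: "smooth_boundary \<Omega>"
    using dom by (auto simp: smooth_bounded_domain_def)
  have "\<exists>V \<rho> a b. open V \<and> smooth_on V \<rho> \<and> (\<forall>y\<in>V \<inter> \<Omega>. \<rho> y < 0) \<and>
      (\<forall>y\<in>V - \<Omega>. \<rho> y \<ge> 0) \<and> (V \<subseteq> \<Omega> \<or> local_defining_function \<Omega> V \<rho>) \<and>
      cbox a b \<subseteq> V \<and> x \<in> box a b" if x: "x \<in> closure \<Omega>" for x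
  proof -
    have "\<exists>V \<rho>. x \<in> V \<and> open V \<and> smooth_on V \<rho> \<and> (\<forall>y\<in>V \<inter> \<Omega>. \<rho> y < 0) \<and>
      (\<forall>y\<in>V - \<Omega>. \<rho> y \<ge> 0) \<and> (V \<subseteq> \<Omega> \<or> local_defining_function \<Omega> V \<rho>)"
    proof (cases "x \<in> \<Omega>")
      case True
      then show ?thesis using o smooth_on_const[OF o, of "- 1 :: real"]
        by (intro exI[of _ \<Omega>] exI[of _ "\<lambda>_. - 1"]) auto
    next
      case False
      then have "x \<in> frontier \<Omega>" using x o by (simp add: frontier_def interior_open)
      then obtain V \<rho> where "x \<in> V" "local_defining_function \<Omega> V \<rho>"
        using sb by (auto simp: smooth_boundary_def)
      then show ?thesis
        by (intro exI[of _ V] exI[of _ \<rho>]) (auto simp: local_defining_function_def set_eq_iff not_less)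
    qed
    then obtain V \<rho> where V: "x \<in> V" "open V" "smooth_on V \<rho>" "\<forall>y\<in>V \<inter> \<Omega>. \<rho> y < 0"
      "\<forall>y\<in>V - \<Omega>. \<rho> y \<ge> 0" "V \<subseteq> \<Omega> \<or> local_defining_function \<Omega> V \<rho>" by blast
    obtain a b where "cbox a b \<subseteq> V" "x \<in> box a b" using open_contains_cbox[OF V(2,1)] by metis
    with V show ?thesis by blast
  qed
  then obtain V \<rho> a b where V: "\<And>x. x \<in> closure \<Omega> \<Longrightarrow> open (V x) \<and> smooth_on (V x) (\<rho> x) \<and>
      (\<forall>y\<in>V x \<inter> \<Omega>. \<rho> x y < 0) \<and> (\<forall>y\<in>V x - \<Omega>. \<rho> x y \<ge> 0) \<and>
      (V x \<subseteq> \<Omega> \<or> local_defining_function \<Omega> (V x) (\<rho> x)) \<and> cbox (a x) (b x) \<subseteq> V x \<and> x \<in> box (a x) (b x)"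
    by metis
  have "compact (closure \<Omega>)" using bd by simp
  moreover have "closure \<Omega> \<subseteq> (\<Union>x\<in>closure \<Omega>. box (a x) (b x))" using V by blast
  ultimately obtain D where D: "D \<subseteq> closure \<Omega>" "finite D" "closure \<Omega> \<subseteq> (\<Union>x\<in>D. box (a x) (b x))"
    using compactE_image[of "closure \<Omega>" "closure \<Omega>" "\<lambda>x. box (a x) (b x)"] by blast
  have DV: "x \<in> closure \<Omega>" if "x \<in> D" for x using that D(1) by auto
  have Vopen: "open (V x)" and Vsm: "smooth_on (V x) (\<rho> x)" if "x \<in> D" for x
    using V[OF DV[OF that]] by auto
  have Vneg: "\<rho> x y < 0" if "x \<in> D" "y \<in> V x" "y \<in> \<Omega>" for x y
    using V[OF DV[OF that(1)]] that by auto
  have Vpos: "\<rho> x y \<ge> 0" if "x \<in> D" "y \<in> V x" "y \<notin> \<Omega>" for x y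
    using V[OF DV[OF that(1)]] that by auto
  have Vloc: "local_defining_function \<Omega> (V x) (\<rho> x)" if "x \<in> D" "y \<in> V x" "y \<notin> \<Omega>" for x y
    using V[OF DV[OF that(1)]] that by auto
  have Vsub: "y \<in> V x" if "x \<in> D" "y \<in> cbox (a x) (b x)" for x y
    using V[OF DV[OF that(1)]] that by auto
  define \<psi> where "\<psi> x = bump_box 1 (a x) (b x) Basis" for x
  have \<psi>s: "smooth_on UNIV (\<psi> x)" for x unfolding \<psi>_def by (rule smooth_bump_box)
  have \<psi>0: "\<psi> x y \<ge> 0" for x y by (simp add: \<psi>_def bump_box_bounds)
  have \<psi>pos: "\<psi> x y > 0 \<longleftrightarrow> y \<in> box (a x) (b x)" for x y
    unfolding \<psi>_def by (rule bump_box_pos_iff) simp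
  have \<psi>z: "\<psi> x y = 0" if "y \<notin> cbox (a x) (b x)" for x y
    using that \<psi>pos[of x y] \<psi>0[of x y] box_subset_cbox[of "a x" "b x"] by force
  define T where "T x y = \<psi> x y * \<rho> x y" for x y
  have Ts: "smooth_on UNIV (T x)" if x: "x \<in> D" for x
  proof -
    have "smooth_on (V x) (T x)"
      unfolding T_def[abs_def] using Vopen[OF x] Vsm[OF x] smooth_on_subset[OF \<psi>s] by (intro smooth_on_mult) auto
    moreover have "smooth_on (- cbox (a x) (b x)) (T x)"
      using smooth_on_cong[of "- cbox (a x) (b x)" "\<lambda>_. 0" "T x"]
        smooth_on_const[of "- cbox (a x) (b x)" "0 :: real"] \<psi>z[of _ x]
      by (simp add: T_def open_Compl closed_cbox)
    ultimately have "smooth_on (V x \<union> - cbox (a x) (b x)) (T x)"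
      using Vopen[OF x] by (intro smooth_on_Un) auto
    moreover have "V x \<union> - cbox (a x) (b x) = UNIV" using Vsub[OF x] by auto
    ultimately show ?thesis by simp
  qed
  define G where "G y = (\<Sum>x\<in>D. T x y)" for y
  have Tneg: "T x y \<le> 0" if "x \<in> D" "y \<in> \<Omega>" for x y
  proof (cases "y \<in> cbox (a x) (b x)")
    case True
    then have "\<rho> x y < 0" using Vneg Vsub that by auto
    then show ?thesis using \<psi>0[of x y] by (simp add: T_def mult_nonneg_nonpos)
  qed (simp add: T_def \<psi>z)
  have Tpos: "T x y \<ge> 0" if "x \<in> D" "y \<notin> \<Omega>" for x y
  proof (cases "y \<in> cbox (a x) (b x)")
    case True
    then have "\<rho> x y \<ge> 0" using Vpos Vsub that by auto
    then show ?thesis using \<psi>0[of x y] by (simp add: T_def)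
  qed (simp add: T_def \<psi>z)
  show ?thesis
  proof (rule that)
    show "smooth_on UNIV G" unfolding G_def[abs_def] by (rule smooth_on_sum) (use Ts in auto)
    show "G y < 0" if y: "y \<in> \<Omega>" for y
    proof -
      obtain x where x: "x \<in> D" "y \<in> box (a x) (b x)" using D(3) y closure_subset by blast
      then have "\<rho> x y < 0" using Vneg[OF x(1) _ y] Vsub[OF x(1)] box_subset_cbox[of "a x" "b x"] by auto
      then have "T x y < 0" using \<psi>pos[of x y] x(2) by (simp add: T_def mult_pos_neg)
      then have "sum (\<lambda>x. - T x y) D > 0"
        using Tneg[OF _ y] x(1) D(2) by (intro sum_pos2[of D x]) auto
      then show ?thesis by (simp add: G_def sum_negf)
    qed
    show "G y \<ge> 0" if "y \<notin> \<Omega>" for y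
      unfolding G_def using Tpos that by (intro sum_nonneg) auto
    have \<rho>0: "\<rho> x y = 0 \<and> local_defining_function \<Omega> (V x) (\<rho> x)"
      if x: "x \<in> D" and y: "y \<in> frontier \<Omega>" "y \<in> V x" for x y
    proof -
      have "y \<notin> \<Omega>" using y(1) o by (simp add: frontier_def interior_open)
      then have "local_defining_function \<Omega> (V x) (\<rho> x)" using Vloc[OF x y(2)] by blast
      then show ?thesis using y by (auto simp: local_defining_function_def set_eq_iff)
    qed
    show "G y = 0" if y: "y \<in> frontier \<Omega>" for y
      unfolding G_def
    proof (rule sum.neutral, rule ballI)
      fix x assume x: "x \<in> D"
      show "T x y = 0"
      proof (cases "y \<in> V x")
        case True then show ?thesis using \<rho>0[OF x y] by (simp add: T_def)
      next
        case False
        then have "y \<notin> cbox (a x) (b x)" using Vsub[OF x] by blast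
        then show ?thesis by (simp add: T_def \<psi>z)
      qed
    qed
    fix y \<nu> assume y: "y \<in> frontier \<Omega>" and \<nu>: "outward_unit_normal \<Omega> y \<nu>"
    define k where "k x = (if y \<in> V x then \<psi> x y * norm (grad (\<rho> x) y) else 0)" for x
    have k: "pd i (T x) y = k x * (\<nu> \<bullet> i)" if x: "x \<in> D" and i: "i \<in> Basis" for x i
    proof (cases "y \<in> V x")
      case True
      note r = \<rho>0[OF x y True]
      have "\<rho> x differentiable at y" using r True smooth_on_differentiable by (auto simp: local_defining_function_def)
      then have "pd i (T x) y = \<psi> x y * pd i (\<rho> x) y + pd i (\<psi> x) y * \<rho> x y"
        unfolding T_def[abs_def] using smooth_on_differentiable[OF \<psi>s] by (intro pd_mult) auto
      also have "\<dots> = \<psi> x y * (grad (\<rho> x) y \<bullet> i)" using r i by (simp add: grad_inner_Basis)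
      also have "\<dots> = k x * (\<nu> \<bullet> i)"
        using outward_unit_normal_grad(1)[OF _ True y \<nu>, of "\<rho> x"] r True
        by (metis (no_types, lifting) inner_scaleR_left k_def mult.assoc)
      finally show ?thesis .
    next
      case False
      then have "y \<in> - cbox (a x) (b x)" using Vsub[OF x] by blast
      then have "frechet_derivative (T x) (at y) = frechet_derivative (\<lambda>_. 0) (at y)"
        by (intro frechet_derivative_cong_open[of "- cbox (a x) (b x)"])
          (auto simp: T_def \<psi>z open_Compl closed_cbox)
      then show ?thesis using False by (simp add: k_def)
    qed
    have k0: "k x \<ge> 0" for x using \<psi>0[of x y] by (simp add: k_def)
    have "y \<in> closure \<Omega>" using y by (simp add: frontier_def)
    then obtain x where x: "x \<in> D" "y \<in> box (a x) (b x)" using D(3) by blast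
    then have yV: "y \<in> V x" using Vsub[OF x(1)] box_subset_cbox[of "a x" "b x"] by blast
    then have "k x > 0"
      using \<psi>pos[of x y] x(2) outward_unit_normal_grad(2)[OF _ yV y \<nu>, of "\<rho> x"] \<rho>0[OF x(1) y yV]
      by (simp add: k_def)
    then have pos: "sum k D > 0" using k0 x(1) D(2) by (intro sum_pos2[of D x]) auto
    have "pd i G y = sum k D * (\<nu> \<bullet> i)" if i: "i \<in> Basis" for i
    proof -
      have "(G has_derivative (\<lambda>h. \<Sum>x\<in>D. frechet_derivative (T x) (at y) h)) (at y)"
        unfolding G_def[abs_def] using smooth_on_has_derivative[OF Ts UNIV_I] by (intro has_derivative_sum) auto
      from frechet_derivative_at[OF this]
      have "pd i G y = (\<Sum>x\<in>D. pd i (T x) y)" by metis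
      also have "\<dots> = sum k D * (\<nu> \<bullet> i)" by (simp add: k[OF _ i] sum_distrib_right)
      finally show ?thesis .
    qed
    with pos show "\<exists>l>0. \<forall>i\<in>Basis. pd i G y = l * (\<nu> \<bullet> i)" by blast
  qed
qed

text \<open>Moving along the normal direction from a point of the domain, a defining function grows at a
  definite rate, so the boundary is reached after a distance of the order of its modulus. This
  bounds any smooth function that vanishes on the boundary.\<close>

lemma vanishing_on_frontier_bound:
  fixes A G :: "'a::euclidean_space \<Rightarrow> real"
  assumes dom: "smooth_bounded_domain \<Omega>"
    and G: "smooth_on UNIV G" "\<And>x. x \<in> \<Omega> \<Longrightarrow> G x < 0" "\<And>x. x \<in> frontier \<Omega> \<Longrightarrow> G x = 0"
    and \<nu>: "\<And>x. x \<in> frontier \<Omega> \<Longrightarrow> \<exists>\<nu> l. norm \<nu> = 1 \<and> l > 0 \<and> (\<forall>i\<in>Basis. pd i G x = l * (\<nu> \<bullet> i))"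
    and A: "smooth_on UNIV A" "\<And>x. x \<in> frontier \<Omega> \<Longrightarrow> A x = 0"
  obtains C where "C \<ge> 0" "\<And>x. x \<in> \<Omega> \<Longrightarrow> \<bar>A x\<bar> \<le> C * \<bar>G x\<bar>"
proof -
  have o: "open \<Omega>" and bd: "bounded \<Omega>" using dom by (auto simp: smooth_bounded_domain_def)
  have Gc: "isCont G x" and Ac: "isCont A x" for x
    using smooth_on_continuous[OF G(1)] smooth_on_continuous[OF A(1)] by (simp_all add: continuous_on_eq_continuous_at)
  have dir: "continuous_on UNIV (\<lambda>x. frechet_derivative f (at x) \<nu>)" if f: "smooth_on UNIV f" for f :: "'a \<Rightarrow> real" and \<nu>
  proof -
    have "frechet_derivative f (at x) \<nu> = (\<Sum>i\<in>Basis. (\<nu> \<bullet> i) * pd i f x)" for x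
      unfolding frechet_derivative_eq_grad[OF smooth_on_differentiable[OF f UNIV_I], of x \<nu>]
      by (simp add: grad_def inner_sum_right mult.commute)
    then show ?thesis
      by (simp only:) (rule continuous_on_sum, rule continuous_on_mult[OF continuous_on_const],
          rule smooth_on_continuous[OF smooth_on_pd[OF f]])
  qed
  have line: "((\<lambda>t. f (x + t *\<^sub>R \<nu>)) has_real_derivative frechet_derivative f (at (x + t *\<^sub>R \<nu>)) \<nu>) (at t)"
    if f: "smooth_on UNIV f" for f :: "'a \<Rightarrow> real" and x \<nu> t
    using smooth_on_differentiable[OF f UNIV_I] by (rule has_real_derivative_along_line)
  have local: "\<exists>r C. r > 0 \<and> C \<ge> 0 \<and> (\<forall>x\<in>\<Omega> \<inter> ball x0 r. \<bar>A x\<bar> \<le> C * \<bar>G x\<bar>)" if x0: "x0 \<in> closure \<Omega>" for x0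
  proof (cases "x0 \<in> \<Omega>")
    case True
    define g where "g = \<bar>G x0\<bar>"
    have g: "g > 0" using G(2)[OF True] by (simp add: g_def)
    obtain r1 where r1: "r1 > 0" "\<And>x. dist x x0 < r1 \<Longrightarrow> dist (G x) (G x0) < g / 2"
      using Gc[of x0] g unfolding continuous_at_eps_delta by (metis half_gt_zero)
    obtain r2 where r2: "r2 > 0" "\<And>x. dist x x0 < r2 \<Longrightarrow> dist (A x) (A x0) < 1"
      using Ac[of x0] unfolding continuous_at_eps_delta by (metis zero_less_one)
    have "\<bar>A x\<bar> \<le> (2 * (\<bar>A x0\<bar> + 1) / g) * \<bar>G x\<bar>" if "x \<in> ball x0 (min r1 r2)" for x
    proof -
      have "dist x x0 < r1" "dist x x0 < r2" using that by (auto simp: dist_commute)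
      then have 1: "\<bar>G x\<bar> \<ge> g / 2" and 2: "\<bar>A x\<bar> \<le> \<bar>A x0\<bar> + 1"
        using r1(2)[of x] r2(2)[of x] by (auto simp: dist_real_def g_def abs_real_def split: if_splits)
      have "\<bar>A x0\<bar> + 1 = (2 * (\<bar>A x0\<bar> + 1) / g) * (g / 2)" using g by simp
      also have "\<dots> \<le> (2 * (\<bar>A x0\<bar> + 1) / g) * \<bar>G x\<bar>" using 1 g by (intro mult_left_mono) auto
      finally show ?thesis using 2 by simp
    qed
    then show ?thesis
      using r1(1) r2(1) g by (intro exI[of _ "min r1 r2"] exI[of _ "2 * (\<bar>A x0\<bar> + 1) / g"]) auto
  next
    case False
    then have x0: "x0 \<in> frontier \<Omega>" using x0 o by (simp add: frontier_def interior_open)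
    obtain \<nu> l where n: "norm \<nu> = 1" "l > 0" "\<forall>i\<in>Basis. pd i G x0 = l * (\<nu> \<bullet> i)" using \<nu>[OF x0] by blast
    let ?D = "\<lambda>x. frechet_derivative G (at x) \<nu>"
    have "grad G x0 = l *\<^sub>R \<nu>"
      by (rule euclidean_eqI) (simp add: grad_inner_Basis n(3))
    then have D0: "?D x0 = l"
      using frechet_derivative_eq_grad[OF smooth_on_differentiable[OF G(1) UNIV_I], of x0 \<nu>] n(1)
      by (simp add: norm_eq_1)
    have "isCont ?D x0" using dir[OF G(1)] by (simp add: continuous_on_eq_continuous_at)
    then obtain r where r: "r > 0" "\<And>x. dist x x0 < r \<Longrightarrow> dist (?D x) l < l / 2"
      using n(2) unfolding continuous_at_eps_delta D0 by (metis half_gt_zero)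
    have Dl: "?D x \<ge> l / 2" if "dist x x0 < r" for x
      using r(2)[OF that] by (auto simp: dist_real_def abs_real_def split: if_splits)
    have "compact ((\<lambda>x. frechet_derivative A (at x) \<nu>) ` cball x0 r)"
      by (intro compact_continuous_image continuous_on_subset[OF dir[OF A(1)]]) auto
    then obtain L where L: "L > 0" "\<forall>y\<in>(\<lambda>x. frechet_derivative A (at x) \<nu>) ` cball x0 r. \<bar>y\<bar> \<le> L"
      using compact_imp_bounded bounded_pos by (metis real_norm_def)
    have LA: "\<bar>frechet_derivative A (at x) \<nu>\<bar> \<le> L" if "dist x x0 < r" for x
      using L(2) that by (auto simp: dist_commute)
    have rl: "r * l / 4 > 0" using r(1) n(2) by simp
    obtain r' where r': "r' > 0" "\<And>x. dist x x0 < r' \<Longrightarrow> dist (G x) (G x0) < r * l / 4"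
      using Gc[of x0] rl unfolding continuous_at_eps_delta by metis
    have "\<bar>A x\<bar> \<le> (2 * L / l) * \<bar>G x\<bar>" if x: "x \<in> \<Omega> \<inter> ball x0 (min r' (r / 2))" for x
    proof -
      define s where "s = 2 * \<bar>G x\<bar> / l"
      have Gx: "G x < 0" using G(2) x by auto
      have s0: "s > 0" unfolding s_def using Gx n(2) by (intro divide_pos_pos) auto
      have "\<bar>G x\<bar> < r * l / 4" using r'(2)[of x] x G(3)[OF x0] by (auto simp: dist_commute dist_real_def)
      then have sr: "s < r / 2" using n(2) by (simp add: s_def field_simps)
      have near: "dist (x + t *\<^sub>R \<nu>) x0 < r" if "0 \<le> t" "t \<le> s" for t
      proof -
        have "dist (x + t *\<^sub>R \<nu>) x0 \<le> dist (x + t *\<^sub>R \<nu>) x + dist x x0" by (rule dist_triangle)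
        also have "dist (x + t *\<^sub>R \<nu>) x \<le> s" using that n(1) by (simp add: dist_norm)
        finally show ?thesis using x sr by (simp add: dist_commute)
      qed
      have "\<exists>z. 0 < z \<and> z < s \<and> G (x + s *\<^sub>R \<nu>) - G (x + 0 *\<^sub>R \<nu>) = (s - 0) * ?D (x + z *\<^sub>R \<nu>)"
        by (rule MVT2[OF s0]) (rule line[OF G(1)])
      then obtain z where z: "0 < z" "z < s" "G (x + s *\<^sub>R \<nu>) = G x + s * ?D (x + z *\<^sub>R \<nu>)" by auto
      have "s * (l / 2) \<le> s * ?D (x + z *\<^sub>R \<nu>)" using Dl[OF near[of z]] z s0 by (intro mult_left_mono) auto
      moreover have "s * (l / 2) = - G x" using n(2) Gx by (simp add: s_def)
      ultimately have "G (x + s *\<^sub>R \<nu>) \<ge> 0" using z(3) by linarith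
      then have out: "x + s *\<^sub>R \<nu> \<notin> \<Omega>" using G(2) by force
      let ?S = "(\<lambda>t. x + t *\<^sub>R \<nu>) ` {0..s}"
      have "connected ?S" by (intro connected_continuous_image continuous_intros) auto
      moreover have "x \<in> ?S \<inter> \<Omega>" using x s0 by (auto intro!: image_eqI[of _ _ 0])
      moreover have "x + s *\<^sub>R \<nu> \<in> ?S - \<Omega>" using out s0 by auto
      ultimately have "?S \<inter> frontier \<Omega> \<noteq> {}" by (intro connected_Int_frontier) auto
      then obtain t where t: "0 \<le> t" "t \<le> s" "x + t *\<^sub>R \<nu> \<in> frontier \<Omega>" by auto
      have t0: "t > 0"
        using t x o by (cases "t = 0") (auto simp: frontier_def interior_open)
      have "\<exists>z. 0 < z \<and> z < t \<and> A (x + t *\<^sub>R \<nu>) - A (x + 0 *\<^sub>R \<nu>) = (t - 0) * frechet_derivative A (at (x + z *\<^sub>R \<nu>)) \<nu>"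
        by (rule MVT2[OF t0]) (rule line[OF A(1)])
      then obtain z where z: "0 < z" "z < t" "A (x + t *\<^sub>R \<nu>) - A x = t * frechet_derivative A (at (x + z *\<^sub>R \<nu>)) \<nu>" by auto
      then have "\<bar>A x\<bar> = t * \<bar>frechet_derivative A (at (x + z *\<^sub>R \<nu>)) \<nu>\<bar>"
        using A(2)[OF t(3)] t0 by (metis abs_minus_cancel abs_mult abs_of_pos diff_0)
      also have "\<dots> \<le> s * L" using t z LA[OF near[of z]] by (intro mult_mono) auto
      also have "\<dots> = (2 * L / l) * \<bar>G x\<bar>" by (simp add: s_def)
      finally show ?thesis .
    qed
    then show ?thesis
      using r(1) r'(1) L(1) n(2) by (intro exI[of _ "min r' (r / 2)"] exI[of _ "2 * L / l"]) auto
  qed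
  then obtain r C where rC: "\<And>x0. x0 \<in> closure \<Omega> \<Longrightarrow> r x0 > 0 \<and> C x0 \<ge> 0 \<and> (\<forall>x\<in>\<Omega> \<inter> ball x0 (r x0). \<bar>A x\<bar> \<le> C x0 * \<bar>G x\<bar>)"
    by metis
  have "compact (closure \<Omega>)" using bd by simp
  moreover have "closure \<Omega> \<subseteq> (\<Union>x\<in>closure \<Omega>. ball x (r x))" using rC by force
  ultimately obtain D where D: "D \<subseteq> closure \<Omega>" "finite D" "closure \<Omega> \<subseteq> (\<Union>x\<in>D. ball x (r x))"
    using compactE_image[of "closure \<Omega>" "closure \<Omega>" "\<lambda>x. ball x (r x)"] by blast
  have C0: "C x \<ge> 0" if "x \<in> D" for x using rC[of x] that D(1) by auto
  show ?thesis
  proof (rule that)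
    show "sum C D \<ge> 0" using C0 by (rule sum_nonneg)
    fix x assume x: "x \<in> \<Omega>"
    then obtain y where y: "y \<in> D" "x \<in> ball y (r y)" using D(3) closure_subset by blast
    then have "\<bar>A x\<bar> \<le> C y * \<bar>G x\<bar>" using rC[of y] D(1) x by auto
    also have "\<dots> \<le> sum C D * \<bar>G x\<bar>"
      using member_le_sum[of y D C] C0 y(1) D(2) by (intro mult_right_mono) auto
    finally show "\<bar>A x\<bar> \<le> sum C D * \<bar>G x\<bar>" .
  qed
qed


section \<open>Green's formula under the Neumann condition\<close>

lemma L2_smooth_mult:
  assumes "L2 \<Omega> u" "smooth_on UNIV f" "bounded \<Omega>" shows "L2 \<Omega> (\<lambda>x. f x * u x)"
proof -
  obtain C where "\<And>x. x \<in> \<Omega> \<Longrightarrow> \<bar>f x\<bar> \<le> C" using smooth_bounded_on[OF assms(2,3)] by metis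
  then show ?thesis
    by (rule L2_mult_bounded[OF assms(1) borel_imp_lebesgue_on[OF smooth_borel_measurable[OF assms(2)]]])
qed

lemma L2_cauchy_schwarz:
  assumes u: "L2 \<Omega> u" and v: "L2 \<Omega> v" and o: "open \<Omega>"
  shows "\<bar>\<integral>x. u x * v x \<partial>lebesgue_on \<Omega>\<bar> \<le> L2norm \<Omega> u * L2norm \<Omega> v"
proof -
  define A where "A = (\<integral>x. (u x)\<^sup>2 \<partial>lebesgue_on \<Omega>)"
  define B where "B = (\<integral>x. (v x)\<^sup>2 \<partial>lebesgue_on \<Omega>)"
  define I where "I = (\<integral>x. u x * v x \<partial>lebesgue_on \<Omega>)"
  have ui: "integrable (lebesgue_on \<Omega>) (\<lambda>x. (u x)\<^sup>2)" and vi: "integrable (lebesgue_on \<Omega>) (\<lambda>x. (v x)\<^sup>2)"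
    using u v by (auto simp: L2_def)
  note uvi = L2_mult_integrable[OF u v]
  have AB: "A \<ge> 0" "B \<ge> 0" by (auto simp: A_def B_def)
  have "I\<^sup>2 \<le> A * B"
  proof (cases "B = 0")
    case True
    then have "AE x in lebesgue_on \<Omega>. (v x)\<^sup>2 = 0"
      using integral_nonneg_eq_0_iff_AE[OF vi] by (simp add: B_def)
    then have "AE x in lebesgue_on \<Omega>. u x * v x = 0" by eventually_elim simp
    then have "I = 0"
      using integral_lebesgue_on_cong_AE[where S = \<Omega> and f = "\<lambda>x. u x * v x" and g = "\<lambda>_. 0"] o
      by (simp add: I_def)
    then show ?thesis using AB by simp
  next
    case False
    have "0 \<le> (\<integral>x. (B * u x - I * v x)\<^sup>2 \<partial>lebesgue_on \<Omega>)" by simp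
    also have "(\<lambda>x. (B * u x - I * v x)\<^sup>2) = (\<lambda>x. B\<^sup>2 * (u x)\<^sup>2 - 2 * B * I * (u x * v x) + I\<^sup>2 * (v x)\<^sup>2)"
      by (simp add: power2_eq_square algebra_simps)
    also have "(\<integral>x. B\<^sup>2 * (u x)\<^sup>2 - 2 * B * I * (u x * v x) + I\<^sup>2 * (v x)\<^sup>2 \<partial>lebesgue_on \<Omega>)
        = B\<^sup>2 * A - 2 * B * I * I + I\<^sup>2 * B"
      using ui vi uvi by (simp add: A_def B_def I_def)
    also have "\<dots> = B * (A * B - I\<^sup>2)" by (simp add: power2_eq_square algebra_simps)
    finally show ?thesis using False AB by (simp add: zero_le_mult_iff)
  qed
  then have "\<bar>I\<bar> \<le> sqrt (A * B)" by (metis real_sqrt_abs real_sqrt_le_mono)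
  then show ?thesis by (simp add: I_def A_def B_def L2norm_def real_sqrt_mult)
qed

lemma inner_weak_grad: "weak_grad \<Omega> u x \<bullet> weak_grad \<Omega> v x = (\<Sum>i\<in>Basis. weak_partial \<Omega> i u x * weak_partial \<Omega> i v x)"
proof -
  have "weak_grad \<Omega> u x \<bullet> weak_grad \<Omega> v x = (\<Sum>i\<in>Basis. (weak_grad \<Omega> u x \<bullet> i) * (weak_grad \<Omega> v x \<bullet> i))"
    by (rule euclidean_inner)
  also have "\<dots> = (\<Sum>i\<in>Basis. weak_partial \<Omega> i u x * weak_partial \<Omega> i v x)"
    by (intro sum.cong refl) (simp add: weak_grad_def inner_sum_left inner_Basis if_distrib cong: if_cong)
  finally show ?thesis .
qed

text \<open>For a test function in place of \<open>h\<close> this is the definition of the weak derivative of \<open>v\<close>, tested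
  with \<open>f h\<close>, and the integral depends continuously on \<open>h\<close> in the Sobolev norm.\<close>

lemma H1_0_pairing:
  fixes f h v :: "'a::euclidean_space \<Rightarrow> real"
  assumes o: "open \<Omega>" and bd: "bounded \<Omega>" and i: "i \<in> Basis" and h: "H1_0 \<Omega> h" and v: "H1 \<Omega> v"
    and f: "smooth_on UNIV f"
  shows "(\<integral>x. (f x * weak_partial \<Omega> i h x + pd i f x * h x) * v x + f x * h x * weak_partial \<Omega> i v x
    \<partial>lebesgue_on \<Omega>) = 0"
proof -
  have om: "\<Omega> \<in> sets lebesgue" using o by auto
  have h1: "H1 \<Omega> h" using h by (simp add: H1_0_def)
  note hw = H1_weak_partial[OF h1 o i] and vw = H1_weak_partial[OF v o i]
  have L: "L2 \<Omega> h" "L2 \<Omega> v" using h1 v by (auto simp: H1_def)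
  define a where "a x = f x * v x" for x
  define b where "b x = pd i f x * v x + f x * weak_partial \<Omega> i v x" for x
  have aL: "L2 \<Omega> a" unfolding a_def by (rule L2_smooth_mult[OF L(2) f bd])
  have bL: "L2 \<Omega> b" unfolding b_def
    by (intro L2_add L2_smooth_mult[OF L(2) smooth_on_pd[OF f i] bd] L2_smooth_mult[OF vw(2) f bd])
  define I where "I = (\<integral>x. a x * weak_partial \<Omega> i h x + b x * h x \<partial>lebesgue_on \<Omega>)"
  have bound: "\<bar>I\<bar> \<le> (L2norm \<Omega> a + L2norm \<Omega> b) * H1norm \<Omega> (\<lambda>x. h x - \<phi> x)" if \<phi>: "test_function \<Omega> \<phi>" for \<phi>
  proof -
    note \<phi>s = test_function_smooth[OF \<phi>] and \<phi>' = test_function_pd[OF \<phi> i]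
    have \<phi>L: "L2 \<Omega> \<psi>" if "test_function \<Omega> \<psi>" for \<psi>
    proof -
      have "integrable (lebesgue_on \<Omega>) (\<lambda>x. (\<psi> x)\<^sup>2)"
        using locally_integrable_mult_test[OF locally_integrable_smooth[OF test_function_smooth[OF that]] that]
          integrable_lebesgue_on_iff[OF om, of "\<lambda>x. \<psi> x * \<psi> x"] test_function_zero(1)[OF that]
        by (simp add: power2_eq_square)
      then show ?thesis
        using borel_imp_lebesgue_on[OF smooth_borel_measurable[OF test_function_smooth[OF that]]] by (simp add: L2_def)
    qed
    let ?d = "\<lambda>x. h x - \<phi> x" and ?d' = "\<lambda>x. weak_partial \<Omega> i h x - pd i \<phi> x"
    have dL: "L2 \<Omega> ?d" "L2 \<Omega> ?d'" using L hw(2) \<phi>L[OF \<phi>] \<phi>L[OF \<phi>'] by (auto intro: L2_diff)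
    have dj: "has_weak_partial \<Omega> j ?d (\<lambda>x. weak_partial \<Omega> j h x - pd j \<phi> x)" if j: "j \<in> Basis" for j
      using has_weak_partial_lincomb[OF o j H1_weak_partial(1)[OF h1 o j] has_weak_partial_smooth[OF \<phi>s o j], of 1 "- 1"]
      by simp
    have djL: "L2 \<Omega> (weak_partial \<Omega> j ?d)" if j: "j \<in> Basis" for j
    proof -
      have "L2 \<Omega> (\<lambda>x. weak_partial \<Omega> j h x - pd j \<phi> x)"
        using H1_weak_partial(2)[OF h1 o j] \<phi>L[OF test_function_pd[OF \<phi> j]] by (rule L2_diff)
      then show ?thesis
        by (rule L2_cong_AE[OF _ _ o]) (use weak_partial_props(2)[OF dj[OF j] o j] in auto)
    qed
    have eq: "AE x in lebesgue_on \<Omega>. weak_partial \<Omega> i ?d x = ?d' x"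
      by (rule weak_partial_props(2)[OF dj[OF i] o i])
    have gradi: "integrable (lebesgue_on \<Omega>) (\<lambda>x. (norm (weak_grad \<Omega> ?d x))\<^sup>2)"
      unfolding power2_norm_eq_inner inner_weak_grad
      using djL by (auto intro!: Bochner_Integration.integrable_sum L2_mult_integrable)
    have "(L2norm \<Omega> ?d')\<^sup>2 = (\<integral>x. (weak_partial \<Omega> i ?d x)\<^sup>2 \<partial>lebesgue_on \<Omega>)"
    proof -
      have "AE x in lebesgue_on \<Omega>. (?d' x)\<^sup>2 = (weak_partial \<Omega> i ?d x)\<^sup>2" using eq by eventually_elim simp
      from integral_lebesgue_on_cong_AE[OF this om] show ?thesis by (simp add: L2norm_def)
    qed
    also have "\<dots> \<le> (\<integral>x. (norm (weak_grad \<Omega> ?d x))\<^sup>2 \<partial>lebesgue_on \<Omega>)"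
    proof (rule integral_mono[OF _ gradi])
      show "integrable (lebesgue_on \<Omega>) (\<lambda>x. (weak_partial \<Omega> i ?d x)\<^sup>2)" using djL[OF i] by (simp add: L2_def)
      show "(weak_partial \<Omega> i ?d x)\<^sup>2 \<le> (norm (weak_grad \<Omega> ?d x))\<^sup>2" for x
        unfolding power2_norm_eq_inner inner_weak_grad power2_eq_square[of "weak_partial \<Omega> i ?d x"]
        by (rule member_le_sum[OF i]) auto
    qed
    also have "\<dots> = (L2norm \<Omega> (weak_grad \<Omega> ?d))\<^sup>2" by (simp add: L2norm_def)
    finally have "(L2norm \<Omega> ?d')\<^sup>2 \<le> (H1norm \<Omega> ?d)\<^sup>2" "(L2norm \<Omega> ?d)\<^sup>2 \<le> (H1norm \<Omega> ?d)\<^sup>2"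
      by (simp_all add: H1norm_def add_increasing)
    then have le: "L2norm \<Omega> ?d' \<le> H1norm \<Omega> ?d" "L2norm \<Omega> ?d \<le> H1norm \<Omega> ?d"
      by (auto intro: power2_le_imp_le simp: H1norm_def)
    have t: "test_function \<Omega> (\<lambda>x. f x * \<phi> x)" by (rule test_function_smooth_mult[OF f \<phi>])
    have pdt: "pd i (\<lambda>x. f x * \<phi> x) x = f x * pd i \<phi> x + pd i f x * \<phi> x" for x
      using smooth_on_differentiable[OF f UNIV_I] smooth_on_differentiable[OF \<phi>s UNIV_I] by (rule pd_mult)
    have ints: "integrable (lebesgue_on \<Omega>) (\<lambda>x. a x * pd i \<phi> x)" "integrable (lebesgue_on \<Omega>) (\<lambda>x. b x * \<phi> x)"
      "integrable (lebesgue_on \<Omega>) (\<lambda>x. a x * ?d' x)" "integrable (lebesgue_on \<Omega>) (\<lambda>x. b x * ?d x)"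
      using aL bL dL \<phi>L[OF \<phi>] \<phi>L[OF \<phi>'] by (auto intro: L2_mult_integrable)
    have "(\<integral>x. v x * pd i (\<lambda>x. f x * \<phi> x) x \<partial>lebesgue_on \<Omega>) = - (\<integral>x. weak_partial \<Omega> i v x * (f x * \<phi> x) \<partial>lebesgue_on \<Omega>)"
      using vw(1) t by (simp add: has_weak_partial_def)
    moreover have "integrable (lebesgue_on \<Omega>) (\<lambda>x. v x * pd i (\<lambda>x. f x * \<phi> x) x)"
      "integrable (lebesgue_on \<Omega>) (\<lambda>x. weak_partial \<Omega> i v x * (f x * \<phi> x))"
      using L(2) vw(2) \<phi>L[OF t] \<phi>L[OF test_function_pd[OF t i]] by (auto intro: L2_mult_integrable)
    ultimately have "(\<integral>x. v x * pd i (\<lambda>x. f x * \<phi> x) x + weak_partial \<Omega> i v x * (f x * \<phi> x) \<partial>lebesgue_on \<Omega>) = 0"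
      by simp
    also have "(\<lambda>x. v x * pd i (\<lambda>x. f x * \<phi> x) x + weak_partial \<Omega> i v x * (f x * \<phi> x)) = (\<lambda>x. a x * pd i \<phi> x + b x * \<phi> x)"
      unfolding pdt by (simp add: a_def b_def algebra_simps)
    finally have z: "(\<integral>x. a x * pd i \<phi> x \<partial>lebesgue_on \<Omega>) + (\<integral>x. b x * \<phi> x \<partial>lebesgue_on \<Omega>) = 0"
      using ints by simp
    have "I = (\<integral>x. (a x * ?d' x + b x * ?d x) + (a x * pd i \<phi> x + b x * \<phi> x) \<partial>lebesgue_on \<Omega>)"
      unfolding I_def by (intro Bochner_Integration.integral_cong refl) (simp add: algebra_simps)
    also have "\<dots> = (\<integral>x. a x * ?d' x \<partial>lebesgue_on \<Omega>) + (\<integral>x. b x * ?d x \<partial>lebesgue_on \<Omega>)"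
      using ints z by (simp del: right_diff_distrib_numeral)
    finally have "\<bar>I\<bar> \<le> \<bar>\<integral>x. a x * ?d' x \<partial>lebesgue_on \<Omega>\<bar> + \<bar>\<integral>x. b x * ?d x \<partial>lebesgue_on \<Omega>\<bar>" by simp
    also have "\<dots> \<le> L2norm \<Omega> a * L2norm \<Omega> ?d' + L2norm \<Omega> b * L2norm \<Omega> ?d"
      by (intro add_mono L2_cauchy_schwarz aL bL dL o)
    also have "\<dots> \<le> L2norm \<Omega> a * H1norm \<Omega> ?d + L2norm \<Omega> b * H1norm \<Omega> ?d"
      by (intro add_mono mult_left_mono le) (auto simp: L2norm_def)
    finally show ?thesis by (simp add: distrib_right)
  qed
  obtain \<phi> where \<phi>: "\<And>k::nat. test_function \<Omega> (\<phi> k)" "(\<lambda>k. H1norm \<Omega> (\<lambda>x. h x - \<phi> k x)) \<longlonglongrightarrow> 0"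
    using h by (auto simp: H1_0_def)
  have "(\<lambda>k. (L2norm \<Omega> a + L2norm \<Omega> b) * H1norm \<Omega> (\<lambda>x. h x - \<phi> k x)) \<longlonglongrightarrow> (L2norm \<Omega> a + L2norm \<Omega> b) * 0"
    by (intro tendsto_intros \<phi>(2))
  from LIMSEQ_le_const[OF this, of "\<bar>I\<bar>"] bound[OF \<phi>(1)] have "\<bar>I\<bar> \<le> 0" by auto
  then have "I = 0" by simp
  moreover have "(\<lambda>x. (f x * weak_partial \<Omega> i h x + pd i f x * h x) * v x + f x * h x * weak_partial \<Omega> i v x)
      = (\<lambda>x. a x * weak_partial \<Omega> i h x + b x * h x)"
    by (simp add: a_def b_def algebra_simps)
  ultimately show ?thesis by (simp add: I_def)
qed

lemma weak_grad_inner_Basis: "i \<in> Basis \<Longrightarrow> weak_grad \<Omega> u x \<bullet> i = weak_partial \<Omega> i u x"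
  by (simp add: weak_grad_def inner_sum_left inner_Basis if_distrib cong: if_cong)

lemma outward_unit_normal_norm: "outward_unit_normal \<Omega> x \<nu> \<Longrightarrow> norm \<nu> = 1"
  by (auto simp: outward_unit_normal_def local_defining_function_def norm_sgn)

lemma step_derivative:
  obtains s S where "\<And>t. (step has_real_derivative s t) (at t)" "\<And>t. \<bar>s t\<bar> \<le> S"
    "\<And>t. t < 0 \<or> t > 1 \<Longrightarrow> s t = 0" "S \<ge> 0"
proof -
  have d: "(step has_real_derivative pd 1 step t) (at t)" for t
    using has_real_derivative_along_line[of step 0 t 1] smooth_on_differentiable[OF smooth_step] by simp
  have z: "pd 1 step t = 0" if "t < 0 \<or> t > 1" for t
  proof -
    have "frechet_derivative step (at t) = frechet_derivative (\<lambda>_. step t) (at t)"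
      using that
    proof
      assume "t < 0" then show ?thesis
        by (intro frechet_derivative_cong_open[of "{..<0}"]) (auto simp: step_0)
    next
      assume "t > 1" then show ?thesis
        by (intro frechet_derivative_cong_open[of "{1<..}"]) (auto simp: step_1)
    qed
    then show ?thesis by simp
  qed
  obtain S where S: "S > 0" "\<And>t. t \<in> {0..1} \<Longrightarrow> \<bar>pd 1 step t\<bar> \<le> S"
    using smooth_bounded_on[OF smooth_on_pd[OF smooth_step], of 1 "{0..1}"] by auto
  have "\<bar>pd 1 step t\<bar> \<le> S" for t
    using S(1) S(2)[of t] z[of t] by (cases "t \<in> {0..1}") auto
  then show ?thesis using that[of "\<lambda>t. pd 1 step t" S] d z S(1) by auto
qed

text \<open>The gradient of \<open>u\<close> is split along the extended normal \<open>N\<close>. The normal part lies in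
  the closure of the test functions, where integration by parts is the definition of a weak
  derivative. For the remaining part, cutting off with functions of the defining function \<open>G\<close> leaves
  an error in which only the tangential part of the gradient of \<open>G\<close> occurs, and this vanishes on the
  boundary to the order needed to compensate the growth of the derivative of the cutoff.\<close>

lemma green_neumann:
  fixes \<Omega> :: "'a::euclidean_space set"
  assumes dom: "smooth_bounded_domain \<Omega>" and u: "H2 \<Omega> u" and nd: "normal_derivative_zero \<Omega> u" and v: "H1 \<Omega> v"
  shows "(\<integral>x. weak_laplacian \<Omega> u x * v x + weak_grad \<Omega> u x \<bullet> weak_grad \<Omega> v x \<partial>lebesgue_on \<Omega>) = 0"
proof -
  have o: "open \<Omega>" and bd: "bounded \<Omega>" using dom by (auto simp: smooth_bounded_domain_def)
  have om: "\<Omega> \<in> sets lebesgue" using o by auto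
  let ?M = "lebesgue_on \<Omega>"
  define w where "w i = weak_partial \<Omega> i u" for i
  define w' where "w' i = weak_partial \<Omega> i (w i)" for i
  define v' where "v' i = weak_partial \<Omega> i v" for i
  have wH: "H1 \<Omega> (w i)" if "i \<in> Basis" for i using u that by (simp add: H2_def w_def)
  have wL: "L2 \<Omega> (w i)" "L2 \<Omega> (w' i)" "has_weak_partial \<Omega> i (w i) (w' i)" if "i \<in> Basis" for i
    using wH[OF that] H1_weak_partial[OF wH[OF that] o that] by (auto simp: H1_def w'_def)
  have vL: "L2 \<Omega> v" "L2 \<Omega> (v' i)" "has_weak_partial \<Omega> i v (v' i)" if "i \<in> Basis" for i
    using v H1_weak_partial[OF v o that] by (auto simp: H1_def v'_def)
  have vL0: "L2 \<Omega> v" using v by (simp add: H1_def)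
  obtain N where N: "smooth_on UNIV N" "\<And>x. x \<in> frontier \<Omega> \<Longrightarrow> outward_unit_normal \<Omega> x (N x)"
    "H1_0 \<Omega> (\<lambda>x. N x \<bullet> weak_grad \<Omega> u x)"
    using nd by (auto simp: normal_derivative_zero_def)
  define h where "h x = N x \<bullet> weak_grad \<Omega> u x" for x
  define n where "n i x = N x \<bullet> i" for i x
  have ns: "smooth_on UNIV (n i)" for i unfolding n_def[abs_def] by (rule smooth_on_inner[OF open_UNIV N(1)])
  have h_eq: "h x = (\<Sum>j\<in>Basis. n j x * w j x)" for x
    unfolding h_def by (subst euclidean_inner) (simp add: n_def w_def weak_grad_inner_Basis)
  have h0: "H1_0 \<Omega> h" using N(3) by (simp add: h_def[abs_def])
  then have hH: "H1 \<Omega> h" by (simp add: H1_0_def)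
  define h' where "h' i = weak_partial \<Omega> i h" for i
  have hL0: "L2 \<Omega> h" using hH by (simp add: H1_def)
  have hL: "L2 \<Omega> (h' i)" "has_weak_partial \<Omega> i h (h' i)" if "i \<in> Basis" for i
    using H1_weak_partial[OF hH o that] by (auto simp: h'_def)
  define d where "d i x = n i x * h' i x + pd i (n i) x * h x" for i x
  have dL: "L2 \<Omega> (d i)" if "i \<in> Basis" for i
    unfolding d_def by (intro L2_add L2_smooth_mult[OF hL(1)[OF that] ns bd] L2_smooth_mult[OF hL0 smooth_on_pd[OF ns that] bd])
  have nhL: "L2 \<Omega> (\<lambda>x. n i x * h x)" for i by (rule L2_smooth_mult[OF hL0 ns bd])
  define P where "P i x = d i x * v x + n i x * h x * v' i x" for i x
  have Pint: "integrable ?M (P i)" if "i \<in> Basis" for i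
    unfolding P_def by (intro Bochner_Integration.integrable_add L2_mult_integrable dL nhL vL0 vL(2) that)
  have P0: "(\<integral>x. P i x \<partial>?M) = 0" if "i \<in> Basis" for i
    using H1_0_pairing[OF o bd that h0 v ns] unfolding P_def d_def h'_def v'_def .
  define t where "t i x = w i x - n i x * h x" for i x
  define t' where "t' i x = w' i x - d i x" for i x
  have tL: "L2 \<Omega> (t i)" "L2 \<Omega> (t' i)" if "i \<in> Basis" for i
    unfolding t_def t'_def by (intro L2_diff wL nhL dL that)+
  have tw: "has_weak_partial \<Omega> i (t i) (t' i)" if "i \<in> Basis" for i
    using has_weak_partial_lincomb[OF o that wL(3)[OF that] has_weak_partial_smooth_mult[OF hL(2)[OF that] o that ns[of i]], of 1 "- 1"]
    by (simp add: t_def[abs_def] t'_def[abs_def] d_def algebra_simps)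
  obtain G where G: "smooth_on UNIV G" "\<And>x. x \<in> \<Omega> \<Longrightarrow> G x < 0" "\<And>x. x \<notin> \<Omega> \<Longrightarrow> G x \<ge> 0"
    "\<And>x. x \<in> frontier \<Omega> \<Longrightarrow> G x = 0"
    "\<And>x \<nu>. x \<in> frontier \<Omega> \<Longrightarrow> outward_unit_normal \<Omega> x \<nu> \<Longrightarrow> \<exists>l>0. \<forall>i\<in>Basis. pd i G x = l * (\<nu> \<bullet> i)"
    by (rule global_defining_function[OF dom]) (rule that)
  \<comment> \<open>On the boundary, where \<open>N\<close> has length 1, these are the components of the tangential part of the
      gradient of \<open>G\<close>.\<close>
  define A where "A j x = pd j G x - n j x * (\<Sum>i\<in>Basis. n i x * pd i G x)" for j x
  have As: "smooth_on UNIV (A j)" if "j \<in> Basis" for j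
  proof -
    have "smooth_on UNIV (\<lambda>x. pd j G x + (- 1) * (n j x * (\<Sum>i\<in>Basis. n i x * pd i G x)))"
      by (intro smooth_on_add smooth_on_mult smooth_on_sum smooth_on_const smooth_on_pd[OF G(1)] ns that open_UNIV)
    then show ?thesis by (simp add: A_def[abs_def])
  qed
  have A0: "A j x = 0" if j: "j \<in> Basis" and x: "x \<in> frontier \<Omega>" for j x
  proof -
    obtain l where l: "\<forall>i\<in>Basis. pd i G x = l * (N x \<bullet> i)" using G(5)[OF x N(2)[OF x]] by blast
    have "(\<Sum>i\<in>Basis. n i x * pd i G x) = l * (\<Sum>i\<in>Basis. (N x \<bullet> i) * (N x \<bullet> i))"
      unfolding sum_distrib_left using l by (intro sum.cong) (auto simp: n_def)
    also have "\<dots> = l"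
      using outward_unit_normal_norm[OF N(2)[OF x]] by (simp add: euclidean_inner[symmetric] norm_eq_1)
    finally show ?thesis using l j by (simp add: A_def n_def)
  qed
  have G5: "\<exists>\<nu> l. norm \<nu> = 1 \<and> l > 0 \<and> (\<forall>i\<in>Basis. pd i G x = l * (\<nu> \<bullet> i))" if "x \<in> frontier \<Omega>" for x
    using G(5)[OF that N(2)[OF that]] outward_unit_normal_norm[OF N(2)[OF that]] by blast
  have "\<exists>C\<ge>0. \<forall>x\<in>\<Omega>. \<bar>A j x\<bar> \<le> C * \<bar>G x\<bar>" if j: "j \<in> Basis" for j
    using vanishing_on_frontier_bound[OF dom G(1,2,4) G5 As[OF j] A0[OF j]] by metis
  then obtain C where C: "\<And>j. j \<in> Basis \<Longrightarrow> C j \<ge> 0" "\<And>j x. j \<in> Basis \<Longrightarrow> x \<in> \<Omega> \<Longrightarrow> \<bar>A j x\<bar> \<le> C j * \<bar>G x\<bar>"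
    by metis
  obtain s S where s: "\<And>r. (step has_real_derivative s r) (at r)" "\<And>r. \<bar>s r\<bar> \<le> S"
    "\<And>r. r < 0 \<or> r > 1 \<Longrightarrow> s r = 0" "S \<ge> 0" by (rule step_derivative) (rule that)
  define m where "m k = real (Suc k)" for k
  have m0: "m k > 0" for k by (simp add: m_def)
  \<comment> \<open>The shift by 1 makes the cutoff vanish where \<open>G\<close> is above \<open>- 1 / m k\<close>, so its support is compact.\<close>
  define \<zeta> where "\<zeta> k x = step (- m k * G x - 1)" for k x
  have \<zeta>t: "test_function \<Omega> (\<zeta> k)" for k
  proof (rule test_functionI[where K = "closure \<Omega> \<inter> {x. G x \<le> - 1 / m k}"])
    have "smooth_on UNIV (\<lambda>x. step ((- m k) * G x + (- 1)))"
      by (intro smooth_on_compose[OF open_UNIV open_UNIV _ _ smooth_step]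
          smooth_on_add smooth_on_mult smooth_on_const G(1) open_UNIV UNIV_I)
    then show "smooth_on UNIV (\<zeta> k)" by (simp add: \<zeta>_def[abs_def])
    have "closed {x. G x \<le> - 1 / m k}"
      using smooth_on_continuous[OF G(1)] by (intro closed_Collect_le continuous_on_const)
    then show "compact (closure \<Omega> \<inter> {x. G x \<le> - 1 / m k})"
      using bd by (intro compact_Int_closed) auto
    have neg: "- 1 / m k < 0" using m0[of k] by simp
    show "closure \<Omega> \<inter> {x. G x \<le> - 1 / m k} \<subseteq> \<Omega>"
    proof
      fix x assume "x \<in> closure \<Omega> \<inter> {x. G x \<le> - 1 / m k}"
      then have "G x \<le> - 1 / m k" by blast
      then have "G x < 0" using neg by linarith
      then show "x \<in> \<Omega>" using G(3)[of x] by force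
    qed
    fix x assume "x \<notin> closure \<Omega> \<inter> {x. G x \<le> - 1 / m k}"
    then have "G x > - 1 / m k"
    proof (cases "x \<in> \<Omega>")
      case True
      then show ?thesis using \<open>x \<notin> _\<close> closure_subset[of \<Omega>] by auto
    next
      case False
      then show ?thesis using neg G(3)[of x] by linarith
    qed
    then have "- m k * G x - 1 \<le> 0" using m0[of k] by (simp add: field_simps)
    then show "\<zeta> k x = 0" unfolding \<zeta>_def by (rule step_0)
  qed
  have \<zeta>d: "pd i (\<zeta> k) x = - (m k * s (- m k * G x - 1)) * pd i G x" for i k x
  proof -
    have "((\<lambda>r. step (- m k * r - 1)) has_real_derivative s (- m k * G x - 1) * (- m k)) (at (G x))"
      by (rule DERIV_chain2[OF s(1)]) (auto intro!: derivative_eq_intros)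
    from pd_compose[OF smooth_on_differentiable[OF G(1) UNIV_I] this]
    show ?thesis by (simp add: \<zeta>_def[abs_def])
  qed
  define Q where "Q x = (\<Sum>i\<in>Basis. t' i x * v x + t i x * v' i x)" for x
  define R where "R k x = (\<Sum>i\<in>Basis. pd i (\<zeta> k) x * (t i x * v x))" for k x
  have Qi: "integrable ?M (\<lambda>x. t' i x * v x + t i x * v' i x)" if "i \<in> Basis" for i
    by (intro Bochner_Integration.integrable_add L2_mult_integrable tL vL0 vL(2) that)
  have Qint: "integrable ?M Q" unfolding Q_def by (intro Bochner_Integration.integrable_sum Qi)
  have test_int: "integrable ?M (\<lambda>x. \<psi> x * p x)" if \<psi>: "test_function \<Omega> \<psi>" and p: "integrable ?M p" for \<psi> p :: "'a \<Rightarrow> real"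
  proof -
    obtain c where c: "\<And>x. \<bar>\<psi> x\<bar> \<le> c" using test_function_bounded[OF \<psi>] by metis
    have "integrable ?M (\<lambda>x. p x * \<psi> x)"
      by (rule integrable_bounded_mult[OF p borel_imp_lebesgue_on[OF smooth_borel_measurable[OF test_function_smooth[OF \<psi>]]]])
        (rule c)
    then show ?thesis by (simp add: mult.commute)
  qed
  have tvi: "integrable ?M (\<lambda>x. t i x * v x)" if "i \<in> Basis" for i
    by (intro L2_mult_integrable tL vL0 that)
  have Rint: "integrable ?M (R k)" for k
    unfolding R_def by (intro Bochner_Integration.integrable_sum test_int test_function_pd[OF \<zeta>t] tvi)
  have \<zeta>Qint: "integrable ?M (\<lambda>x. \<zeta> k x * Q x)" for k
    by (rule test_int[OF \<zeta>t Qint])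
  have cut: "(\<integral>x. \<zeta> k x * Q x + R k x \<partial>?M) = 0" for k
  proof -
    have "(\<integral>x. \<zeta> k x * Q x + R k x \<partial>?M)
        = (\<integral>x. (\<Sum>i\<in>Basis. \<zeta> k x * (t' i x * v x + t i x * v' i x) + pd i (\<zeta> k) x * (t i x * v x)) \<partial>?M)"
      unfolding Q_def R_def sum_distrib_left sum.distrib[symmetric] ..
    also have "\<dots> = (\<Sum>i\<in>Basis. \<integral>x. \<zeta> k x * (t' i x * v x + t i x * v' i x) + pd i (\<zeta> k) x * (t i x * v x) \<partial>?M)"
      by (intro Bochner_Integration.integral_sum Bochner_Integration.integrable_add test_int
          \<zeta>t test_function_pd[OF \<zeta>t] Qi tvi)
    also have "\<dots> = 0"
      by (intro sum.neutral ballI weak_product_rule[OF o _ tw _ tL vL0 vL(2) \<zeta>t]) (auto intro: vL(3))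
    finally show ?thesis .
  qed
  define b where "b x = \<bar>Q x\<bar> + (\<Sum>j\<in>Basis. (2 * S * C j) * \<bar>w j x * v x\<bar>)" for x
  have bint: "integrable ?M b"
    unfolding b_def
    by (intro Bochner_Integration.integrable_add Bochner_Integration.integrable_sum integrable_abs Qint integrable_mult_right
        L2_mult_integrable wL(1) vL0)
  have R_eq: "R k x = - (m k * s (- m k * G x - 1)) * (\<Sum>j\<in>Basis. A j x * (w j x * v x))" for k x
  proof -
    define c where "c = (\<Sum>i\<in>Basis. n i x * pd i G x)"
    have "(\<Sum>i\<in>Basis. pd i G x * t i x) = (\<Sum>i\<in>Basis. pd i G x * w i x - (n i x * pd i G x) * h x)"
      by (intro sum.cong refl) (simp add: t_def algebra_simps)
    also have "\<dots> = (\<Sum>i\<in>Basis. pd i G x * w i x) - c * h x"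
      by (simp only: sum_subtractf sum_distrib_right c_def)
    also have "\<dots> = (\<Sum>j\<in>Basis. pd j G x * w j x - c * (n j x * w j x))"
      by (simp only: h_eq sum_subtractf sum_distrib_left)
    also have "\<dots> = (\<Sum>j\<in>Basis. A j x * w j x)"
      by (intro sum.cong refl) (simp add: A_def c_def[symmetric] algebra_simps)
    finally have *: "(\<Sum>i\<in>Basis. pd i G x * t i x) = (\<Sum>j\<in>Basis. A j x * w j x)" .
    have "R k x = - (m k * s (- m k * G x - 1)) * (\<Sum>i\<in>Basis. pd i G x * t i x) * v x"
      by (simp only: R_def \<zeta>d sum_distrib_left sum_distrib_right mult.assoc)
    also have "\<dots> = - (m k * s (- m k * G x - 1)) * (\<Sum>j\<in>Basis. A j x * (w j x * v x))"
      by (simp only: * sum_distrib_left sum_distrib_right mult.assoc)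
    finally show ?thesis .
  qed
  have Rb: "\<bar>R k x\<bar> \<le> (\<Sum>j\<in>Basis. (2 * S * C j) * \<bar>w j x * v x\<bar>)" if x: "x \<in> \<Omega>" for k x
  proof -
    let ?r = "- m k * G x - 1"
    \<comment> \<open>The derivative of the step vanishes where \<open>m k * \<bar>G x\<bar>\<close> exceeds 2.\<close>
    have key: "m k * \<bar>s ?r\<bar> * \<bar>G x\<bar> \<le> 2 * S"
    proof (cases "?r > 1")
      case True then show ?thesis using s(3,4) by simp
    next
      case False
      then have "m k * \<bar>G x\<bar> \<le> 2" using G(2)[OF x] by simp
      then have "(m k * \<bar>G x\<bar>) * \<bar>s ?r\<bar> \<le> 2 * S" using s(2)[of ?r] by (intro mult_mono) auto
      then show ?thesis by (simp add: mult_ac)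
    qed
    have "\<bar>R k x\<bar> = m k * \<bar>s ?r\<bar> * \<bar>\<Sum>j\<in>Basis. A j x * (w j x * v x)\<bar>"
      unfolding R_eq using m0[of k] by (simp add: abs_mult)
    also have "\<dots> \<le> m k * \<bar>s ?r\<bar> * (\<Sum>j\<in>Basis. (C j * \<bar>G x\<bar>) * \<bar>w j x * v x\<bar>)"
    proof (intro mult_left_mono order_trans[OF sum_abs] sum_mono)
      fix j :: 'a assume "j \<in> Basis"
      then show "\<bar>A j x * (w j x * v x)\<bar> \<le> C j * \<bar>G x\<bar> * \<bar>w j x * v x\<bar>"
        unfolding abs_mult[of "A j x"] using C(2) x by (intro mult_right_mono) auto
    qed (use m0[of k] in auto)
    also have "\<dots> = (\<Sum>j\<in>Basis. (m k * \<bar>s ?r\<bar> * \<bar>G x\<bar>) * (C j * \<bar>w j x * v x\<bar>))"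
      by (simp add: sum_distrib_left mult_ac)
    also have "\<dots> \<le> (\<Sum>j\<in>Basis. (2 * S) * (C j * \<bar>w j x * v x\<bar>))"
      using key C(1) by (intro sum_mono mult_right_mono) auto
    finally show ?thesis by (simp add: mult.assoc)
  qed
  have "(\<lambda>k. \<integral>x. \<zeta> k x * Q x + R k x \<partial>?M) \<longlonglongrightarrow> (\<integral>x. Q x \<partial>?M)"
  proof (rule integral_dominated_convergence[OF _ _ bint])
    show "Q \<in> borel_measurable ?M" using Qint by (rule borel_measurable_integrable)
    show "(\<lambda>x. \<zeta> k x * Q x + R k x) \<in> borel_measurable ?M" for k
      using \<zeta>Qint Rint by (intro borel_measurable_integrable Bochner_Integration.integrable_add)
    show "AE x in ?M. (\<lambda>k. \<zeta> k x * Q x + R k x) \<longlonglongrightarrow> Q x"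
    proof (rule AE_I2)
      fix x assume "x \<in> space ?M"
      then have x: "x \<in> \<Omega>" by (simp add: space_restrict_space)
      obtain k0 :: nat where k0: "3 / \<bar>G x\<bar> \<le> real k0" using real_arch_simple by blast
      have "\<forall>\<^sub>F k in sequentially. \<zeta> k x * Q x + R k x = Q x"
        using eventually_ge_at_top[of k0]
      proof eventually_elim
        case (elim k)
        then have "3 / \<bar>G x\<bar> \<le> m k" using k0 by (simp add: m_def)
        then have "- m k * G x - 1 > 1" using G(2)[OF x] by (simp add: field_simps)
        then show ?case using s(3) step_1 by (simp add: R_eq \<zeta>_def)
      qed
      then show "(\<lambda>k. \<zeta> k x * Q x + R k x) \<longlonglongrightarrow> Q x" by (rule tendsto_eventually)
    qed
    show "AE x in ?M. norm (\<zeta> k x * Q x + R k x) \<le> b x" for k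
    proof (rule AE_I2)
      fix x assume "x \<in> space ?M"
      then have x: "x \<in> \<Omega>" by (simp add: space_restrict_space)
      have "\<bar>\<zeta> k x * Q x\<bar> \<le> \<bar>Q x\<bar>"
        using step_bounds by (simp add: \<zeta>_def abs_mult mult_left_le_one_le)
      then show "norm (\<zeta> k x * Q x + R k x) \<le> b x"
        using Rb[OF x, of k] abs_triangle_ineq[of "\<zeta> k x * Q x" "R k x"] by (simp add: b_def)
    qed
  qed
  then have Q0: "(\<integral>x. Q x \<partial>?M) = 0" by (simp add: cut LIMSEQ_const_iff)
  have "(\<lambda>x. weak_laplacian \<Omega> u x * v x + weak_grad \<Omega> u x \<bullet> weak_grad \<Omega> v x) = (\<lambda>x. Q x + (\<Sum>i\<in>Basis. P i x))"
  proof
    fix x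
    have "weak_laplacian \<Omega> u x * v x + weak_grad \<Omega> u x \<bullet> weak_grad \<Omega> v x = (\<Sum>i\<in>Basis. w' i x * v x + w i x * v' i x)"
      by (simp add: inner_weak_grad weak_laplacian_def w_def w'_def v'_def sum.distrib sum_distrib_right)
    also have "\<dots> = (\<Sum>i\<in>Basis. (t' i x * v x + t i x * v' i x) + P i x)"
      by (intro sum.cong refl) (simp add: t_def t'_def P_def algebra_simps)
    finally show "weak_laplacian \<Omega> u x * v x + weak_grad \<Omega> u x \<bullet> weak_grad \<Omega> v x = Q x + (\<Sum>i\<in>Basis. P i x)"
      by (simp add: Q_def sum.distrib)
  qed
  then show ?thesis
    using Qint Q0 Pint P0 by (simp add: Bochner_Integration.integrable_sum Bochner_Integration.integral_sum)
qed

section \<open>Green's formula under periodicity\<close>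

text \<open>Integration against a cutoff that rises from 0 to 1 over one period and falls back over the
  next one reduces, by periodicity, to integration over a single cell: the values of the cutoff at
  corresponding points add up to 1, and those of its derivative to 0.\<close>

lemma periodic_integral_product_rule:
  fixes f f' v v' :: "'a::euclidean_space \<Rightarrow> real"
  assumes i: "i \<in> Basis" and ab: "a \<bullet> i < b \<bullet> i" and o: "open W"
    and sub: "cbox a (b + ((b - a) \<bullet> i) *\<^sub>R i) \<subseteq> W"
    and wf: "has_weak_partial W i f f'" and wv: "has_weak_partial W i v v'"
    and L2: "L2 W f" "L2 W f'" "L2 W v" "L2 W v'"
    and per: "\<And>g. g \<in> {f, f', v, v'} \<Longrightarrow> AE x in lebesgue_on (box a b). g (x + ((b - a) \<bullet> i) *\<^sub>R i) = g x"
  shows "(\<integral>x. f' x * v x + f x * v' x \<partial>lebesgue_on (box a b)) = 0"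
proof -
  define L where "L = (b - a) \<bullet> i"
  define h where "h = L *\<^sub>R i"
  define c where "c = b + h"
  have L: "L > 0" "b \<bullet> i = a \<bullet> i + L" using ab by (auto simp: L_def inner_diff_left)
  have ci: "c \<bullet> i = b \<bullet> i + L" and cj: "\<And>j. j \<in> Basis \<Longrightarrow> j \<noteq> i \<Longrightarrow> c \<bullet> j = b \<bullet> j"
    and hi: "h \<bullet> i = L" and hj: "\<And>j. j \<in> Basis \<Longrightarrow> j \<noteq> i \<Longrightarrow> h \<bullet> j = 0"
    using i by (auto simp: c_def h_def inner_add_left inner_Basis)
  have cW: "cbox a c \<subseteq> W" using sub by (simp add: c_def h_def L_def)
  have om: "W \<in> sets lebesgue" using o by auto
  obtain s S where s: "\<And>r. (step has_real_derivative s r) (at r)" "\<And>r. \<bar>s r\<bar> \<le> S"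
    "\<And>r. r < 0 \<or> r > 1 \<Longrightarrow> s r = 0" "S \<ge> 0" by (rule step_derivative) (rule that)
  define p where "p t = step ((t - a \<bullet> i) / L)" for t
  define p' where "p' t = s ((t - a \<bullet> i) / L) / L" for t
  have p0: "p t = 0" if "t \<le> a \<bullet> i" for t
    unfolding p_def using that L(1) by (intro step_0) (simp add: divide_nonpos_pos)
  have p1: "p t = 1" if "t \<ge> b \<bullet> i" for t
    unfolding p_def using that L by (intro step_1) (simp add: le_divide_eq)
  have p'0: "p' t = 0" if "t < a \<bullet> i \<or> t > b \<bullet> i" for t
  proof -
    have "(t - a \<bullet> i) / L < 0 \<or> (t - a \<bullet> i) / L > 1"
      using that divide_neg_pos[OF _ L(1), of "t - a \<bullet> i"] pos_less_divide_eq[OF L(1), of 1 "t - a \<bullet> i"] L(2)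
      by linarith
    from s(3)[OF this] show ?thesis by (simp add: p'_def)
  qed
  have pd: "(p has_real_derivative p' t) (at t)" for t
  proof -
    have "((\<lambda>t. step ((t - a \<bullet> i) / L)) has_real_derivative s ((t - a \<bullet> i) / L) * (1 / L)) (at t)"
      by (rule DERIV_chain2[OF s(1)]) (use L(1) in \<open>auto intro!: derivative_eq_intros\<close>)
    then show ?thesis by (simp add: p_def[abs_def] p'_def)
  qed
  have ps: "smooth_on UNIV p"
  proof -
    have "smooth_on UNIV (\<lambda>t. step ((1 / L) *\<^sub>R t + (- (a \<bullet> i) / L)))" by (rule smooth_on_affine[OF smooth_step])
    then show ?thesis by (simp add: p_def[abs_def] diff_divide_distrib)
  qed
  define q where "q t = p t - p (t - L)" for t
  define q' where "q' t = p' t - p' (t - L)" for t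
  have q0: "q t = 0" if "t \<le> a \<bullet> i \<or> t \<ge> c \<bullet> i" for t
    using that p0[of t] p0[of "t - L"] p1[of t] p1[of "t - L"] L(1) by (auto simp: q_def ci)
  have q'0: "q' t = 0" if "t < a \<bullet> i \<or> t > c \<bullet> i" for t
    using that p'0[of t] p'0[of "t - L"] L by (auto simp: q'_def ci)
  have qsum: "q t + q (t + L) = 1" "q' t + q' (t + L) = 0" if "a \<bullet> i < t" "t < b \<bullet> i" for t
    using that p0[of "t - L"] p1[of "t + L"] p'0[of "t - L"] p'0[of "t + L"] L by (auto simp: q_def q'_def)
  have qd: "(q has_real_derivative q' t) (at t)" for t
  proof -
    have "((\<lambda>t. p (t - L)) has_real_derivative p' (t - L) * 1) (at t)"
      by (rule DERIV_chain2[OF pd]) (auto intro!: derivative_eq_intros)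
    from DERIV_diff[OF pd this] show ?thesis by (simp add: q_def[abs_def] q'_def)
  qed
  have qs: "smooth_on UNIV q"
  proof -
    have "smooth_on UNIV (\<lambda>t. p t + (- 1) * p (t + - L))"
      by (intro smooth_on_add smooth_on_mult smooth_on_const smooth_on_translation ps open_UNIV)
    then show ?thesis by (simp add: q_def[abs_def])
  qed
  \<comment> \<open>The bumps in the other directions do not affect the derivative in direction \<open>i\<close>, so they may tend to
      the indicator function of the cell.\<close>
  let ?J = "Basis - {i}"
  define B where "B k = bump_box (real (Suc k)) a b ?J" for k
  have Bs: "smooth_on UNIV (B k)" for k unfolding B_def by (rule smooth_bump_box)
  have qis: "smooth_on UNIV (\<lambda>x::'a. q (x \<bullet> i))"
    by (intro smooth_on_compose[OF open_UNIV open_UNIV _ _ qs] smooth_on_coordinate open_UNIV UNIV_I)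
  define \<zeta> where "\<zeta> k x = q (x \<bullet> i) * B k x" for k x
  have \<zeta>t: "test_function W (\<zeta> k)" for k
  proof (rule test_functionI[OF _ compact_cbox cW])
    show "smooth_on UNIV (\<zeta> k)" unfolding \<zeta>_def[abs_def] by (intro smooth_on_mult qis Bs open_UNIV)
    fix x assume "x \<notin> cbox a c"
    then obtain j where j: "j \<in> Basis" "x \<bullet> j < a \<bullet> j \<or> x \<bullet> j > c \<bullet> j" by (auto simp: mem_box not_le)
    show "\<zeta> k x = 0"
    proof (cases "j = i")
      case True then show ?thesis using q0[of "x \<bullet> i"] j by (auto simp: \<zeta>_def)
    next
      case False
      then have "\<not> bump (real (Suc k)) (a \<bullet> j) (b \<bullet> j) (x \<bullet> j) > 0"
        using j cj[of j] by (subst bump_pos_iff) auto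
      then have "bump (real (Suc k)) (a \<bullet> j) (b \<bullet> j) (x \<bullet> j) = 0"
        using bump_bounds(1)[of "real (Suc k)" "a \<bullet> j" "b \<bullet> j" "x \<bullet> j"] by linarith
      then have "B k x = 0" unfolding B_def bump_box_def using j(1) False by (intro prod_zero) auto
      then show ?thesis by (simp add: \<zeta>_def)
    qed
  qed
  have Bd: "pd i (B k) x = 0" for k x
  proof -
    have "(\<lambda>t. B k (x + t *\<^sub>R i)) = (\<lambda>t. B k x)"
      unfolding B_def bump_box_def using i by (intro ext prod.cong refl) (auto simp: inner_add_left inner_Basis)
    moreover have "((\<lambda>t. B k (x + t *\<^sub>R i)) has_real_derivative pd i (B k) (x + 0 *\<^sub>R i)) (at 0)"
      by (rule has_real_derivative_along_line[OF smooth_on_differentiable[OF Bs UNIV_I]])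
    ultimately have "((\<lambda>t::real. B k x) has_real_derivative pd i (B k) x) (at 0)" by simp
    then show ?thesis using DERIV_unique[OF _ DERIV_const] by blast
  qed
  have qid: "pd i (\<lambda>x. q (x \<bullet> i)) x = q' (x \<bullet> i)" for x
  proof -
    have "((\<lambda>x. x \<bullet> i) has_derivative (\<lambda>h. h \<bullet> i)) (at x)" by (auto intro!: derivative_eq_intros)
    from frechet_derivative_at[OF this] have "pd i (\<lambda>x. x \<bullet> i) x = i \<bullet> i" by metis
    then show ?thesis
      using pd_compose[OF smooth_on_differentiable[OF smooth_on_coordinate[OF open_UNIV, of i] UNIV_I, of x] qd[of "x \<bullet> i"], where i = i] i
      by simp
  qed
  have \<zeta>d: "pd i (\<zeta> k) x = q' (x \<bullet> i) * B k x" for k x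
    unfolding \<zeta>_def[abs_def]
    using pd_mult[OF smooth_on_differentiable[OF qis UNIV_I] smooth_on_differentiable[OF Bs[of k] UNIV_I], of x i]
    by (simp add: Bd qid)
  define F where "F x = f' x * v x + f x * v' x" for x
  define g where "g x = f x * v x" for x
  define Z where "Z x = q (x \<bullet> i) * F x + q' (x \<bullet> i) * g x" for x
  have Fi: "integrable (lebesgue_on W) F" and gi: "integrable (lebesgue_on W) g"
    unfolding F_def g_def by (intro Bochner_Integration.integrable_add L2_mult_integrable L2)+
  have Zi: "integrable (lebesgue_on W) Z"
  proof -
    have bm: "(\<lambda>x. q (x \<bullet> i)) \<in> borel_measurable borel" "(\<lambda>x. q' (x \<bullet> i)) \<in> borel_measurable borel"
      using smooth_borel_measurable[OF qis] smooth_borel_measurable[OF smooth_on_pd[OF qis i]] by (simp_all add: qid)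
    have pb: "\<bar>q t\<bar> \<le> 1" for t
      using step_bounds[of "(t - a \<bullet> i) / L"] step_bounds[of "(t - L - a \<bullet> i) / L"] by (auto simp: q_def p_def abs_le_iff)
    have p'b: "\<bar>p' t\<bar> \<le> S / L" for t using s(2) L(1) by (simp add: p'_def divide_right_mono)
    have q'b: "\<bar>q' t\<bar> \<le> 2 * (S / L)" for t
      using p'b[of t] p'b[of "t - L"] unfolding q'_def by linarith
    have "integrable (lebesgue_on W) (\<lambda>x. F x * q (x \<bullet> i) + g x * q' (x \<bullet> i))"
      by (intro Bochner_Integration.integrable_add integrable_bounded_mult[OF Fi borel_imp_lebesgue_on[OF bm(1)] pb]
        integrable_bounded_mult[OF gi borel_imp_lebesgue_on[OF bm(2)] q'b])
    then show ?thesis by (simp add: Z_def[abs_def] mult.commute)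
  qed
  define \<iota> where "\<iota> x = (\<Prod>j\<in>?J. indicator {a \<bullet> j<..<b \<bullet> j} (x \<bullet> j) :: real)" for x :: 'a
  have lim: "(\<lambda>k. B k x) \<longlonglongrightarrow> \<iota> x" for x
    unfolding B_def \<iota>_def by (rule bump_box_tendsto) simp
  have cut: "(\<integral>x. B k x * Z x \<partial>lebesgue_on W) = 0" for k
  proof -
    have "(\<lambda>x. B k x * Z x) = (\<lambda>x. \<zeta> k x * (f' x * v x + f x * v' x) + pd i (\<zeta> k) x * (f x * v x))"
      unfolding \<zeta>d by (simp add: \<zeta>_def Z_def F_def g_def algebra_simps)
    then show ?thesis using weak_product_rule[OF o i wf wv L2 \<zeta>t, of k] by simp
  qed
  have Bm: "B k \<in> borel_measurable borel" for k by (rule smooth_borel_measurable[OF Bs])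
  have \<iota>m: "\<iota> \<in> borel_measurable borel" using borel_measurable_LIMSEQ_real[OF lim Bm] .
  have Bb: "\<bar>B k x\<bar> \<le> 1" for k x using bump_box_bounds[of "real (Suc k)" a b ?J x] by (simp add: B_def)
  have \<iota>b: "\<bar>\<iota> x\<bar> \<le> 1" for x by (auto simp: \<iota>_def intro!: prod_le_1 prod_nonneg simp: abs_prod)
  have Zm: "Z \<in> borel_measurable (lebesgue_on W)" using Zi by (rule borel_measurable_integrable)
  have "(\<lambda>k. \<integral>x. B k x * Z x \<partial>lebesgue_on W) \<longlonglongrightarrow> (\<integral>x. \<iota> x * Z x \<partial>lebesgue_on W)"
  proof (rule integral_dominated_convergence[OF _ _ integrable_abs[OF Zi]])
    show "(\<lambda>x. \<iota> x * Z x) \<in> borel_measurable (lebesgue_on W)"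
      by (rule borel_measurable_times[OF borel_imp_lebesgue_on[OF \<iota>m] Zm])
    show "(\<lambda>x. B k x * Z x) \<in> borel_measurable (lebesgue_on W)" for k
      by (rule borel_measurable_times[OF borel_imp_lebesgue_on[OF Bm] Zm])
    show "AE x in lebesgue_on W. (\<lambda>k. B k x * Z x) \<longlonglongrightarrow> \<iota> x * Z x"
      by (intro AE_I2 tendsto_mult lim tendsto_const)
    show "AE x in lebesgue_on W. norm (B k x * Z x) \<le> \<bar>Z x\<bar>" for k
      using Bb by (intro AE_I2) (simp add: abs_mult mult_left_le_one_le)
  qed
  then have zero: "(\<integral>x. \<iota> x * Z x \<partial>lebesgue_on W) = 0" by (simp add: cut LIMSEQ_const_iff)
  \<comment> \<open>The cutoff in direction \<open>i\<close> lives on two adjacent cells; the second is translated onto the first.\<close>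
  let ?Q = "box a b"
  have QW: "?Q \<subseteq> W" and QhW: "\<And>x. x \<in> ?Q \<Longrightarrow> x + h \<in> W"
  proof -
    have "x \<in> cbox a c" if "x \<in> ?Q" for x
    proof -
      have "x \<bullet> j \<le> c \<bullet> j" if "j \<in> Basis" for j
        using \<open>x \<in> ?Q\<close> that L ci cj[of j] by (cases "j = i") (force simp: mem_box)+
      then show ?thesis using that by (force simp: mem_box)
    qed
    then show "?Q \<subseteq> W" using cW by auto
    have "x + h \<in> cbox a c" if "x \<in> ?Q" for x
    proof -
      have "a \<bullet> j \<le> (x + h) \<bullet> j \<and> (x + h) \<bullet> j \<le> c \<bullet> j" if j: "j \<in> Basis" for j
      proof -
        have "a \<bullet> j < x \<bullet> j" "x \<bullet> j < b \<bullet> j" using \<open>x \<in> ?Q\<close> j by (auto simp: mem_box)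
        then show ?thesis
          using j L ci cj[of j] hi hj[of j] by (cases "j = i") (auto simp: inner_add_left)
      qed
      then show ?thesis by (simp add: mem_box)
    qed
    then show "x + h \<in> W" if "x \<in> ?Q" for x using cW that by auto
  qed
  have Zl: "integrable lebesgue (\<lambda>x. indicator W x * Z x)"
    using Zi om integrable_restrict_space[of W lebesgue Z] by simp
  define I1 where "I1 x = indicator ?Q x * (indicator W x * Z x)" for x
  define I2 where "I2 x = indicator ?Q (x - h) * (indicator W x * Z x)" for x
  have I1: "integrable lebesgue I1"
    using integrable_mult_indicator[OF _ Zl, of ?Q] by (simp add: I1_def[abs_def])
  have Q': "{x. x - h \<in> ?Q} \<in> sets lebesgue"
  proof -
    have "{x. x - h \<in> ?Q} = (\<lambda>x. x - h) -` ?Q" by auto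
    moreover have "open ((\<lambda>x. x - h) -` ?Q)" by (intro open_vimage open_box continuous_intros)
    ultimately show ?thesis by (simp add: open_sets_lebesgue)
  qed
  have I2: "integrable lebesgue I2"
    using integrable_mult_indicator[OF Q' Zl] by (simp add: I2_def[abs_def] indicator_def)
  have hyper: "AE x in lebesgue. x \<bullet> i \<noteq> r" for r
    using negligible_standard_hyperplane[OF i, of r] AE_not_in[of "{x. x \<bullet> i = r}" lebesgue]
    by (simp add: negligible_iff_null_sets)
  have split: "AE x in lebesgue. indicator W x * (\<iota> x * Z x) = I1 x + I2 x"
    using hyper[of "a \<bullet> i"] hyper[of "b \<bullet> i"] hyper[of "c \<bullet> i"]
  proof eventually_elim
    case (elim x)
    have \<iota>_eq: "\<iota> x = (if \<forall>j\<in>?J. a \<bullet> j < x \<bullet> j \<and> x \<bullet> j < b \<bullet> j then 1 else 0)"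
      by (auto simp: \<iota>_def indicator_def prod_zero_iff)
    have Qx: "x \<in> ?Q \<longleftrightarrow> (\<forall>j\<in>?J. a \<bullet> j < x \<bullet> j \<and> x \<bullet> j < b \<bullet> j) \<and> a \<bullet> i < x \<bullet> i \<and> x \<bullet> i < b \<bullet> i"
      using i by (auto simp: mem_box)
    have "(\<forall>j\<in>?J. a \<bullet> j < (x - h) \<bullet> j \<and> (x - h) \<bullet> j < b \<bullet> j) \<longleftrightarrow> (\<forall>j\<in>?J. a \<bullet> j < x \<bullet> j \<and> x \<bullet> j < b \<bullet> j)"
      using hj by (auto simp: inner_diff_left)
    then have Qhx: "x - h \<in> ?Q \<longleftrightarrow> (\<forall>j\<in>?J. a \<bullet> j < x \<bullet> j \<and> x \<bullet> j < b \<bullet> j) \<and> b \<bullet> i < x \<bullet> i \<and> x \<bullet> i < c \<bullet> i"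
      using i hi L ci by (auto simp: mem_box inner_diff_left)
    show ?case
    proof (cases "x \<bullet> i < a \<bullet> i \<or> x \<bullet> i > c \<bullet> i")
      case True
      then show ?thesis using q0[of "x \<bullet> i"] q'0[of "x \<bullet> i"] by (auto simp: I1_def I2_def Z_def)
    next
      case False
      then show ?thesis using elim L(1) by (auto simp: I1_def I2_def indicator_def \<iota>_eq Qx Qhx)
    qed
  qed
  have "(\<integral>x. \<iota> x * Z x \<partial>lebesgue_on W) = (\<integral>x. indicator W x * (\<iota> x * Z x) \<partial>lebesgue)"
    using om by (simp add: integral_restrict_space)
  also have "\<dots> = (\<integral>x. I1 x + I2 x \<partial>lebesgue)"
    using integral_lebesgue_on_cong_AE[where S = UNIV, unfolded lebesgue_on_UNIV_eq, OF split] by simp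
  also have "\<dots> = (\<integral>x. I1 x \<partial>lebesgue) + (\<integral>x. I2 (x + h) \<partial>lebesgue)"
    using I1 I2 by (simp add: integral_lebesgue_translation[OF I2])
  also have "\<dots> = (\<integral>x. I1 x + I2 (x + h) \<partial>lebesgue)"
    using I1 integrable_lebesgue_translation[OF I2, of h] by simp
  also have "\<dots> = (\<integral>x. indicator ?Q x * F x \<partial>lebesgue)"
  proof -
    have per': "AE x in lebesgue. x \<in> ?Q \<longrightarrow> G (x + h) = G x" if "G \<in> {f, f', v, v'}" for G
      using per[OF that] by (subst (asm) AE_restrict_space_iff) (auto simp: h_def L_def)
    have "AE x in lebesgue. I1 x + I2 (x + h) = indicator ?Q x * F x"
      using per'[of f, simplified] per'[of f', simplified] per'[of v, simplified] per'[of v', simplified]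
    proof eventually_elim
      case (elim x)
      show ?case
      proof (cases "x \<in> ?Q")
        case True
        have xi: "a \<bullet> i < x \<bullet> i" "x \<bullet> i < b \<bullet> i" using True i by (auto simp: mem_box)
        have "I1 x + I2 (x + h) = (q (x \<bullet> i) + q (x \<bullet> i + L)) * F x + (q' (x \<bullet> i) + q' (x \<bullet> i + L)) * g x"
          using True QW QhW[OF True] elim
          by (auto simp: I1_def I2_def Z_def F_def g_def inner_add_left hi algebra_simps)
        then show ?thesis using True qsum[OF xi] by simp
      qed (simp add: I1_def I2_def)
    qed
    from integral_lebesgue_on_cong_AE[where S = UNIV, unfolded lebesgue_on_UNIV_eq, OF this] show ?thesis by simp
  qed
  also have "\<dots> = (\<integral>x. F x \<partial>lebesgue_on ?Q)"
    by (simp add: integral_restrict_space)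
  finally show ?thesis using zero by (simp add: F_def)
qed

text \<open>The periodic extensions are Sobolev functions on a ball that contains the cell and its neighbours. By
  uniqueness their weak derivatives are periodic and restrict to those on the cell.\<close>

lemma green_periodic:
  fixes a b :: "'a::euclidean_space"
  assumes ab: "\<And>i. i \<in> Basis \<Longrightarrow> a \<bullet> i < b \<bullet> i" and u: "H2_periodic a b u" and v: "H2_periodic a b v"
  shows "(\<integral>x. weak_laplacian (box a b) u x * v x + weak_grad (box a b) u x \<bullet> weak_grad (box a b) v x
    \<partial>lebesgue_on (box a b)) = 0"
proof -
  let ?Q = "box a b"
  define h where "h i = ((b - a) \<bullet> i) *\<^sub>R i" for i :: 'a
  obtain p where p: "\<And>x i. i \<in> Basis \<Longrightarrow> p (x + h i) = p x" "\<And>r. r > 0 \<Longrightarrow> H2 (ball 0 r) p"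
    "AE x in lebesgue_on ?Q. p x = u x" using u unfolding H2_periodic_def h_def by blast
  obtain q where q: "\<And>x i. i \<in> Basis \<Longrightarrow> q (x + h i) = q x" "\<And>r. r > 0 \<Longrightarrow> H2 (ball 0 r) q"
    "AE x in lebesgue_on ?Q. q x = v x" using v unfolding H2_periodic_def h_def by blast
  obtain r where r: "r > 0" "cbox a (b + (b - a)) \<subseteq> ball 0 r"
    using bounded_subset_ballD[OF bounded_cbox] by metis
  define W where "W = ball (0::'a) r"
  have o: "open W" and oQ: "open ?Q" and Qm: "?Q \<in> sets lebesgue" by (auto simp: W_def open_box)
  have sub: "cbox a (b + h i) \<subseteq> W" if i: "i \<in> Basis" for i
  proof -
    have "cbox a (b + h i) \<subseteq> cbox a (b + (b - a))"
    proof (rule subsetI, unfold mem_box, rule ballI)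
      fix x j :: 'a
      assume x: "\<forall>j\<in>Basis. a \<bullet> j \<le> x \<bullet> j \<and> x \<bullet> j \<le> (b + h i) \<bullet> j" and j: "j \<in> Basis"
      have "h i \<bullet> j \<le> (b - a) \<bullet> j" using i j ab[of j] by (auto simp: h_def inner_Basis inner_diff_left)
      then show "a \<bullet> j \<le> x \<bullet> j \<and> x \<bullet> j \<le> (b + (b - a)) \<bullet> j"
        using bspec[OF x j] by (simp add: inner_add_left)
    qed
    then show ?thesis using r(2) by (auto simp: W_def)
  qed
  have QW: "?Q \<subseteq> W"
  proof
    fix x assume x: "x \<in> ?Q"
    have "x \<in> cbox a (b + (b - a))"
      using x by (force simp: mem_box inner_add_left inner_diff_left)
    then show "x \<in> W" using r(2) by (auto simp: W_def)
  qed
  have QhW: "x + h i \<in> W" if x: "x \<in> ?Q" and i: "i \<in> Basis" for x i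
  proof (rule subsetD[OF sub[OF i]], unfold mem_box, rule ballI)
    fix j :: 'a assume j: "j \<in> Basis"
    then show "a \<bullet> j \<le> (x + h i) \<bullet> j \<and> (x + h i) \<bullet> j \<le> (b + h i) \<bullet> j"
      using x ab[OF i] i by (auto simp: mem_box h_def inner_add_left inner_Basis less_imp_le inner_diff_left intro: add_increasing2)
  qed
  have per: "AE x in lebesgue_on ?Q. G' (x + h i) = G' x"
    if G: "AE x in lebesgue_on ?Q. G (x + h i) = G x" "has_weak_partial W j G G'" and i: "i \<in> Basis" and j: "j \<in> Basis" for G G' i j
    by (rule has_weak_partial_unique[OF has_weak_partial_translation[OF G(2) o oQ j QhW[OF _ i]]
          has_weak_partial_subset[OF G(2) o oQ QW j] oQ j G(1)])
  define w where "w i = weak_partial W i p" for i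
  define w' where "w' i = weak_partial W i (w i)" for i
  define q' where "q' i = weak_partial W i q" for i
  have H: "H2 W p" "H1 W q" using p(2)[OF r(1)] q(2)[OF r(1)] by (auto simp: W_def H2_def)
  have pw: "has_weak_partial W i p (w i)" "H1 W (w i)" if "i \<in> Basis" for i
    using H1_weak_partial(1)[OF _ o that, of p] H(1) that by (auto simp: w_def H2_def)
  have ww: "has_weak_partial W i (w i) (w' i)" "L2 W (w i)" "L2 W (w' i)" if "i \<in> Basis" for i
    using H1_weak_partial[OF pw(2)[OF that] o that] pw(2)[OF that] by (auto simp: w'_def H1_def)
  have qw: "has_weak_partial W i q (q' i)" "L2 W q" "L2 W (q' i)" if "i \<in> Basis" for i
    using H1_weak_partial[OF H(2) o that] H(2) by (auto simp: q'_def H1_def)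
  have zero: "(\<integral>x. w' i x * q x + w i x * q' i x \<partial>lebesgue_on ?Q) = 0" if i: "i \<in> Basis" for i
  proof (rule periodic_integral_product_rule[OF i ab[OF i] o sub[OF i, unfolded h_def] ww(1)[OF i] qw(1)[OF i]])
    have pp: "AE x in lebesgue_on ?Q. p (x + h i) = p x" and qq: "AE x in lebesgue_on ?Q. q (x + h i) = q x"
      using p(1)[OF i] q(1)[OF i] by auto
    note wp = per[OF pp pw(1)[OF i] i i]
    fix G assume "G \<in> {w i, w' i, q, q' i}"
    then show "AE x in lebesgue_on ?Q. G (x + ((b - a) \<bullet> i) *\<^sub>R i) = G x"
      using wp per[OF wp ww(1)[OF i] i i] qq per[OF qq qw(1)[OF i] i i] by (auto simp: h_def)
  qed (use ww qw i in auto)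
  have int: "integrable (lebesgue_on ?Q) (\<lambda>x. w' i x * q x + w i x * q' i x)" if i: "i \<in> Basis" for i
    using ww[OF i] qw[OF i] L2_subset[OF _ QW open_sets_lebesgue[OF o] Qm]
    by (intro Bochner_Integration.integrable_add L2_mult_integrable) auto
  have wQ: "AE x in lebesgue_on ?Q. weak_partial ?Q i u x = w i x" if i: "i \<in> Basis" for i
    by (rule weak_partial_props(2)[OF has_weak_partial_cong_AE[OF has_weak_partial_subset[OF pw(1)[OF i] o oQ QW i] oQ p(3)] oQ i]) simp
  have w'Q: "AE x in lebesgue_on ?Q. weak_partial ?Q i (weak_partial ?Q i u) x = w' i x" if i: "i \<in> Basis" for i
    by (rule weak_partial_props(2)[OF has_weak_partial_cong_AE[OF has_weak_partial_subset[OF ww(1)[OF i] o oQ QW i] oQ] oQ i])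
      (use wQ[OF i] in auto)
  have qQ: "AE x in lebesgue_on ?Q. weak_partial ?Q i v x = q' i x" if i: "i \<in> Basis" for i
    by (rule weak_partial_props(2)[OF has_weak_partial_cong_AE[OF has_weak_partial_subset[OF qw(1)[OF i] o oQ QW i] oQ q(3)] oQ i]) simp
  have "AE x in lebesgue_on ?Q. \<forall>i\<in>Basis. weak_partial ?Q i u x = w i x \<and>
      weak_partial ?Q i (weak_partial ?Q i u) x = w' i x \<and> weak_partial ?Q i v x = q' i x"
    using wQ w'Q qQ by (intro AE_finite_allI finite_Basis) auto
  then have "AE x in lebesgue_on ?Q. weak_laplacian ?Q u x * v x + weak_grad ?Q u x \<bullet> weak_grad ?Q v x
      = (\<Sum>i\<in>Basis. w' i x * q x + w i x * q' i x)"
    using q(3)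
  proof eventually_elim
    case (elim x)
    then show ?case
      by (simp add: inner_weak_grad weak_laplacian_def sum.distrib sum_distrib_right)
  qed
  from integral_lebesgue_on_cong_AE[OF this Qm]
  show ?thesis using int zero by (simp add: Bochner_Integration.integral_sum)
qed

section \<open>Energy stability of the scheme\<close>

text \<open>For scalar functions this is plain square integrability, so that gradients and scalar fields share
  the identities below.\<close>

definition VL2 :: "'a::euclidean_space set \<Rightarrow> ('a \<Rightarrow> 'b::euclidean_space) \<Rightarrow> bool" where
  "VL2 \<Omega> X \<longleftrightarrow> (\<forall>i\<in>Basis. L2 \<Omega> (\<lambda>x. X x \<bullet> i))"

lemma VL2_real: "VL2 \<Omega> (u :: 'a::euclidean_space \<Rightarrow> real) \<longleftrightarrow> L2 \<Omega> u"
  by (simp add: VL2_def)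

lemma VL2_lincomb: "VL2 \<Omega> X \<Longrightarrow> VL2 \<Omega> Y \<Longrightarrow> VL2 \<Omega> (\<lambda>x. a *\<^sub>R X x + b *\<^sub>R Y x)"
  by (simp add: VL2_def inner_add_left L2_lincomb)

lemma VL2_add: "VL2 \<Omega> X \<Longrightarrow> VL2 \<Omega> Y \<Longrightarrow> VL2 \<Omega> (\<lambda>x. X x + Y x)"
  using VL2_lincomb[of \<Omega> X Y 1 1] by simp

lemma VL2_diff: "VL2 \<Omega> X \<Longrightarrow> VL2 \<Omega> Y \<Longrightarrow> VL2 \<Omega> (\<lambda>x. X x - Y x)"
  using VL2_lincomb[of \<Omega> X Y 1 "- 1"] by simp

lemma VL2_scaleR: "VL2 \<Omega> X \<Longrightarrow> VL2 \<Omega> (\<lambda>x. a *\<^sub>R X x)"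
  using VL2_lincomb[of \<Omega> X X a 0] by simp

lemma VL2_sum: "(\<And>i. i \<in> I \<Longrightarrow> VL2 \<Omega> (X i)) \<Longrightarrow> VL2 \<Omega> (\<lambda>x. \<Sum>i\<in>I. X i x)"
  by (simp add: VL2_def inner_sum_left L2_sum)

lemma VL2_inner_integrable:
  assumes "VL2 \<Omega> X" "VL2 \<Omega> Y" shows "integrable (lebesgue_on \<Omega>) (\<lambda>x. X x \<bullet> Y x)"
proof -
  have "integrable (lebesgue_on \<Omega>) (\<lambda>x. \<Sum>i\<in>Basis. (X x \<bullet> i) * (Y x \<bullet> i))"
    using assms by (intro Bochner_Integration.integrable_sum L2_mult_integrable) (auto simp: VL2_def)
  then show ?thesis by (simp add: euclidean_inner[symmetric])
qed

lemma L2norm_power2: "(L2norm \<Omega> X)\<^sup>2 = (\<integral>x. X x \<bullet> X x \<partial>lebesgue_on \<Omega>)"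
  for X :: "'a::euclidean_space \<Rightarrow> 'b::euclidean_space"
  by (simp add: L2norm_def power2_norm_eq_inner)

lemma AE_zero_if_integral_inner_zero:
  assumes "VL2 \<Omega> X" "(\<integral>x. X x \<bullet> X x \<partial>lebesgue_on \<Omega>) = 0"
  shows "AE x in lebesgue_on \<Omega>. X x = 0"
proof -
  have "AE x in lebesgue_on \<Omega>. X x \<bullet> X x = 0"
    using integral_nonneg_eq_0_iff_AE[OF VL2_inner_integrable[OF assms(1,1)]] assms(2) by simp
  then show ?thesis by simp
qed

text \<open>Linear combinations are taken in Green's formula and not in the boundary condition: the extension of
  the normal in the Neumann condition may differ from field to field, so the condition is not evidently
  inherited by sums.\<close>

lemma green_combination:
  fixes F H :: "'i \<Rightarrow> 'a::euclidean_space \<Rightarrow> real" and X Y :: "'i \<Rightarrow> 'a \<Rightarrow> 'a"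
  assumes L2: "\<And>i. i \<in> I \<Longrightarrow> L2 \<Omega> (F i)" "\<And>i. i \<in> I \<Longrightarrow> VL2 \<Omega> (X i)"
      "\<And>j. j \<in> I \<Longrightarrow> L2 \<Omega> (H j)" "\<And>j. j \<in> I \<Longrightarrow> VL2 \<Omega> (Y j)"
    and green: "\<And>i j. i \<in> I \<Longrightarrow> j \<in> I \<Longrightarrow> (\<integral>x. F i x * H j x \<partial>lebesgue_on \<Omega>) = - (\<integral>x. X i x \<bullet> Y j x \<partial>lebesgue_on \<Omega>)"
  shows "(\<integral>x. (\<Sum>i\<in>I. a i * F i x) * (\<Sum>j\<in>I. b j * H j x) \<partial>lebesgue_on \<Omega>)
    = - (\<integral>x. (\<Sum>i\<in>I. a i *\<^sub>R X i x) \<bullet> (\<Sum>j\<in>I. b j *\<^sub>R Y j x) \<partial>lebesgue_on \<Omega>)"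
proof -
  have "(\<integral>x. (\<Sum>i\<in>I. a i * F i x) * (\<Sum>j\<in>I. b j * H j x) \<partial>lebesgue_on \<Omega>)
      = (\<integral>x. (\<Sum>i\<in>I. \<Sum>j\<in>I. (a i * b j) * (F i x * H j x)) \<partial>lebesgue_on \<Omega>)"
    by (simp add: sum_product mult_ac)
  also have "\<dots> = (\<Sum>i\<in>I. \<Sum>j\<in>I. (a i * b j) * (\<integral>x. F i x * H j x \<partial>lebesgue_on \<Omega>))"
    using L2_mult_integrable[OF L2(1,3)] by (simp add: Bochner_Integration.integral_sum)
  also have "\<dots> = (\<Sum>i\<in>I. \<Sum>j\<in>I. - ((a i * b j) * (\<integral>x. X i x \<bullet> Y j x \<partial>lebesgue_on \<Omega>)))"
    by (intro sum.cong refl) (simp add: green)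
  also have "\<dots> = - (\<Sum>i\<in>I. \<Sum>j\<in>I. (a i * b j) * (\<integral>x. X i x \<bullet> Y j x \<partial>lebesgue_on \<Omega>))"
    by (simp add: sum_negf)
  also have "\<dots> = - (\<integral>x. (\<Sum>i\<in>I. \<Sum>j\<in>I. (a i * b j) * (X i x \<bullet> Y j x)) \<partial>lebesgue_on \<Omega>)"
    using VL2_inner_integrable[OF L2(2,4)] by (simp add: Bochner_Integration.integral_sum)
  also have "\<dots> = - (\<integral>x. (\<Sum>i\<in>I. a i *\<^sub>R X i x) \<bullet> (\<Sum>j\<in>I. b j *\<^sub>R Y j x) \<partial>lebesgue_on \<Omega>)"
  proof -
    have "(\<Sum>i\<in>I. a i *\<^sub>R X i x) \<bullet> (\<Sum>j\<in>I. b j *\<^sub>R Y j x) = (\<Sum>i\<in>I. \<Sum>j\<in>I. (a i * b j) * (X i x \<bullet> Y j x))" for x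
      unfolding inner_sum_left unfolding inner_sum_right by (simp add: mult_ac)
    then show ?thesis by simp
  qed
  finally show ?thesis .
qed

text \<open>The backward difference, paired with the newest value, telescopes up to the square of the second
  difference.\<close>

lemma bdf_identity:
  fixes A B C :: "'a::euclidean_space \<Rightarrow> 'b::euclidean_space"
  assumes L2: "VL2 \<Omega> A" "VL2 \<Omega> B" "VL2 \<Omega> C"
  shows "2 * (\<integral>x. A x \<bullet> (3 *\<^sub>R A x - 4 *\<^sub>R B x + C x) \<partial>lebesgue_on \<Omega>)
    = (L2norm \<Omega> A)\<^sup>2 + (L2norm \<Omega> (\<lambda>x. 2 *\<^sub>R A x - B x))\<^sup>2
      - (L2norm \<Omega> B)\<^sup>2 - (L2norm \<Omega> (\<lambda>x. 2 *\<^sub>R B x - C x))\<^sup>2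
      + (L2norm \<Omega> (\<lambda>x. A x - 2 *\<^sub>R B x + C x))\<^sup>2"
proof -
  have pw: "2 * (p \<bullet> (3 *\<^sub>R p - 4 *\<^sub>R q + r)) = p \<bullet> p + (2 *\<^sub>R p - q) \<bullet> (2 *\<^sub>R p - q) - q \<bullet> q
      - (2 *\<^sub>R q - r) \<bullet> (2 *\<^sub>R q - r) + (p - 2 *\<^sub>R q + r) \<bullet> (p - 2 *\<^sub>R q + r)" for p q r :: 'b
    by (simp add: inner_add_left inner_add_right inner_diff_left inner_diff_right inner_commute algebra_simps)
  have "2 * (\<integral>x. A x \<bullet> (3 *\<^sub>R A x - 4 *\<^sub>R B x + C x) \<partial>lebesgue_on \<Omega>)
      = (\<integral>x. 2 * (A x \<bullet> (3 *\<^sub>R A x - 4 *\<^sub>R B x + C x)) \<partial>lebesgue_on \<Omega>)"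
    by simp
  also have "\<dots> = (\<integral>x. A x \<bullet> A x + (2 *\<^sub>R A x - B x) \<bullet> (2 *\<^sub>R A x - B x) - B x \<bullet> B x
      - (2 *\<^sub>R B x - C x) \<bullet> (2 *\<^sub>R B x - C x) + (A x - 2 *\<^sub>R B x + C x) \<bullet> (A x - 2 *\<^sub>R B x + C x) \<partial>lebesgue_on \<Omega>)"
    unfolding pw ..
  also have "\<dots> = (\<integral>x. A x \<bullet> A x \<partial>lebesgue_on \<Omega>) + (\<integral>x. (2 *\<^sub>R A x - B x) \<bullet> (2 *\<^sub>R A x - B x) \<partial>lebesgue_on \<Omega>)
      - (\<integral>x. B x \<bullet> B x \<partial>lebesgue_on \<Omega>) - (\<integral>x. (2 *\<^sub>R B x - C x) \<bullet> (2 *\<^sub>R B x - C x) \<partial>lebesgue_on \<Omega>)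
      + (\<integral>x. (A x - 2 *\<^sub>R B x + C x) \<bullet> (A x - 2 *\<^sub>R B x + C x) \<partial>lebesgue_on \<Omega>)"
  proof -
    have 1: "VL2 \<Omega> (\<lambda>x. 2 *\<^sub>R A x - B x)" "VL2 \<Omega> (\<lambda>x. 2 *\<^sub>R B x - C x)" "VL2 \<Omega> (\<lambda>x. A x - 2 *\<^sub>R B x + C x)"
      by (intro VL2_add VL2_diff VL2_scaleR L2)+
    show ?thesis
      using VL2_inner_integrable[OF L2(1,1)] VL2_inner_integrable[OF L2(2,2)] VL2_inner_integrable[OF 1(1,1)]
        VL2_inner_integrable[OF 1(2,2)] VL2_inner_integrable[OF 1(3,3)]
      by (simp only: Bochner_Integration.integral_add Bochner_Integration.integral_diff
          Bochner_Integration.integrable_add Bochner_Integration.integrable_diff)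
  qed
  finally show ?thesis by (simp only: L2norm_power2)
qed

lemma VL2_weak_grad:
  assumes "H1 \<Omega> u" "open \<Omega>" shows "VL2 \<Omega> (weak_grad \<Omega> u)"
  using H1_weak_partial(2)[OF assms] by (simp add: VL2_def weak_grad_inner_Basis)

lemma L2_weak_laplacian:
  assumes "H2 \<Omega> u" "open \<Omega>" shows "L2 \<Omega> (weak_laplacian \<Omega> u)"
  unfolding weak_laplacian_def[abs_def] using assms by (intro L2_sum H1_weak_partial(2)) (auto simp: H2_def)

lemma weak_grad_sum_zero:
  fixes u :: "3 \<Rightarrow> 'a::euclidean_space \<Rightarrow> real"
  assumes o: "open \<Omega>" and H1: "\<And>i. H1 \<Omega> (u i)" and const: "AE x in lebesgue_on \<Omega>. u 1 x + u 2 x + u 3 x = k"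
  shows "AE x in lebesgue_on \<Omega>. (\<Sum>i\<in>UNIV. weak_grad \<Omega> (u i) x) = 0"
proof -
  have "AE x in lebesgue_on \<Omega>. weak_partial \<Omega> j (u 1) x + weak_partial \<Omega> j (u 2) x + weak_partial \<Omega> j (u 3) x = 0"
    if j: "j \<in> Basis" for j
  proof -
    note w = H1_weak_partial(1)[OF H1 o j]
    have w12: "has_weak_partial \<Omega> j (\<lambda>x. u 1 x + u 2 x) (\<lambda>x. weak_partial \<Omega> j (u 1) x + weak_partial \<Omega> j (u 2) x)"
      using has_weak_partial_lincomb[OF o j w[of 1] w[of 2], of 1 1] by simp
    have w123: "has_weak_partial \<Omega> j (\<lambda>x. u 1 x + u 2 x + u 3 x)
        (\<lambda>x. weak_partial \<Omega> j (u 1) x + weak_partial \<Omega> j (u 2) x + weak_partial \<Omega> j (u 3) x)"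
      using has_weak_partial_lincomb[OF o j w12 w[of 3], of 1 1] by simp
    have c: "has_weak_partial \<Omega> j (\<lambda>x. k) (\<lambda>x. 0)"
      using has_weak_partial_smooth[OF smooth_on_const o j, of k] by simp
    show ?thesis by (rule has_weak_partial_unique[OF w123 c o j const])
  qed
  then have "AE x in lebesgue_on \<Omega>. \<forall>j\<in>Basis. weak_partial \<Omega> j (u 1) x + weak_partial \<Omega> j (u 2) x + weak_partial \<Omega> j (u 3) x = 0"
    by (intro AE_finite_allI finite_Basis)
  then show ?thesis
  proof eventually_elim
    case (elim x)
    show ?case
      by (rule euclidean_eqI) (use elim in \<open>simp add: sum_3 inner_add_left weak_grad_inner_Basis\<close>)
  qed
qed

theorem theorem3p9:
  fixes \<Omega> :: "'a::euclidean_space set"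
    and \<sigma> :: "3 \<Rightarrow> 3 \<Rightarrow> real" and S :: "3 \<Rightarrow> real" and ST S_low :: real
    and \<epsilon> M\<^sub>0 \<Lambda> B \<delta>t :: real
    and c :: "nat \<Rightarrow> 3 \<Rightarrow> 'a \<Rightarrow> real" and \<mu> :: "3 \<Rightarrow> 'a \<Rightarrow> real" and U :: "nat \<Rightarrow> 'a \<Rightarrow> real"
    and n :: nat
  assumes dim: "DIM('a) = 2 \<or> DIM('a) = 3"
    and params: "\<epsilon> > 0" "M\<^sub>0 > 0" "\<Lambda> \<ge> 0" "\<delta>t > 0"
    and tension_pos: "\<And>i j. i \<noteq> j \<Longrightarrow> \<sigma> i j > 0"
    and tension_sym: "\<And>i j. \<sigma> i j = \<sigma> j i"
    and S_eq: "\<And>i j k. {i, j, k} = UNIV \<Longrightarrow> S i = \<sigma> i j + \<sigma> i k - \<sigma> j k"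
    and S_nonzero: "\<And>i. S i \<noteq> 0"
    and S_inv_sum: "1 / S 1 + 1 / S 2 + 1 / S 3 \<noteq> 0"
    and ST_eq: "3 / ST = 1 / S 1 + 1 / S 2 + 1 / S 3"
    and S_prod_sum: "S 1 * S 2 + S 1 * S 3 + S 2 * S 3 > 0"
    and S_pair_sum: "\<And>i j. i \<noteq> j \<Longrightarrow> S i + S j > 0"
    and S_low_pos: "S_low > 0"
    and S_low: "\<And>\<xi> :: 3 \<Rightarrow> 'a. \<xi> 1 + \<xi> 2 + \<xi> 3 = 0 \<Longrightarrow>
          (\<Sum>i\<in>UNIV. S i * (norm (\<xi> i))\<^sup>2) \<ge> S_low * (\<Sum>i\<in>UNIV. (norm (\<xi> i))\<^sup>2)"
    and B: "\<And>p :: 3 \<Rightarrow> real. p 1 + p 2 + p 3 = 1 \<Longrightarrow> F_pot S \<Lambda> p + B > 0"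
    and n: "n \<ge> 1"
    and c_reg: "\<And>m i. m \<in> {n - 1, n, n + 1} \<Longrightarrow> H2 \<Omega> (c m i)"
    and mu_reg: "\<And>i. H2 \<Omega> (\<mu> i)"
    and U_reg: "\<And>m. m \<in> {n - 1, n, n + 1} \<Longrightarrow> L2 \<Omega> (U m)"
    and boundary:
      "(\<exists>a b. (\<forall>i\<in>Basis. a \<bullet> i < b \<bullet> i) \<and> \<Omega> = box a b \<and>
          (\<forall>m\<in>{n - 1, n, n + 1}. \<forall>i. H2_periodic a b (c m i)) \<and> (\<forall>i. H2_periodic a b (\<mu> i)))
       \<or> (smooth_bounded_domain \<Omega> \<and>
          (\<forall>m\<in>{n - 1, n, n + 1}. \<forall>i. normal_derivative_zero \<Omega> (c m i)) \<and>
          (\<forall>i. normal_derivative_zero \<Omega> (\<mu> i)))"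
    and c_sum: "\<And>m. m \<in> {n - 1, n} \<Longrightarrow> AE x in lebesgue_on \<Omega>. c m 1 x + c m 2 x + c m 3 x = 1"
    and scheme_c: "\<And>i. AE x in lebesgue_on \<Omega>.
          (3 * c (n + 1) i x - 4 * c n i x + c (n - 1) i x) / (2 * \<delta>t)
            = M\<^sub>0 / S i * weak_laplacian \<Omega> (\<mu> i) x"
    and scheme_mu: "\<And>i. AE x in lebesgue_on \<Omega>.
          \<mu> i x = - (3 / 4) * \<epsilon> * S i * weak_laplacian \<Omega> (c (n + 1) i) x
            + 24 / \<epsilon> * H_dagger S \<Lambda> B c n i x * U (n + 1) x
            + beta_next \<epsilon> S ST \<Lambda> B c U n x"
    and scheme_U: "AE x in lebesgue_on \<Omega>.
          3 * U (n + 1) x - 4 * U n x + U (n - 1) x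
            = (\<Sum>i\<in>UNIV. H_dagger S \<Lambda> B c n i x
                 * (3 * c (n + 1) i x - 4 * c n i x + c (n - 1) i x))"
  shows "1 / \<delta>t * (E_bdf \<Omega> \<epsilon> S B c U (n + 1) - E_bdf \<Omega> \<epsilon> S B c U n)
           \<le> - M\<^sub>0 * (\<Sum>i\<in>UNIV. 1 / S i * (L2norm \<Omega> (weak_grad \<Omega> (\<mu> i)))\<^sup>2)
       \<and> - M\<^sub>0 * (\<Sum>i\<in>UNIV. 1 / S i * (L2norm \<Omega> (weak_grad \<Omega> (\<mu> i)))\<^sup>2)
           \<le> - M\<^sub>0 * S_low * (\<Sum>i\<in>UNIV. (L2norm \<Omega> (weak_grad \<Omega> (\<mu> i)))\<^sup>2 / (S i)\<^sup>2)"
proof -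
  let ?M = "lebesgue_on \<Omega>"
  have o: "open \<Omega>" using boundary by (auto simp: smooth_bounded_domain_def open_box)
  then have om: "\<Omega> \<in> sets lebesgue" by auto
  have H1: "H1 \<Omega> u" if "H2 \<Omega> u" for u using that by (simp add: H2_def)
  define levels where "levels = {n - 1, n, n + 1}"
  define fields where "fields = {c m i | m i. m \<in> levels} \<union> range \<mu>"
  have H2: "H2 \<Omega> p" if "p \<in> fields" for p
    using that c_reg mu_reg by (auto simp: fields_def levels_def)
  have L2: "L2 \<Omega> p" if "p \<in> fields" for p using H1[OF H2[OF that]] by (simp add: H1_def)
  note grad = VL2_weak_grad[OF H1[OF H2] o] and lap = L2_weak_laplacian[OF H2 o]
  have green: "(\<integral>x. weak_laplacian \<Omega> p x * q x \<partial>?M) = - (\<integral>x. weak_grad \<Omega> p x \<bullet> weak_grad \<Omega> q x \<partial>?M)"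
    if p: "p \<in> fields" and q: "q \<in> fields" for p q
  proof -
    have "(\<integral>x. weak_laplacian \<Omega> p x * q x + weak_grad \<Omega> p x \<bullet> weak_grad \<Omega> q x \<partial>?M) = 0"
      using boundary
    proof
      assume "\<exists>a b. (\<forall>i\<in>Basis. a \<bullet> i < b \<bullet> i) \<and> \<Omega> = box a b \<and>
          (\<forall>m\<in>{n - 1, n, n + 1}. \<forall>i. H2_periodic a b (c m i)) \<and> (\<forall>i. H2_periodic a b (\<mu> i))"
      then obtain a b where ab: "\<And>i. i \<in> Basis \<Longrightarrow> a \<bullet> i < b \<bullet> i" "\<Omega> = box a b"
        and per: "\<forall>m\<in>levels. \<forall>i. H2_periodic a b (c m i)" "\<forall>i. H2_periodic a b (\<mu> i)"
        unfolding levels_def by blast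
      have "H2_periodic a b p" "H2_periodic a b q" using p q per by (auto simp: fields_def)
      then show ?thesis unfolding ab(2) by (intro green_periodic ab(1))
    next
      assume A: "smooth_bounded_domain \<Omega> \<and>
          (\<forall>m\<in>{n - 1, n, n + 1}. \<forall>i. normal_derivative_zero \<Omega> (c m i)) \<and>
          (\<forall>i. normal_derivative_zero \<Omega> (\<mu> i))"
      then have "normal_derivative_zero \<Omega> p" using p by (auto simp: fields_def levels_def)
      then show ?thesis using A by (intro green_neumann H2[OF p] H1[OF H2[OF q]]) auto
    qed
    then show ?thesis
      using L2_mult_integrable[OF lap[OF p] L2[OF q]] VL2_inner_integrable[OF grad[OF p] grad[OF q]] by simp
  qed
  have fc: "c m i \<in> fields" if "m \<in> levels" for m i using that by (auto simp: fields_def)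
  have f\<mu>: "\<mu> i \<in> fields" for i by (simp add: fields_def)
  have lev: "n - 1 \<in> levels" "n \<in> levels" "n + 1 \<in> levels" by (auto simp: levels_def)
  define g where "g m i = weak_grad \<Omega> (c m i)" for m i
  define g\<mu> where "g\<mu> i = weak_grad \<Omega> (\<mu> i)" for i
  define D where "D i x = 3 * c (n + 1) i x - 4 * c n i x + c (n - 1) i x" for i x
  define gD where "gD i x = 3 *\<^sub>R g (n + 1) i x - 4 *\<^sub>R g n i x + g (n - 1) i x" for i x
  have gL: "VL2 \<Omega> (g m i)" if "m \<in> levels" for m i unfolding g_def by (rule grad[OF fc[OF that]])
  have g\<mu>L: "VL2 \<Omega> (g\<mu> i)" for i unfolding g\<mu>_def by (rule grad[OF f\<mu>])
  have DL: "L2 \<Omega> (D i)" for i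
    unfolding D_def by (intro L2_add L2_diff L2_cmult L2 fc lev)
  have gDL: "VL2 \<Omega> (gD i)" for i
    unfolding gD_def by (intro VL2_add VL2_diff VL2_scaleR gL lev)
  have greenD: "(\<integral>x. weak_laplacian \<Omega> p x * D i x \<partial>?M) = - (\<integral>x. weak_grad \<Omega> p x \<bullet> gD i x \<partial>?M)"
    if p: "p \<in> fields" for p i
  proof -
    have l: "(\<lambda>x. weak_laplacian \<Omega> p x * D i x) = (\<lambda>x. 3 * (weak_laplacian \<Omega> p x * c (n + 1) i x)
        - 4 * (weak_laplacian \<Omega> p x * c n i x) + weak_laplacian \<Omega> p x * c (n - 1) i x)"
      by (simp add: D_def algebra_simps)
    have r: "(\<lambda>x. weak_grad \<Omega> p x \<bullet> gD i x) = (\<lambda>x. 3 * (weak_grad \<Omega> p x \<bullet> g (n + 1) i x)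
        - 4 * (weak_grad \<Omega> p x \<bullet> g n i x) + weak_grad \<Omega> p x \<bullet> g (n - 1) i x)"
      by (simp add: gD_def inner_add_right inner_diff_right)
    have li: "integrable ?M (\<lambda>x. weak_laplacian \<Omega> p x * c m i x)" if "m \<in> levels" for m
      by (rule L2_mult_integrable[OF lap[OF p] L2[OF fc[OF that]]])
    have ri: "integrable ?M (\<lambda>x. weak_grad \<Omega> p x \<bullet> g m i x)" if "m \<in> levels" for m
      by (rule VL2_inner_integrable[OF grad[OF p] gL[OF that]])
    show ?thesis
      unfolding l r using li[OF lev(1)] li[OF lev(2)] li[OF lev(3)] ri[OF lev(1)] ri[OF lev(2)] ri[OF lev(3)]
        green[OF p fc[OF lev(1), of i]] green[OF p fc[OF lev(2), of i]] green[OF p fc[OF lev(3), of i]]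
      by (simp add: g_def)
  qed
  have S0: "S i \<noteq> 0" for i by (rule S_nonzero)
  have ST0: "ST \<noteq> 0" using ST_eq S_inv_sum by auto
  have schemeD: "AE x in ?M. \<forall>i. D i x = (2 * \<delta>t * M\<^sub>0) * (weak_laplacian \<Omega> (\<mu> i) x / S i)"
  proof -
    have "AE x in ?M. \<forall>i\<in>UNIV. D i x / (2 * \<delta>t) = M\<^sub>0 / S i * weak_laplacian \<Omega> (\<mu> i) x"
      using scheme_c by (intro AE_finite_allI) (auto simp: D_def)
    then show ?thesis
    proof eventually_elim
      case (elim x)
      then have "D i x / (2 * \<delta>t) = M\<^sub>0 / S i * weak_laplacian \<Omega> (\<mu> i) x" for i by simp
      then show ?case using params(4) by (simp add: field_simps)
    qed
  qed
  have schemeMu: "AE x in ?M. \<forall>i\<in>UNIV. \<mu> i x = - (3 / 4) * \<epsilon> * S i * weak_laplacian \<Omega> (c (n + 1) i) x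
            + 24 / \<epsilon> * H_dagger S \<Lambda> B c n i x * U (n + 1) x + beta_next \<epsilon> S ST \<Lambda> B c U n x"
    using scheme_mu by (intro AE_finite_allI) auto

  \<comment> \<open>Conservation of the constraint. The quantities for the sum over the phases carry the factor 1 to match
      \<open>green_combination\<close>.\<close>
  define SD where "SD x = (\<Sum>i\<in>UNIV. 1 * D i x)" for x
  define gSD where "gSD x = (\<Sum>i\<in>UNIV. 1 *\<^sub>R gD i x)" for x
  define gs where "gs x = (\<Sum>i\<in>UNIV. 1 *\<^sub>R g (n + 1) i x)" for x
  define laps where "laps x = (\<Sum>i\<in>UNIV. 1 * weak_laplacian \<Omega> (c (n + 1) i) x)" for x
  define \<Theta> where "\<Theta> x = (\<Sum>i\<in>UNIV. (1 / S i) * \<mu> i x)" for x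
  define g\<Theta> where "g\<Theta> x = (\<Sum>i\<in>UNIV. (1 / S i) *\<^sub>R g\<mu> i x)" for x
  define lap\<Theta> where "lap\<Theta> x = (\<Sum>i\<in>UNIV. (1 / S i) * weak_laplacian \<Omega> (\<mu> i) x)" for x
  have VL: "VL2 \<Omega> gSD" "VL2 \<Omega> gs" "VL2 \<Omega> g\<Theta>" "VL2 \<Omega> SD"
    unfolding gSD_def gs_def g\<Theta>_def SD_def VL2_real
    by (intro VL2_sum VL2_scaleR gDL gL g\<mu>L lev L2_sum L2_cmult DL)+
  have green1: "(\<integral>x. lap\<Theta> x * \<Theta> x \<partial>?M) = - (\<integral>x. g\<Theta> x \<bullet> g\<Theta> x \<partial>?M)"
    unfolding lap\<Theta>_def \<Theta>_def g\<Theta>_def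
    by (rule green_combination) (auto intro: lap f\<mu> g\<mu>L L2 simp: green[OF f\<mu> f\<mu>, folded g\<mu>_def])
  have green2: "(\<integral>x. laps x * SD x \<partial>?M) = - (\<integral>x. gs x \<bullet> gSD x \<partial>?M)"
    unfolding laps_def SD_def gs_def gSD_def
    by (rule green_combination) (rule lap[OF fc[OF lev(3)]] gL[OF lev(3)] DL gDL greenD[OF fc[OF lev(3)], folded g_def])+
  have green3: "(\<integral>x. lap\<Theta> x * SD x \<partial>?M) = - (\<integral>x. g\<Theta> x \<bullet> gSD x \<partial>?M)"
    unfolding lap\<Theta>_def SD_def g\<Theta>_def gSD_def
    by (rule green_combination) (auto intro: lap f\<mu> g\<mu>L DL gDL simp: greenD[OF f\<mu>, folded g\<mu>_def])
  have SD_eq: "AE x in ?M. SD x = (2 * \<delta>t * M\<^sub>0) * lap\<Theta> x"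
    using schemeD by eventually_elim (simp add: SD_def lap\<Theta>_def sum_distrib_left)
  have \<Theta>_eq: "AE x in ?M. \<Theta> x = - (3 / 4) * \<epsilon> * laps x"
    using schemeMu
  proof eventually_elim
    case (elim x)
    define l where "l i = weak_laplacian \<Omega> (c (n + 1) i) x" for i
    define e where "e i = H_dagger S \<Lambda> B c n i x" for i
    define \<beta> where "\<beta> = beta_next \<epsilon> S ST \<Lambda> B c U n x"
    have "\<Theta> x = (\<Sum>i\<in>UNIV. - (3 / 4) * \<epsilon> * l i + 24 / \<epsilon> * U (n + 1) x * (e i / S i) + \<beta> * (1 / S i))"
      unfolding \<Theta>_def
    proof (intro sum.cong refl)
      fix i
      have "\<mu> i x = - (3 / 4) * \<epsilon> * S i * l i + 24 / \<epsilon> * e i * U (n + 1) x + \<beta>"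
        using elim by (simp add: l_def e_def \<beta>_def)
      then show "1 / S i * \<mu> i x = - (3 / 4) * \<epsilon> * l i + 24 / \<epsilon> * U (n + 1) x * (e i / S i) + \<beta> * (1 / S i)"
        using S0[of i] by (simp add: field_simps)
    qed
    also have "\<dots> = - (3 / 4) * \<epsilon> * (\<Sum>i\<in>UNIV. l i) + 24 / \<epsilon> * U (n + 1) x * (\<Sum>i\<in>UNIV. e i / S i) + \<beta> * (\<Sum>i\<in>UNIV. 1 / S i)"
      by (simp only: sum.distrib sum_distrib_left)
    also have "(\<Sum>i\<in>UNIV. 1 / S i) = 3 / ST" by (simp add: sum_3 ST_eq)
    also have "\<beta> * (3 / ST) = - (24 / \<epsilon> * U (n + 1) x * (\<Sum>i\<in>UNIV. e i / S i))"
      using ST0 by (simp add: \<beta>_def beta_next_def e_def)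
    finally show ?case by (simp add: laps_def l_def)
  qed
  have const: "AE x in ?M. (\<Sum>i\<in>UNIV. g m i x) = 0" if "m \<in> {n - 1, n}" for m
    unfolding g_def using that lev
    by (intro weak_grad_sum_zero[OF o _ c_sum] H1 H2 fc) auto
  have gSD_eq: "AE x in ?M. gSD x = 3 *\<^sub>R gs x"
    using const[of n, simplified] const[of "n - 1", simplified]
    by eventually_elim (simp add: gSD_def gD_def gs_def sum.distrib sum_subtractf scaleR_sum_right[symmetric])
  have "(\<integral>x. SD x * \<Theta> x \<partial>?M) = (\<integral>x. (2 * \<delta>t * M\<^sub>0) * (lap\<Theta> x * \<Theta> x) \<partial>?M)"
    by (rule integral_lebesgue_on_cong_AE[OF _ om]) (use SD_eq in \<open>eventually_elim, simp\<close>)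
  then have 1: "(\<integral>x. SD x * \<Theta> x \<partial>?M) = - (2 * \<delta>t * M\<^sub>0) * (\<integral>x. g\<Theta> x \<bullet> g\<Theta> x \<partial>?M)"
    using green1 by simp
  have "(\<integral>x. SD x * \<Theta> x \<partial>?M) = (\<integral>x. (- (3 / 4) * \<epsilon>) * (laps x * SD x) \<partial>?M)"
    by (rule integral_lebesgue_on_cong_AE[OF _ om]) (use \<Theta>_eq in \<open>eventually_elim, simp\<close>)
  also have "\<dots> = (3 / 4 * \<epsilon>) * (\<integral>x. gs x \<bullet> gSD x \<partial>?M)"
    using green2 by simp
  also have "(\<integral>x. gs x \<bullet> gSD x \<partial>?M) = (\<integral>x. 3 * (gs x \<bullet> gs x) \<partial>?M)"
    by (rule integral_lebesgue_on_cong_AE[OF _ om]) (use gSD_eq in \<open>eventually_elim, simp\<close>)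
  finally have 2: "(\<integral>x. SD x * \<Theta> x \<partial>?M) = (9 / 4 * \<epsilon>) * (\<integral>x. gs x \<bullet> gs x \<partial>?M)" by simp
  have nn: "(\<integral>x. g\<Theta> x \<bullet> g\<Theta> x \<partial>?M) \<ge> 0" "(\<integral>x. gs x \<bullet> gs x \<partial>?M) \<ge> 0" by simp_all
  have pos: "2 * \<delta>t * M\<^sub>0 > 0" "9 / 4 * \<epsilon> > 0" using params by auto
  have z: "(\<integral>x. g\<Theta> x \<bullet> g\<Theta> x \<partial>?M) = 0 \<and> (\<integral>x. gs x \<bullet> gs x \<partial>?M) = 0"
  proof -
    have "(2 * \<delta>t * M\<^sub>0) * (\<integral>x. g\<Theta> x \<bullet> g\<Theta> x \<partial>?M) + (9 / 4 * \<epsilon>) * (\<integral>x. gs x \<bullet> gs x \<partial>?M) = 0"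
      using 1 2 by simp
    moreover have "(2 * \<delta>t * M\<^sub>0) * (\<integral>x. g\<Theta> x \<bullet> g\<Theta> x \<partial>?M) \<ge> 0" "(9 / 4 * \<epsilon>) * (\<integral>x. gs x \<bullet> gs x \<partial>?M) \<ge> 0"
      by (rule mult_nonneg_nonneg[OF less_imp_le[OF pos(1)] nn(1)])
        (rule mult_nonneg_nonneg[OF less_imp_le[OF pos(2)] nn(2)])
    ultimately have "(2 * \<delta>t * M\<^sub>0) * (\<integral>x. g\<Theta> x \<bullet> g\<Theta> x \<partial>?M) = 0" "(9 / 4 * \<epsilon>) * (\<integral>x. gs x \<bullet> gs x \<partial>?M) = 0"
      by linarith+
    then show ?thesis using pos by (metis less_irrefl mult_eq_0_iff)
  qed
  have g\<Theta>0: "AE x in ?M. g\<Theta> x = 0" and gs0: "AE x in ?M. gs x = 0"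
    using AE_zero_if_integral_inner_zero[OF VL(3)] AE_zero_if_integral_inner_zero[OF VL(2)] z by blast+
  have "(\<integral>x. SD x \<bullet> SD x \<partial>?M) = (\<integral>x. (2 * \<delta>t * M\<^sub>0) * (lap\<Theta> x * SD x) \<partial>?M)"
    by (rule integral_lebesgue_on_cong_AE[OF _ om]) (use SD_eq in \<open>eventually_elim, simp\<close>)
  also have "\<dots> = - (2 * \<delta>t * M\<^sub>0) * (\<integral>x. g\<Theta> x \<bullet> gSD x \<partial>?M)" using green3 by simp
  also have "(\<integral>x. g\<Theta> x \<bullet> gSD x \<partial>?M) = (\<integral>x. 0 \<partial>?M)"
    by (rule integral_lebesgue_on_cong_AE[OF _ om]) (use g\<Theta>0 in \<open>eventually_elim, simp\<close>)
  finally have SD0: "AE x in ?M. SD x = 0"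
    by (intro AE_zero_if_integral_inner_zero[OF VL(4)]) simp

  \<comment> \<open>The products of \<open>H\<close>, \<open>U\<close> and \<open>D\<close> are not known to be integrable one by one, so the balance is
      established pointwise before it is integrated.\<close>
  define W where "W x = 3 * U (n + 1) x - 4 * U n x + U (n - 1) x" for x
  have UL: "L2 \<Omega> (U m)" if "m \<in> levels" for m using U_reg that by (simp add: levels_def)
  have WL: "L2 \<Omega> W" unfolding W_def by (intro L2_add L2_diff L2_cmult UL lev)
  define l where "l i = weak_laplacian \<Omega> (c (n + 1) i)" for i
  have lL: "L2 \<Omega> (l i)" for i unfolding l_def by (rule lap[OF fc[OF lev(3)]])
  have balance: "AE x in ?M. (\<Sum>i\<in>UNIV. D i x * \<mu> i x)
      = (\<Sum>i\<in>UNIV. (- (3 / 4) * \<epsilon> * S i) * (l i x * D i x)) + (24 / \<epsilon>) * (U (n + 1) x * W x)"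
    using schemeMu SD0 scheme_U
  proof eventually_elim
    case (elim x)
    define e where "e i = H_dagger S \<Lambda> B c n i x" for i
    define \<beta> where "\<beta> = beta_next \<epsilon> S ST \<Lambda> B c U n x"
    have "(\<Sum>i\<in>UNIV. D i x * \<mu> i x)
        = (\<Sum>i\<in>UNIV. (- (3 / 4) * \<epsilon> * S i) * (l i x * D i x) + (24 / \<epsilon> * U (n + 1) x) * (e i * D i x) + \<beta> * D i x)"
    proof (intro sum.cong refl)
      fix i
      have mu: "\<mu> i x = - (3 / 4) * \<epsilon> * S i * l i x + 24 / \<epsilon> * e i * U (n + 1) x + \<beta>"
        using elim(1) by (simp add: l_def e_def \<beta>_def)
      show "D i x * \<mu> i x = (- (3 / 4) * \<epsilon> * S i) * (l i x * D i x) + (24 / \<epsilon> * U (n + 1) x) * (e i * D i x) + \<beta> * D i x"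
        unfolding mu by (simp add: algebra_simps)
    qed
    also have "\<dots> = (\<Sum>i\<in>UNIV. (- (3 / 4) * \<epsilon> * S i) * (l i x * D i x))
        + (24 / \<epsilon> * U (n + 1) x) * (\<Sum>i\<in>UNIV. e i * D i x) + \<beta> * (\<Sum>i\<in>UNIV. D i x)"
      by (simp only: sum.distrib sum_distrib_left)
    also have "(\<Sum>i\<in>UNIV. D i x) = 0" using elim(2) by (simp add: SD_def)
    also have "(\<Sum>i\<in>UNIV. e i * D i x) = W x" using elim(3) by (simp add: e_def D_def W_def)
    finally show ?case by (simp add: mult.assoc)
  qed
  define m where "m i = (L2norm \<Omega> (weak_grad \<Omega> (\<mu> i)))\<^sup>2" for i
  define \<xi> where "\<xi> i x = g (n + 1) i x - 2 *\<^sub>R g n i x + g (n - 1) i x" for i x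
  define eg where "eg k i = (L2norm \<Omega> (g k i))\<^sup>2 + (L2norm \<Omega> (\<lambda>x. 2 *\<^sub>R g k i x - g (k - 1) i x))\<^sup>2" for k i
  define eU where "eU k = (L2norm \<Omega> (U k))\<^sup>2 + (L2norm \<Omega> (\<lambda>x. 2 * U k x - U (k - 1) x))\<^sup>2" for k
  define rU where "rU = (L2norm \<Omega> (\<lambda>x. U (n + 1) x - 2 * U n x + U (n - 1) x))\<^sup>2"
  have left: "(\<integral>x. D i x * \<mu> i x \<partial>?M) = - (2 * \<delta>t * M\<^sub>0) * (m i / S i)" for i
  proof -
    have "(\<integral>x. D i x * \<mu> i x \<partial>?M) = (\<integral>x. (2 * \<delta>t * M\<^sub>0 / S i) * (weak_laplacian \<Omega> (\<mu> i) x * \<mu> i x) \<partial>?M)"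
      by (rule integral_lebesgue_on_cong_AE[OF _ om]) (use schemeD in \<open>eventually_elim, simp\<close>)
    then show ?thesis using green[OF f\<mu> f\<mu>, of i i] by (simp add: m_def L2norm_power2)
  qed
  have right1: "2 * (\<integral>x. l i x * D i x \<partial>?M) = - (eg (n + 1) i - eg n i + (L2norm \<Omega> (\<xi> i))\<^sup>2)" for i
    using bdf_identity[OF gL[OF lev(3)] gL[OF lev(2)] gL[OF lev(1)], of i i i] greenD[OF fc[OF lev(3), of i], of i]
    by (simp add: l_def eg_def \<xi>_def[abs_def] gD_def g_def[symmetric])
  have right2: "2 * (\<integral>x. U (n + 1) x * W x \<partial>?M) = eU (n + 1) - eU n + rU"
    using bdf_identity[of \<Omega> "U (n + 1)" "U n" "U (n - 1)"] UL lev
    by (simp add: VL2_real W_def eU_def rU_def)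
  have D\<mu>: "integrable ?M (\<lambda>x. D i x * \<mu> i x)" for i by (rule L2_mult_integrable[OF DL L2[OF f\<mu>]])
  have lD: "integrable ?M (\<lambda>x. l i x * D i x)" for i by (rule L2_mult_integrable[OF lL DL])
  have UW: "integrable ?M (\<lambda>x. U (n + 1) x * W x)" by (rule L2_mult_integrable[OF UL[OF lev(3)] WL])
  have "(\<Sum>i\<in>UNIV. - (2 * \<delta>t * M\<^sub>0) * (m i / S i)) = (\<integral>x. (\<Sum>i\<in>UNIV. D i x * \<mu> i x) \<partial>?M)"
    using D\<mu> by (simp add: Bochner_Integration.integral_sum left)
  also have "\<dots> = (\<integral>x. (\<Sum>i\<in>UNIV. (- (3 / 4) * \<epsilon> * S i) * (l i x * D i x)) + (24 / \<epsilon>) * (U (n + 1) x * W x) \<partial>?M)"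
    by (rule integral_lebesgue_on_cong_AE[OF balance om])
  also have "\<dots> = (\<Sum>i\<in>UNIV. (- (3 / 4) * \<epsilon> * S i) * (\<integral>x. l i x * D i x \<partial>?M)) + (24 / \<epsilon>) * (\<integral>x. U (n + 1) x * W x \<partial>?M)"
    using lD UW by (simp add: Bochner_Integration.integral_sum Bochner_Integration.integrable_sum)
  also have "(\<lambda>i. (- (3 / 4) * \<epsilon> * S i) * (\<integral>x. l i x * D i x \<partial>?M))
      = (\<lambda>i. (3 / 8 * \<epsilon> * S i) * (eg (n + 1) i - eg n i + (L2norm \<Omega> (\<xi> i))\<^sup>2))"
  proof
    fix i
    have "(- (3 / 4) * \<epsilon> * S i) * (\<integral>x. l i x * D i x \<partial>?M) = - (3 / 8 * \<epsilon> * S i) * (2 * (\<integral>x. l i x * D i x \<partial>?M))" by simp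
    also have "\<dots> = - (3 / 8 * \<epsilon> * S i) * - (eg (n + 1) i - eg n i + (L2norm \<Omega> (\<xi> i))\<^sup>2)"
      by (simp only: right1)
    finally show "(- (3 / 4) * \<epsilon> * S i) * (\<integral>x. l i x * D i x \<partial>?M)
        = (3 / 8 * \<epsilon> * S i) * (eg (n + 1) i - eg n i + (L2norm \<Omega> (\<xi> i))\<^sup>2)"
      by (simp only: mult_minus_left mult_minus_right minus_minus)
  qed
  also have "(24 / \<epsilon>) * (\<integral>x. U (n + 1) x * W x \<partial>?M) = (12 / \<epsilon>) * (2 * (\<integral>x. U (n + 1) x * W x \<partial>?M))" by simp
  also note right2
  finally have total: "(\<Sum>i\<in>UNIV. - (2 * \<delta>t * M\<^sub>0) * (m i / S i))
      = (\<Sum>i\<in>UNIV. (3 / 8 * \<epsilon> * S i) * (eg (n + 1) i - eg n i + (L2norm \<Omega> (\<xi> i))\<^sup>2)) + (12 / \<epsilon>) * (eU (n + 1) - eU n + rU)" .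
  have coercive: "S_low * (\<Sum>i\<in>UNIV. (L2norm \<Omega> (X i))\<^sup>2) \<le> (\<Sum>i\<in>UNIV. S i * (L2norm \<Omega> (X i))\<^sup>2)"
    if X: "\<And>i. VL2 \<Omega> (X i)" and X0: "AE x in ?M. (\<Sum>i\<in>UNIV. X i x) = 0" for X :: "3 \<Rightarrow> 'a \<Rightarrow> 'a"
  proof -
    note int = VL2_inner_integrable[OF X X]
    have "(\<integral>x. S_low * (\<Sum>i\<in>UNIV. X i x \<bullet> X i x) \<partial>?M) \<le> (\<integral>x. (\<Sum>i\<in>UNIV. S i * (X i x \<bullet> X i x)) \<partial>?M)"
    proof (rule integral_mono_AE)
      show "AE x in ?M. S_low * (\<Sum>i\<in>UNIV. X i x \<bullet> X i x) \<le> (\<Sum>i\<in>UNIV. S i * (X i x \<bullet> X i x))"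
        using X0
      proof eventually_elim
        case (elim x)
        then have "X 1 x + X 2 x + X 3 x = 0" by (simp add: sum_3)
        from S_low[of "\<lambda>i. X i x", OF this] show ?case by (simp add: power2_norm_eq_inner)
      qed
    qed (use int in \<open>auto intro!: Bochner_Integration.integrable_sum integrable_mult_right\<close>)
    then show ?thesis
      using int by (simp add: L2norm_power2 Bochner_Integration.integral_sum Bochner_Integration.integrable_sum)
  qed
  have \<xi>L: "VL2 \<Omega> (\<xi> i)" for i unfolding \<xi>_def by (intro VL2_add VL2_diff VL2_scaleR gL lev)
  have \<xi>0: "AE x in ?M. (\<Sum>i\<in>UNIV. \<xi> i x) = 0"
    using gs0 const[of n, simplified] const[of "n - 1", simplified]
    by eventually_elim (simp add: \<xi>_def gs_def sum.distrib sum_subtractf scaleR_sum_right[symmetric])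
  have r\<xi>: "(\<Sum>i\<in>UNIV. S i * (L2norm \<Omega> (\<xi> i))\<^sup>2) \<ge> 0"
  proof -
    have "0 \<le> S_low * (\<Sum>i\<in>UNIV. (L2norm \<Omega> (\<xi> i))\<^sup>2)"
      using S_low_pos by (simp add: sum_nonneg)
    then show ?thesis using coercive[OF \<xi>L \<xi>0] by (rule order_trans)
  qed
  have Ediff: "E_bdf \<Omega> \<epsilon> S B c U (n + 1) - E_bdf \<Omega> \<epsilon> S B c U n
      = (\<Sum>i\<in>UNIV. 3 / 16 * \<epsilon> * S i * (eg (n + 1) i - eg n i)) + 6 / \<epsilon> * (eU (n + 1) - eU n)"
  proof -
    have "E_bdf \<Omega> \<epsilon> S B c U k = (\<Sum>i\<in>UNIV. 3 / 16 * \<epsilon> * S i * eg k i) + 6 / \<epsilon> * eU k - 12 / \<epsilon> * B * measure lebesgue \<Omega>" for k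
    proof -
      have half: "3 / 8 * q * \<epsilon> * (r / 2 + s / 2) = 3 / 16 * \<epsilon> * q * (r + s)" for q r s :: real
        by (simp add: algebra_simps)
      have half': "12 / \<epsilon> * (r / 2 + s / 2) = 6 / \<epsilon> * (r + s)" for r s :: real
        by (simp add: add_divide_distrib)
      show ?thesis unfolding E_bdf_def eg_def eU_def g_def half half' ..
    qed
    then show ?thesis by (simp add: right_diff_distrib sum_subtractf)
  qed
  have "2 * (E_bdf \<Omega> \<epsilon> S B c U (n + 1) - E_bdf \<Omega> \<epsilon> S B c U n)
      = (\<Sum>i\<in>UNIV. - (2 * \<delta>t * M\<^sub>0) * (m i / S i)) - 3 / 8 * \<epsilon> * (\<Sum>i\<in>UNIV. S i * (L2norm \<Omega> (\<xi> i))\<^sup>2) - 12 / \<epsilon> * rU"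
    unfolding total Ediff by (simp add: sum_3 algebra_simps add_divide_distrib diff_divide_distrib)
  also have "\<dots> \<le> (\<Sum>i\<in>UNIV. - (2 * \<delta>t * M\<^sub>0) * (m i / S i))"
  proof -
    have "3 / 8 * \<epsilon> * (\<Sum>i\<in>UNIV. S i * (L2norm \<Omega> (\<xi> i))\<^sup>2) \<ge> 0" using r\<xi> params(1) by simp
    moreover have "12 / \<epsilon> * rU \<ge> 0" using params(1) by (simp add: rU_def)
    ultimately show ?thesis by linarith
  qed
  also have "\<dots> = 2 * \<delta>t * (- M\<^sub>0 * (\<Sum>i\<in>UNIV. 1 / S i * m i))"
    by (simp add: sum_3 algebra_simps)
  finally have first: "1 / \<delta>t * (E_bdf \<Omega> \<epsilon> S B c U (n + 1) - E_bdf \<Omega> \<epsilon> S B c U n) \<le> - M\<^sub>0 * (\<Sum>i\<in>UNIV. 1 / S i * m i)"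
    using params(4) by (simp add: field_simps)
  have "S_low * (\<Sum>i\<in>UNIV. m i / (S i)\<^sup>2) \<le> (\<Sum>i\<in>UNIV. 1 / S i * m i)"
  proof -
    have scale: "(L2norm \<Omega> (\<lambda>x. (1 / S i) *\<^sub>R g\<mu> i x))\<^sup>2 = m i / (S i)\<^sup>2" for i
      unfolding m_def g\<mu>_def L2norm_power2 by (simp add: power2_eq_square)
    have "S i * (m i / (S i)\<^sup>2) = 1 / S i * m i" for i using S0[of i] by (simp add: power2_eq_square)
    then show ?thesis
      using coercive[of "\<lambda>i x. (1 / S i) *\<^sub>R g\<mu> i x", OF VL2_scaleR[OF g\<mu>L]] g\<Theta>0
      unfolding scale by (simp add: g\<Theta>_def)
  qed
  from mult_left_mono[OF this, of M\<^sub>0] params(2)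
  have second: "- M\<^sub>0 * (\<Sum>i\<in>UNIV. 1 / S i * m i) \<le> - M\<^sub>0 * S_low * (\<Sum>i\<in>UNIV. m i / (S i)\<^sup>2)"
    by (simp add: mult.assoc)
  show ?thesis using first second unfolding m_def by blast
qed

end
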